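(* Let $\Lambda$ be an admissible sequence. For $n\in\mathbb{N}$ let $\alpha=\alpha(n)>0$ be the solution of $n=\sum_{\lambda\in\Lambda}\frac{\lambda}{e^{\alpha\lambda}-1}$. Then, as $n\to\infty$, $$t_\Lambda^0(n)=\bigl(2\pi\mu_0(\mu_0+1)\zeta_R(\mu_0+1)A_{-\mu_0}\bigr)^{-\frac12}\,\alpha^{\frac{\mu_0}{2}+1-A_0}\,\exp\left[\sum_{i=0}^{d}\frac{\mu_i+1}{\alpha^{\mu_i}}\zeta_R(\mu_i+1)A_{-\mu_i}+A_0+\zeta_\Lambda'(0)\right]\,[1+o(1)].$$
   Context: A sequence $\Lambda$ is called admissible if it is a nondecreasing sequence of positive integers (the same integer may occur finitely many times; all sums and products over $\lambda\in\Lambda$ count multiplicity) such that: (i) $1\in\Lambda$; (ii) $\Theta(t)=\sum_{\lambda\in\Lambda}e^{-\lambda t}$ converges for all $t>0$; (iii) as $t\to0^+$, $\Theta$ admits a full asymptotic expansion $\Theta(t)\sim\sum_{n\ge0}A_{i_n}t^{i_n}$ with real exponents $i_0<i_1<i_2<\cdots$, $i_n\to\infty$, $i_0<0$ and $A_{i_0}\neq0$. Thus $A_x$ is the coefficient of $t^x$ in the expansion, with $A_x=0$ if $t^x$ does not occur; in particular $A_0$ is the coefficient of $t^0$. Write $\mu_n=-i_n$, and let $\mu_0>\mu_1>\dots>\mu_d>0$ be the positive ones among the $\mu_n$. Let $\zeta_\Lambda(s)=\sum_{\lambda\in\Lambda}\lambda^{-s}$ for $\Re s>\mu_0$, also denoting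 its meromorphic continuation to $\mathbb{C}$ (which is regular at $s=0$). $\zeta_R$ is the Riemann zeta-function. Let $p_\Lambda(n,m)$ be the number of partitions of $n$ into $m$ summands from $\Lambda$, where repetition of summands is allowed and equal integers occupying different positions of $\Lambda$ are regarded as different; that is, $\prod_{\lambda\in\Lambda}(1-zx^\lambda)^{-1}=\sum_{n,m\ge0}p_\Lambda(n,m)x^nz^m$. For $n\ge1$ set $t_\Lambda^0(n)=\sum_{m\ge0}p_\Lambda(n,m)$, the number of partitions of $n$ over $\Lambda$. *)

theory Defs
  imports
    "HOL-Complex_Analysis.Complex_Analysis"
    "HOL-Library.Landau_Symbols"
    "HOL-Library.Multiset"
begin

definition theta :: "(nat \<Rightarrow> nat) \<Rightarrow> real \<Rightarrow> real" where
  "theta \<Lambda> t = (\<Sum>j. exp (- (real (\<Lambda> j) * t)))"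

text \<open>
  A sequence is indexed by all natural numbers: a finite one has bounded \<open>theta\<close>, which
  the exponent \<open>i 0 < 0\<close> with nonzero coefficient excludes.
  The exponents \<open>i\<close> and the coefficient function \<open>A\<close> (\<open>A x\<close> is the coefficient of
  \<open>t powr x\<close>, and \<open>0\<close> if \<open>x\<close> is not an exponent) are data of the predicate. Later
  coefficients may vanish, so that expansions with finitely many terms are covered.
\<close>
definition admissible :: "(nat \<Rightarrow> nat) \<Rightarrow> (nat \<Rightarrow> real) \<Rightarrow> (real \<Rightarrow> real) \<Rightarrow> bool" where
  "admissible \<Lambda> i A \<longleftrightarrow>
     mono \<Lambda> \<and> (\<forall>j. 0 < \<Lambda> j) \<and> (\<forall>k. finite {j. \<Lambda> j = k}) \<and>
     1 \<in> range \<Lambda> \<and>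
     (\<forall>t>0. summable (\<lambda>j. exp (- (real (\<Lambda> j) * t)))) \<and>
     strict_mono i \<and> filterlim i at_top sequentially \<and>
     i 0 < 0 \<and> A (i 0) \<noteq> 0 \<and> (\<forall>x. x \<notin> range i \<longrightarrow> A x = 0) \<and>
     (\<forall>N. (\<lambda>t. theta \<Lambda> t - (\<Sum>n\<le>N. A (i n) * t powr i n)) \<in> o[at_right 0](\<lambda>t. t powr i N))"

text \<open>
  \<open>zeta_seq \<Lambda> \<sigma>\<close> is the meromorphic continuation to the whole plane of the Dirichlet series
  on \<open>Re s > \<sigma>\<close>; asking for a \<^emph>\<open>nicely\<close> meromorphic function fixes the values at
  removable singularities and at poles, and thus makes it unique.
\<close>
definition zeta_seq :: "(nat \<Rightarrow> nat) \<Rightarrow> real \<Rightarrow> complex \<Rightarrow> complex" where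
  "zeta_seq \<Lambda> \<sigma> = (THE Z. Z nicely_meromorphic_on UNIV \<and>
     (\<forall>s. Re s > \<sigma> \<longrightarrow> (\<lambda>j. of_nat (\<Lambda> j) powr (- s)) sums Z s))"

text \<open>The Riemann zeta-function, for real arguments greater than \<open>1\<close> only.\<close>
definition riemann_zeta :: "real \<Rightarrow> real" where
  "riemann_zeta x = (\<Sum>k. real (Suc k) powr (- x))"

text \<open>
  A partition is a finite multiset of positions of the sequence, so that equal integers in
  different positions are distinguished.
\<close>
definition partitions_into :: "(nat \<Rightarrow> nat) \<Rightarrow> nat \<Rightarrow> nat \<Rightarrow> nat" where
  "partitions_into \<Lambda> n m = card {M :: nat multiset. size M = m \<and> (\<Sum>j\<in>#M. \<Lambda> j) = n}"

text \<open>Only the terms with \<open>m \<le> n\<close> can be nonzero if all members of the sequence are positive.\<close>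
definition num_partitions :: "(nat \<Rightarrow> nat) \<Rightarrow> nat \<Rightarrow> nat" where
  "num_partitions \<Lambda> n = (\<Sum>m. partitions_into \<Lambda> n m)"

definition saddle :: "(nat \<Rightarrow> nat) \<Rightarrow> nat \<Rightarrow> real" where
  "saddle \<Lambda> n = (THE \<alpha>. \<alpha> > 0 \<and>
     (\<lambda>j. real (\<Lambda> j) / (exp (\<alpha> * real (\<Lambda> j)) - 1)) sums real n)"

end

(*
  The saddle point method. Taking logarithms in the product, the generating function at exp (-a)
  is exp (SUM k. Theta (k a) / k). The exponents - mu_i of Theta contribute zeta_R (mu_i + 1) a^(- mu_i)
  to this sum; the remainder R of Theta, made to vanish at 0 by subtracting A_0 exp (-t), gives a
  Riemann sum for the integral of R (t) / t. That integral is zeta_Lambda' (0), since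
  Gamma (s) zeta_Lambda (s) = A_0 Gamma (s) + INT R (t) t^(s - 1) dt for s near 0.

  On the circle of radius exp (-a), with a the saddle point, the quotient by the value at the real
  point is at most exp (- G y) in modulus at the angle y, where
  G y = SUM exp (- lambda a) (1 - cos (lambda y)). Near the real axis a Taylor expansion and dominated
  convergence give the Gaussian integral. Away from it no arithmetic information on the sequence is
  needed: as G (x - y) <= 2 G x + 2 G y, the integral of exp (- G) over any interval is at most that of
  exp (- G / 4) over an interval around 0. The number of these intervals costs a power of ln (1 / a),
  which is made up for by a factor a / |y| that comes from 1 being a member of the sequence.
*)
theory Submission
  imports Defs "HOL-Probability.Characteristic_Functions" "HOL-Probability.Distributions"
    "HOL-Real_Asymp.Real_Asymp"
begin

subsection \<open>The generating function as an infinite product\<close>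

text \<open>The generating function need not be uniformly small away from the real axis. For the
  sequence of 1 and all even numbers, only the factor of 1 changes its modulus at the angle pi, so
  \<open>gap\<close> stays bounded there as \<alpha> tends to 0: there is a second peak as wide as
  the main one, lowered by that single factor alone. So no pointwise bound in terms of
  \<open>gap\<close> can suffice, and integrals over whole intervals are compared instead.

  The exponent must be known up to o(1), not merely to leading order. It contains n * \<alpha>,
  which at the saddle point is an expression in the derivative of theta, and an asymptotic expansion
  may not be differentiated term by term in general. A difference quotient makes this possible at
  the price of more than half the order of the remainder, which a full expansion can afford. The
  expansion of n * \<alpha> turns each coefficient of the logarithm into \<mu> + 1 times itself and
  contributes the summand \<open>A 0\<close>.\<close>

lemma finite_multisets_bounded:
  assumes "finite A"
  shows "finite {M. set_mset M \<subseteq> A \<and> size M \<le> n}"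
proof -
  have "{M. set_mset M \<subseteq> A \<and> size M \<le> n} \<subseteq> mset ` {xs. set xs \<subseteq> A \<and> length xs \<le> n}"
  proof
    fix M assume M: "M \<in> {M. set_mset M \<subseteq> A \<and> size M \<le> n}"
    obtain xs where "mset xs = M" using ex_mset by blast
    then show "M \<in> mset ` {xs. set xs \<subseteq> A \<and> length xs \<le> n}" using M by force
  qed
  then show ?thesis
    using finite_lists_length_le[OF assms] finite_subset by blast
qed

locale pos_seq =
  fixes \<Lambda> :: "nat \<Rightarrow> nat"
  assumes pos: "0 < \<Lambda> j"
    and finite_fibers: "finite {j. \<Lambda> j = k}"
begin

lemma finite_le: "finite {j. \<Lambda> j \<le> n}"
proof -
  have "{j. \<Lambda> j \<le> n} = (\<Union>k\<le>n. {j. \<Lambda> j = k})" by auto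
  then show ?thesis using finite_fibers by simp
qed

lemma size_le_weight: "size M \<le> (\<Sum>j\<in>#M. \<Lambda> j)"
proof (induction M)
  case (add x M)
  then show ?case using pos[of x] by simp
qed simp

text \<open>With only the first J positions allowed the generating function is a finite product, and
  for fixed n the count no longer depends on J once J is large.\<close>

definition bounded_parts :: "nat \<Rightarrow> nat \<Rightarrow> nat multiset set" where
  "bounded_parts J n = {M. set_mset M \<subseteq> {..<J} \<and> (\<Sum>j\<in>#M. \<Lambda> j) = n}"

lemma finite_bounded_parts: "finite (bounded_parts J n)"
  by (rule finite_subset[OF _ finite_multisets_bounded[of "{..<J}" n]])
     (use size_le_weight in \<open>auto simp: bounded_parts_def\<close>)

lemma parts_eq_bounded_parts:
  assumes "{j. \<Lambda> j \<le> n} \<subseteq> {..<J}"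
  shows "{M. (\<Sum>j\<in>#M. \<Lambda> j) = n} = bounded_parts J n"
proof -
  have "set_mset M \<subseteq> {..<J}" if "(\<Sum>j\<in>#M. \<Lambda> j) = n" for M
  proof
    fix j assume "j \<in># M"
    then obtain M' where "M = add_mset j M'" by (meson multi_member_split)
    then have "\<Lambda> j \<le> n" using that by simp
    then show "j \<in> {..<J}" using assms by blast
  qed
  then show ?thesis by (auto simp: bounded_parts_def)
qed

lemma ex_le_subset_lessThan: "\<exists>J. {j. \<Lambda> j \<le> n} \<subseteq> {..<J}"
  using finite_le[of n] finite_nat_bounded by blast

lemma finite_parts: "finite {M. (\<Sum>j\<in>#M. \<Lambda> j) = n}"
  using ex_le_subset_lessThan[of n] parts_eq_bounded_parts finite_bounded_parts by metis

lemma num_partitions_eq_card: "num_partitions \<Lambda> n = card {M. (\<Sum>j\<in>#M. \<Lambda> j) = n}"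
proof -
  let ?S = "\<lambda>m. {M. size M = m \<and> (\<Sum>j\<in>#M. \<Lambda> j) = n}"
  have "partitions_into \<Lambda> n m = 0" if "m \<notin> {..n}" for m
  proof -
    have "?S m = {}" using that size_le_weight by force
    then show ?thesis unfolding partitions_into_def by (simp only: card.empty)
  qed
  then have "num_partitions \<Lambda> n = (\<Sum>m\<le>n. partitions_into \<Lambda> n m)"
    unfolding num_partitions_def by (intro suminf_finite) auto
  also have "\<dots> = card (\<Union>m\<le>n. ?S m)"
    unfolding partitions_into_def
    by (intro card_UN_disjoint[symmetric] ballI finite_subset[OF _ finite_parts[of n]]) auto
  also have "(\<Union>m\<le>n. ?S m) = {M. (\<Sum>j\<in>#M. \<Lambda> j) = n}"
    using size_le_weight by auto
  finally show ?thesis .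
qed

text \<open>The cases are whether position J occurs. If it does, removing one copy leaves a multiset
  that may still contain J, hence \<open>Suc J\<close> on the right. For generating functions this
  is multiplication by 1 / (1 - x ^ \<Lambda> J).\<close>

lemma card_bounded_parts_Suc:
  "card (bounded_parts (Suc J) n) = card (bounded_parts J n) +
     (if \<Lambda> J \<le> n then card (bounded_parts (Suc J) (n - \<Lambda> J)) else 0)"
proof -
  let ?B = "{M. set_mset M \<subseteq> {..<Suc J} \<and> J \<in># M \<and> (\<Sum>j\<in>#M. \<Lambda> j) = n}"
  have split: "bounded_parts (Suc J) n = bounded_parts J n \<union> ?B"
    by (auto simp: bounded_parts_def lessThan_Suc)
  have fin: "finite ?B" by (rule finite_subset[OF _ finite_bounded_parts[of "Suc J" n]])
     (auto simp: bounded_parts_def)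
  have "bounded_parts J n \<inter> ?B = {}" by (auto simp: bounded_parts_def)
  then have 1: "card (bounded_parts (Suc J) n) = card (bounded_parts J n) + card ?B"
    unfolding split using finite_bounded_parts fin by (intro card_Un_disjoint) auto
  have "card ?B = (if \<Lambda> J \<le> n then card (bounded_parts (Suc J) (n - \<Lambda> J)) else 0)"
  proof (cases "\<Lambda> J \<le> n")
    case True
    have "?B = add_mset J ` bounded_parts (Suc J) (n - \<Lambda> J)"
    proof (intro equalityI subsetI)
      fix M assume M: "M \<in> ?B"
      then have "J \<in># M" by simp
      define M' where "M' = M - {#J#}"
      have M': "M = add_mset J M'" using \<open>J \<in># M\<close> by (simp add: M'_def)
      have "M' \<in> bounded_parts (Suc J) (n - \<Lambda> J)" using M unfolding bounded_parts_def M' by auto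
      then show "M \<in> add_mset J ` bounded_parts (Suc J) (n - \<Lambda> J)" using M' by blast
    qed (use True in \<open>auto simp: bounded_parts_def\<close>)
    then show ?thesis using True by (simp add: card_image inj_on_def)
  next
    case False
    have "?B = {}"
    proof (rule ccontr)
      assume "?B \<noteq> {}"
      then obtain M where M: "M \<in> ?B" by blast
      then have "J \<in># M" by simp
      define M' where "M' = M - {#J#}"
      have M': "M = add_mset J M'" using \<open>J \<in># M\<close> by (simp add: M'_def)
      show False using M False unfolding M' by simp
    qed
    then show ?thesis using False by (simp only: if_False card.empty)
  qed
  then show ?thesis using 1 by simp
qed

lemma bounded_parts_0: "bounded_parts 0 n = (if n = 0 then {{#}} else {})"
  by (auto simp: bounded_parts_def)

text \<open>Convergence must be known before the recurrence can be solved for the sum, so partial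
  sums are bounded first: with q = x ^ \<Lambda> J the recurrence bounds a partial sum S by a
  constant plus q * S, and q < 1.\<close>

lemma summable_bounded_parts:
  fixes x :: real
  assumes x: "0 \<le> x" "x < 1"
  shows "summable (\<lambda>n. real (card (bounded_parts J n)) * x ^ n)"
proof (induction J)
  case 0
  have "real (card (bounded_parts 0 n)) * x ^ n = (if n = 0 then 1 else 0)" for n
    by (simp add: bounded_parts_0)
  then show ?case by simp
next
  case (Suc J)
  let ?T = "\<lambda>J n. real (card (bounded_parts J n))"
  let ?q = "x ^ \<Lambda> J"
  have q: "?q < 1" using x pos[of J] by (simp add: power_less_one_iff)
  have bound: "(\<Sum>n<N. ?T (Suc J) n * x ^ n) \<le> (\<Sum>n. ?T J n * x ^ n) / (1 - ?q)" for N
  proof -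
    let ?S = "\<Sum>n<N. ?T (Suc J) n * x ^ n"
    have "?T (Suc J) n * x ^ n = ?T J n * x ^ n + (if \<Lambda> J \<le> n then ?T (Suc J) (n - \<Lambda> J) * x ^ n else 0)" for n
      by (subst card_bounded_parts_Suc) (simp add: algebra_simps)
    then have "?S = (\<Sum>n<N. ?T J n * x ^ n) +
        (\<Sum>n<N. if \<Lambda> J \<le> n then ?T (Suc J) (n - \<Lambda> J) * x ^ n else 0)"
      by (subst sum.distrib[symmetric]) (rule sum.cong[OF refl])
    also have "(\<Sum>n<N. if \<Lambda> J \<le> n then ?T (Suc J) (n - \<Lambda> J) * x ^ n else 0)
        = (\<Sum>n\<in>{\<Lambda> J..<N}. ?T (Suc J) (n - \<Lambda> J) * x ^ n)"
      by (intro sum.mono_neutral_cong_right) auto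
    also have "\<dots> = (\<Sum>n<N - \<Lambda> J. ?T (Suc J) n * x ^ (n + \<Lambda> J))"
      by (rule sum.reindex_bij_witness[of _ "\<lambda>n. n + \<Lambda> J" "\<lambda>n. n - \<Lambda> J"]) auto
    also have "\<dots> = ?q * (\<Sum>n<N - \<Lambda> J. ?T (Suc J) n * x ^ n)"
      by (simp add: sum_distrib_left power_add algebra_simps)
    also have "\<dots> \<le> ?q * ?S"
      using x by (intro mult_left_mono sum_mono2) auto
    also have "(\<Sum>n<N. ?T J n * x ^ n) \<le> (\<Sum>n. ?T J n * x ^ n)"
      using x by (intro sum_le_suminf Suc) auto
    finally have "?S * (1 - ?q) \<le> (\<Sum>n. ?T J n * x ^ n)" by (simp add: algebra_simps)
    then show ?thesis using q by (simp add: pos_le_divide_eq)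
  qed
  show ?case
    by (rule summableI_nonneg_bounded[OF _ bound]) (use x in auto)
qed

lemma sums_bounded_parts:
  fixes x :: complex
  assumes x: "norm x < 1"
  shows "(\<lambda>n. of_nat (card (bounded_parts J n)) * x ^ n) sums (\<Prod>j<J. 1 / (1 - x ^ \<Lambda> j))"
proof (induction J)
  case 0
  have eq: "of_nat (card (bounded_parts 0 n)) * x ^ n = (if n = 0 then 1 else 0)" for n
    by (simp add: bounded_parts_0)
  show ?case unfolding eq using sums_single[of 0 "\<lambda>_. 1::complex"] by simp
next
  case (Suc J)
  let ?T = "\<lambda>J n. of_nat (card (bounded_parts J n)) :: complex"
  have "norm (x ^ \<Lambda> J) < 1" using x pos[of J] by (simp add: norm_power power_less_one_iff)
  then have q: "x ^ \<Lambda> J \<noteq> 1" by force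
  have sm: "summable (\<lambda>n. ?T (Suc J) n * x ^ n)"
    by (rule summable_norm_cancel) (use summable_bounded_parts[of "norm x" "Suc J"] x
        in \<open>simp add: norm_mult norm_power\<close>)
  let ?S = "\<Sum>n. ?T (Suc J) n * x ^ n"
  have "(\<lambda>n. x ^ \<Lambda> J * (?T (Suc J) n * x ^ n)) sums (x ^ \<Lambda> J * ?S)"
    by (intro sums_mult summable_sums sm)
  then have "(\<lambda>n. (\<lambda>m. if \<Lambda> J \<le> m then ?T (Suc J) (m - \<Lambda> J) * x ^ m else 0) (n + \<Lambda> J)) sums (x ^ \<Lambda> J * ?S)"
    by (simp add: power_add mult_ac)
  \<comment> \<open>The terms with index below \<open>\<Lambda> J\<close> are 0, so the shift does
    not change the sum.\<close>
  then have "(\<lambda>m. if \<Lambda> J \<le> m then ?T (Suc J) (m - \<Lambda> J) * x ^ m else 0) sums (x ^ \<Lambda> J * ?S)"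
    by (subst (asm) sums_iff_shift) simp
  from sums_add[OF Suc this]
  have "(\<lambda>n. ?T J n * x ^ n + (if \<Lambda> J \<le> n then ?T (Suc J) (n - \<Lambda> J) * x ^ n else 0)) sums
      ((\<Prod>j<J. 1 / (1 - x ^ \<Lambda> j)) + x ^ \<Lambda> J * ?S)" .
  moreover have "?T (Suc J) n * x ^ n = ?T J n * x ^ n + (if \<Lambda> J \<le> n then ?T (Suc J) (n - \<Lambda> J) * x ^ n else 0)" for n
    by (subst card_bounded_parts_Suc) (simp add: algebra_simps)
  ultimately have "(\<lambda>n. ?T (Suc J) n * x ^ n) sums ((\<Prod>j<J. 1 / (1 - x ^ \<Lambda> j)) + x ^ \<Lambda> J * ?S)"
    by simp
  then have "?S = (\<Prod>j<J. 1 / (1 - x ^ \<Lambda> j)) + x ^ \<Lambda> J * ?S" by (simp add: sums_iff)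
  then have "?S = (\<Prod>j<Suc J. 1 / (1 - x ^ \<Lambda> j))" using q by (simp add: field_simps)
  then show ?case using sm by (simp add: sums_iff)
qed

lemma bounded_parts_le: "card (bounded_parts J n) \<le> num_partitions \<Lambda> n"
  unfolding num_partitions_eq_card by (rule card_mono[OF finite_parts]) (auto simp: bounded_parts_def)

lemma eventually_bounded_parts_eq:
  "\<forall>\<^sub>F J in sequentially. card (bounded_parts J n) = num_partitions \<Lambda> n"
proof -
  obtain J0 where "{j. \<Lambda> j \<le> n} \<subseteq> {..<J0}" using ex_le_subset_lessThan by blast
  then have "card (bounded_parts J n) = num_partitions \<Lambda> n" if "J \<ge> J0" for J
    unfolding num_partitions_eq_card
    using parts_eq_bounded_parts[of n J] that by fastforce
  then show ?thesis by (auto simp: eventually_sequentially)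
qed

text \<open>A partial sum involves finitely many n, so a single J gives all their coefficients
  exactly, and the finite product for that J is at most B.\<close>

lemma summable_num_partitions:
  fixes x :: real
  assumes x: "0 \<le> x" "x < 1" and B: "\<And>J. (\<Prod>j<J. 1 / (1 - x ^ \<Lambda> j)) \<le> B"
  shows "summable (\<lambda>n. real (num_partitions \<Lambda> n) * x ^ n)"
proof (rule summableI_nonneg_bounded)
  fix N :: nat
  have "\<forall>\<^sub>F J in sequentially. \<forall>n\<in>{..<N}. card (bounded_parts J n) = num_partitions \<Lambda> n"
    by (intro eventually_ball_finite ballI eventually_bounded_parts_eq) auto
  then obtain J where J: "\<And>n. n < N \<Longrightarrow> card (bounded_parts J n) = num_partitions \<Lambda> n"
    by (auto simp: eventually_sequentially)
  have "(\<lambda>n. complex_of_real (real (card (bounded_parts J n)) * x ^ n)) sums complex_of_real (\<Prod>j<J. 1 / (1 - x ^ \<Lambda> j))"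
    using sums_bounded_parts[of "of_real x" J] x by simp
  then have s: "(\<lambda>n. real (card (bounded_parts J n)) * x ^ n) sums (\<Prod>j<J. 1 / (1 - x ^ \<Lambda> j))"
    by (rule sums_of_real_iff[THEN iffD1])
  have "(\<Sum>n<N. real (num_partitions \<Lambda> n) * x ^ n) = (\<Sum>n<N. real (card (bounded_parts J n)) * x ^ n)"
    using J by simp
  also have "\<dots> \<le> (\<Sum>n. real (card (bounded_parts J n)) * x ^ n)"
    using x s by (intro sum_le_suminf) (auto simp: sums_iff)
  also have "\<dots> \<le> B" using s B[of J] by (simp add: sums_iff)
  finally show "(\<Sum>n<N. real (num_partitions \<Lambda> n) * x ^ n) \<le> B" .
qed (use x in auto)

theorem sums_num_partitions:
  fixes x :: complex
  assumes x: "norm x < 1" and B: "\<And>J. (\<Prod>j<J. 1 / (1 - norm x ^ \<Lambda> j)) \<le> B"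
    and F: "(\<lambda>J. \<Prod>j<J. 1 / (1 - x ^ \<Lambda> j)) \<longlonglongrightarrow> F"
  shows "(\<lambda>n. of_nat (num_partitions \<Lambda> n) * x ^ n) sums F"
proof -
  have sm: "summable (\<lambda>n. real (num_partitions \<Lambda> n) * norm x ^ n)"
    by (rule summable_num_partitions[OF _ x B]) auto
  \<comment> \<open>The coefficients stabilise as J grows and are dominated by the full series at
    \<open>norm x\<close>, so limit and sum may be exchanged.\<close>
  have "(\<lambda>J. \<Sum>n. of_nat (card (bounded_parts J n)) * x ^ n) \<longlonglongrightarrow> (\<Sum>n. of_nat (num_partitions \<Lambda> n) * x ^ n)"
  proof (rule tannerys_theorem[THEN conjunct2, THEN conjunct2, OF _ _ sm])
    fix n
    show "(\<lambda>J. of_nat (card (bounded_parts J n)) * x ^ n) \<longlonglongrightarrow> of_nat (num_partitions \<Lambda> n) * x ^ n"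
      by (rule tendsto_eventually) (use eventually_bounded_parts_eq[of n] in eventually_elim, simp)
  next
    show "\<forall>\<^sub>F (n, J) in sequentially \<times>\<^sub>F sequentially.
       norm (of_nat (card (bounded_parts J n)) * x ^ n) \<le> real (num_partitions \<Lambda> n) * norm x ^ n"
      by (intro always_eventually) (auto simp: norm_mult norm_power bounded_parts_le intro!: mult_right_mono)
  qed auto
  moreover have "(\<Sum>n. of_nat (card (bounded_parts J n)) * x ^ n) = (\<Prod>j<J. 1 / (1 - x ^ \<Lambda> j))" for J
    using sums_bounded_parts[OF x] by (simp add: sums_iff)
  ultimately have "(\<Sum>n. of_nat (num_partitions \<Lambda> n) * x ^ n) = F"
    using F LIMSEQ_unique by simp
  moreover have "summable (\<lambda>n. of_nat (num_partitions \<Lambda> n) * x ^ n)"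
    by (rule summable_norm_cancel) (use sm in \<open>simp add: norm_mult norm_power\<close>)
  ultimately show ?thesis by (simp add: sums_iff)
qed

end

subsection \<open>Fourier coefficients\<close>

lemma integral_cis_nat_diff:
  "((\<lambda>t. cis (real n * t) * cis (- (real m * t))) has_integral (if m = n then 2 * pi else 0)) {-pi..pi}"
proof (cases "m = n")
  case True
  then have "(\<lambda>t. cis (real n * t) * cis (- (real m * t))) = (\<lambda>t. 1)" by (simp add: cis_mult)
  then show ?thesis using True has_integral_const_real[of "1::complex" "-pi" pi]
    by (simp add: scaleR_conv_of_real)
next
  case False
  define k where "k = real n - real m"
  have k: "k \<noteq> 0" using False by (simp add: k_def)
  have "((\<lambda>t. cis (k * t)) has_integral (cis (k * pi) / (\<i> * k) - cis (k * (-pi)) / (\<i> * k))) {-pi..pi}"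
  proof (rule fundamental_theorem_of_calculus)
    fix t
    have "((\<lambda>z. exp (\<i> * k * z) / (\<i> * k)) has_field_derivative exp (\<i> * k * of_real t)) (at (of_real t))"
      using k by (auto intro!: derivative_eq_intros)
    from has_vector_derivative_real_field[OF this]
    show "((\<lambda>t. cis (k * t) / (\<i> * k)) has_vector_derivative cis (k * t)) (at t within {-pi..pi})"
      by (simp add: cis_conv_exp mult_ac)
  qed simp
  moreover have "cis (k * pi) = cis (k * (- pi))"
  proof -
    have "sin (k * pi) = 0" unfolding k_def left_diff_distrib sin_diff by simp
    then show ?thesis by (simp add: complex_eq_iff)
  qed
  moreover have "cis (real n * t) * cis (- (real m * t)) = cis (k * t)" for t
    by (simp add: cis_mult k_def left_diff_distrib)
  ultimately show ?thesis using False by simp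
qed

text \<open>The sign in \<open>cis (- (real m * t))\<close> fits the powers of exp (- (\<alpha> +
  \<i> t)). Absolute summability makes the series uniformly convergent, so orthogonality applies
  term by term.\<close>

lemma fourier_coefficient_integral:
  fixes d :: "nat \<Rightarrow> complex"
  assumes "summable (\<lambda>m. norm (d m))"
  shows "((\<lambda>t. cis (real n * t) * (\<Sum>m. d m * cis (- (real m * t)))) has_integral (2 * pi * d n)) {-pi..pi}"
proof -
  let ?f = "\<lambda>N t. \<Sum>m<N. cis (real n * t) * (d m * cis (- (real m * t)))"
  have ul: "uniform_limit {-pi..pi} ?f (\<lambda>t. \<Sum>m. cis (real n * t) * (d m * cis (- (real m * t)))) sequentially"
    by (rule Weierstrass_m_test[OF _ assms]) (simp add: norm_mult)
  obtain I J where I: "\<And>N. (?f N has_integral I N) {-pi..pi}"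
    and J: "((\<lambda>t. \<Sum>m. cis (real n * t) * (d m * cis (- (real m * t)))) has_integral J) {-pi..pi}"
    and lim: "I \<longlonglongrightarrow> J"
    by (rule uniform_limit_integral[OF ul]) (auto intro!: continuous_intros)
  have "I N = (\<Sum>m<N. if m = n then 2 * pi * d m else 0)" for N
  proof (rule has_integral_unique[OF I])
    have "((\<lambda>t. d m * (cis (real n * t) * cis (- (real m * t)))) has_integral (d m * (if m = n then 2 * pi else 0))) {-pi..pi}" for m
      by (intro has_integral_mult_right integral_cis_nat_diff)
    then have "((\<lambda>t. \<Sum>m<N. d m * (cis (real n * t) * cis (- (real m * t)))) has_integral (\<Sum>m<N. d m * (if m = n then 2 * pi else 0))) {-pi..pi}"
      by (intro has_integral_sum) auto
    moreover have "(\<Sum>m<N. d m * (if m = n then 2 * pi else 0)) = (\<Sum>m<N. if m = n then 2 * pi * d m else 0)"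
      by (intro sum.cong) auto
    ultimately show "(?f N has_integral (\<Sum>m<N. if m = n then 2 * pi * d m else 0)) {-pi..pi}"
      by (simp add: mult_ac)
  qed
  then have "\<forall>\<^sub>F N in sequentially. I N = 2 * pi * d n"
    by (intro eventually_mono[OF eventually_gt_at_top[of n]]) simp
  then have "J = 2 * pi * d n"
    using lim tendsto_eventually LIMSEQ_unique by blast
  moreover have "(\<Sum>m. cis (real n * t) * (d m * cis (- (real m * t)))) = cis (real n * t) * (\<Sum>m. d m * cis (- (real m * t)))" for t
    by (rule suminf_mult) (rule summable_norm_cancel, use assms in \<open>simp add: norm_mult\<close>)
  ultimately show ?thesis using J by simp
qed

subsection \<open>Bounds by powers\<close>

lemma power_le_fact_exp:
  assumes "0 \<le> (x::real)"
  shows "x ^ n \<le> fact n * exp x"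
proof -
  have "(\<lambda>k. x ^ k /\<^sub>R fact k) sums exp x" by (rule exp_converges)
  then have "(\<Sum>k\<in>{n}. x ^ k /\<^sub>R fact k) \<le> exp x"
    using assms sum_le_suminf[of "\<lambda>k. x ^ k /\<^sub>R fact k" "{n}"] by (auto simp: sums_iff)
  then show ?thesis by (simp add: field_simps)
qed

text \<open>The function x powr p * exp (- x) is greatest at x = p; the proof is ln y \<le> y - 1
  for y = x / p.\<close>

lemma powr_le_exp:
  assumes "0 < (x::real)" "0 < p"
  shows "x powr p \<le> p powr p * exp (x - p)"
proof -
  have "p * ln (x / p) \<le> p * (x / p - 1)"
    using assms ln_le_minus_one[of "x / p"] by (intro mult_left_mono) auto
  then have "p * ln x \<le> p * ln p + (x - p)"
    using assms by (simp add: ln_div algebra_simps)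
  then show ?thesis using assms by (simp add: powr_def flip: exp_add)
qed

lemma powr_bigo_at_right_0:
  assumes "b \<le> a"
  shows "(\<lambda>t. t powr a) \<in> O[at_right (0::real)](\<lambda>t. t powr b)"
proof (rule bigoI[where c = 1])
  have "\<forall>\<^sub>F t in at_right (0::real). t < 1" using eventually_at_right_less by (simp add: eventually_at_right_field) (use zero_less_one in blast)
  moreover have "\<forall>\<^sub>F t in at_right (0::real). 0 < t" by (simp add: eventually_at_right_less)
  ultimately show "\<forall>\<^sub>F t in at_right (0::real). norm (t powr a) \<le> 1 * norm (t powr b)"
    by eventually_elim (use assms in \<open>auto intro: powr_mono'\<close>)
qed

lemma tendsto_powr_at_right_0:
  assumes "0 < (p::real)"
  shows "((\<lambda>x. x powr p) \<longlongrightarrow> 0) (at_right 0)"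
proof -
  have "((\<lambda>x. x powr p) \<longlongrightarrow> 0 powr p) (at_right 0)"
    using assms by (intro tendsto_powr' tendsto_const tendsto_ident_at)
      (auto simp: less_imp_le eventually_mono[OF eventually_at_right_less])
  then show ?thesis by simp
qed

lemma bigo_powr_at_right_0E:
  assumes "f \<in> O[at_right (0::real)](\<lambda>t. t powr a)"
  obtains C e where "C > 0" "e > 0" "\<And>t. 0 < t \<Longrightarrow> t < e \<Longrightarrow> \<bar>f t :: real\<bar> \<le> C * t powr a"
proof -
  obtain C where C: "C > 0" "\<forall>\<^sub>F t in at_right 0. norm (f t) \<le> C * norm (t powr a)"
    using assms by (rule landau_o.bigE)
  then obtain e where "e > 0" "\<And>t. 0 < t \<Longrightarrow> t < e \<Longrightarrow> norm (f t) \<le> C * norm (t powr a)"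
    by (auto simp: eventually_at_right_field)
  then show ?thesis using C(1) that by simp
qed

text \<open>
  Landau's trick: a power bound for a function and for its second derivative gives one for the
  derivative, by the difference quotient with step \<open>t powr (K + b)\<close>.
\<close>
lemma derivative_bigo_at_right_0:
  fixes r r' r'' :: "real \<Rightarrow> real"
  assumes r: "\<And>t. 0 < t \<Longrightarrow> (r has_real_derivative r' t) (at t)"
    and r': "\<And>t. 0 < t \<Longrightarrow> (r' has_real_derivative r'' t) (at t)"
    and bound: "r \<in> O[at_right 0](\<lambda>t. t powr (2 * K + b))"
    and bound'': "r'' \<in> O[at_right 0](\<lambda>t. t powr (- b))"
    and b: "0 \<le> b" and K: "1 \<le> K + b" "0 \<le> 2 * K + b"
  shows "r' \<in> O[at_right 0](\<lambda>t. t powr K)"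
proof -
  obtain C e where C: "C > 0" "e > 0" and r_le: "\<And>t. 0 < t \<Longrightarrow> t < e \<Longrightarrow> \<bar>r t\<bar> \<le> C * t powr (2 * K + b)"
    using bigo_powr_at_right_0E[OF bound] by blast
  obtain D e' where D: "D > 0" "e' > 0" and r''_le: "\<And>t. 0 < t \<Longrightarrow> t < e' \<Longrightarrow> \<bar>r'' t\<bar> \<le> D * t powr (- b)"
    using bigo_powr_at_right_0E[OF bound''] by blast
  \<comment> \<open>As h \<le> t below, all points used lie within 2 * t, so t < d keeps them in the
    range of both bounds.\<close>
  define d where "d = min 1 (min e e' / 2)"
  have d: "d > 0" "d \<le> 1" "2 * d \<le> e" "2 * d \<le> e'" using C D by (auto simp: d_def)
  define E where "E = C * (2 powr (2 * K + b) + 1) + D"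
  have "\<bar>r' t\<bar> \<le> E * t powr K" if t: "0 < t" "t < d" for t
  proof -
    \<comment> \<open>This step balances the two errors: t powr (2 * K + b) / h and h * t powr (- b)
      are both t powr K.\<close>
    define h where "h = t powr (K + b)"
    have "h \<le> t powr 1" unfolding h_def using t d K by (intro powr_mono') auto
    then have h: "0 < h" "h \<le> t" using t by (auto simp: h_def)
    obtain x where x: "t < x" "x < t + h" "r (t + h) - r t = (t + h - t) * r' x"
      using MVT2[of t "t + h" r r'] r t h by force
    obtain y where y: "t < y" "y < x" "r' x - r' t = (x - t) * r'' y"
      using MVT2[of t x r' r''] r' t h x by force
    have "\<bar>r'' y\<bar> \<le> D * y powr (- b)" using y x t d h by (intro r''_le) auto
    also have "\<dots> \<le> D * t powr (- b)"
      using y t b D by (intro mult_left_mono powr_mono2') auto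
    finally have "\<bar>r' x - r' t\<bar> \<le> h * (D * t powr (- b))"
      unfolding y(3) abs_mult using x y by (intro mult_mono) auto
    also have "\<dots> = D * t powr K" by (simp add: h_def flip: powr_add)
    finally have 1: "\<bar>r' x - r' t\<bar> \<le> D * t powr K" .
    have "\<bar>r (t + h)\<bar> \<le> C * (t + h) powr (2 * K + b)" using t d h by (intro r_le) auto
    also have "\<dots> \<le> C * (2 * t) powr (2 * K + b)"
      using t h K C by (intro mult_left_mono powr_mono2) auto
    finally have "\<bar>r (t + h)\<bar> \<le> C * 2 powr (2 * K + b) * t powr (2 * K + b)"
      using t by (simp add: powr_mult mult_ac)
    moreover have "\<bar>r t\<bar> \<le> C * t powr (2 * K + b)" using t d by (intro r_le) auto
    ultimately have "\<bar>r (t + h) - r t\<bar> \<le> C * (2 powr (2 * K + b) + 1) * t powr (2 * K + b)"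
      by (simp add: algebra_simps)
    also have "t powr (2 * K + b) = h * t powr K" by (simp add: h_def flip: powr_add)
    finally have "h * \<bar>r' x\<bar> \<le> h * (C * (2 powr (2 * K + b) + 1) * t powr K)"
      using x h by (simp add: abs_mult mult_ac)
    then have "\<bar>r' x\<bar> \<le> C * (2 powr (2 * K + b) + 1) * t powr K" using h by simp
    then show ?thesis using 1 by (simp add: E_def algebra_simps)
  qed
  then have "\<forall>\<^sub>F t in at_right 0. norm (r' t) \<le> E * norm (t powr K)"
    using d(1) by (auto simp: eventually_at_right_field)
  then show ?thesis by (rule bigoI)
qed

subsection \<open>The expansion of theta and its derivatives\<close>

locale admissible_seq =
  fixes \<Lambda> :: "nat \<Rightarrow> nat" and i :: "nat \<Rightarrow> real" and A :: "real \<Rightarrow> real"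
  assumes admissible: "admissible \<Lambda> i A"
begin

sublocale pos_seq \<Lambda>
  using admissible by unfold_locales (auto simp: admissible_def)

abbreviation "\<mu>0 \<equiv> - i 0"

lemma one_in_range: "\<exists>j. \<Lambda> j = 1"
  using admissible unfolding admissible_def image_iff by (metis UNIV_I imageE)

lemma one_le: "1 \<le> real (\<Lambda> j)"
  using pos[of j] by simp

lemma summable_theta: "0 < t \<Longrightarrow> summable (\<lambda>j. exp (- (real (\<Lambda> j) * t)))"
  and strict_mono_i: "strict_mono i"
  and filterlim_i: "filterlim i at_top sequentially"
  and \<mu>0_pos: "0 < \<mu>0"
  and A_i_0_nonzero: "A (i 0) \<noteq> 0"
  and A_eq_0: "x \<notin> range i \<Longrightarrow> A x = 0"
  and theta_expansion:
    "(\<lambda>t. theta \<Lambda> t - (\<Sum>n\<le>N. A (i n) * t powr i n)) \<in> o[at_right 0](\<lambda>t. t powr i N)"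
  using admissible by (auto simp: admissible_def)

lemma i_0_le: "i 0 \<le> i n"
  using strict_mono_i by (simp add: strict_mono_less_eq)

definition moment :: "nat \<Rightarrow> real \<Rightarrow> real" where
  "moment q t = (\<Sum>j. real (\<Lambda> j) ^ q * exp (- (real (\<Lambda> j) * t)))"

lemma theta_eq_moment: "theta \<Lambda> t = moment 0 t"
  by (simp add: theta_def moment_def)

text \<open>Half of the exponent absorbs the power: y ^ q \<le> fact q * exp y, where y is half of
  \<Lambda> j * t.\<close>

lemma moment_term_le:
  assumes "0 < t"
  shows "real (\<Lambda> j) ^ q * exp (- (real (\<Lambda> j) * t)) \<le> fact q * (2 / t) ^ q * exp (- (real (\<Lambda> j) * (t / 2)))"
proof -
  define y where "y = real (\<Lambda> j) * (t / 2)"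
  have "y \<ge> 0" using assms by (simp add: y_def)
  have "real (\<Lambda> j) ^ q * exp (- (real (\<Lambda> j) * t)) = (2 / t) ^ q * y ^ q * exp (- y) * exp (- y)"
    using assms by (simp add: y_def power_mult_distrib power_divide flip: exp_add)
  also have "\<dots> \<le> (2 / t) ^ q * (fact q * exp y) * exp (- y) * exp (- y)"
    using assms \<open>y \<ge> 0\<close> by (intro mult_right_mono mult_left_mono power_le_fact_exp) auto
  also have "\<dots> = fact q * (2 / t) ^ q * exp (- y)" by (simp add: exp_minus field_simps)
  finally show ?thesis by (simp add: y_def)
qed

lemma summable_moment:
  assumes "0 < t"
  shows "summable (\<lambda>j. real (\<Lambda> j) ^ q * exp (- (real (\<Lambda> j) * t)))"
  by (rule summable_comparison_test'[of "\<lambda>j. fact q * (2 / t) ^ q * exp (- (real (\<Lambda> j) * (t / 2)))"])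
    (use assms moment_term_le[OF assms] summable_theta[of "t / 2"] in \<open>auto intro!: summable_mult\<close>)

lemma moment_pos: "0 < t \<Longrightarrow> 0 < moment q t"
  unfolding moment_def by (rule suminf_pos[OF summable_moment]) (use pos in auto)

lemma moment_le_theta:
  assumes "0 < t"
  shows "moment q t \<le> fact q * (2 / t) ^ q * moment 0 (t / 2)"
proof -
  have "moment q t \<le> (\<Sum>j. fact q * (2 / t) ^ q * exp (- (real (\<Lambda> j) * (t / 2))))"
    unfolding moment_def using assms
    by (intro suminf_le moment_term_le summable_moment summable_mult summable_theta) auto
  also have "\<dots> = fact q * (2 / t) ^ q * moment 0 (t / 2)"
    unfolding moment_def using summable_theta[of "t / 2"] assms by (simp add: suminf_mult)
  finally show ?thesis .
qed

text \<open>Every member of the sequence is at least 1.\<close>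

lemma moment_0_exp_decay:
  assumes "0 < s" "s \<le> t"
  shows "moment 0 t \<le> exp (- (t - s)) * moment 0 s"
proof -
  have "exp (- (real (\<Lambda> j) * t)) \<le> exp (- (t - s)) * exp (- (real (\<Lambda> j) * s))" for j
  proof -
    have "1 * (t - s) \<le> real (\<Lambda> j) * (t - s)" using assms one_le by (intro mult_right_mono) auto
    then show ?thesis by (simp add: algebra_simps flip: exp_add)
  qed
  then have "moment 0 t \<le> (\<Sum>j. exp (- (t - s)) * exp (- (real (\<Lambda> j) * s)))"
    unfolding moment_def using assms by (simp, intro suminf_le summable_mult summable_theta) auto
  also have "\<dots> = exp (- (t - s)) * moment 0 s"
    unfolding moment_def using summable_theta[of s] assms by (simp add: suminf_mult)
  finally show ?thesis .
qed

lemma DERIV_moment: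
  assumes t: "0 < t"
  shows "(moment q has_real_derivative - moment (Suc q) t) (at t)"
proof -
  let ?S = "{t / 2<..}"
  have uc: "uniformly_convergent_on ?S (\<lambda>n x. \<Sum>j<n. - (real (\<Lambda> j) ^ Suc q * exp (- (real (\<Lambda> j) * x))))"
  proof (rule Weierstrass_m_test'[OF _ summable_moment[of "t / 2" "Suc q"]])
    fix n x assume "x \<in> ?S"
    then have "real (\<Lambda> n) * (t / 2) \<le> real (\<Lambda> n) * x" by (intro mult_left_mono) auto
    then show "norm (- (real (\<Lambda> n) ^ Suc q * exp (- (real (\<Lambda> n) * x)))) \<le> real (\<Lambda> n) ^ Suc q * exp (- (real (\<Lambda> n) * (t / 2)))"
      using t by (auto simp: abs_mult intro!: mult_left_mono)
  qed (use t in auto)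
  have "((\<lambda>x. \<Sum>j. real (\<Lambda> j) ^ q * exp (- (real (\<Lambda> j) * x))) has_field_derivative
      (\<Sum>j. - (real (\<Lambda> j) ^ Suc q * exp (- (real (\<Lambda> j) * t))))) (at t)"
    by (rule has_field_derivative_series'(2)[OF _ _ uc, where x0 = t])
      (use t in \<open>auto intro!: derivative_eq_intros summable_moment simp: interior_open\<close>)
  also have "(\<Sum>j. - (real (\<Lambda> j) ^ Suc q * exp (- (real (\<Lambda> j) * t)))) = - moment (Suc q) t"
    unfolding moment_def by (rule suminf_minus[OF summable_moment[OF t]])
  finally show ?thesis unfolding moment_def[abs_def] .
qed

lemma continuous_on_moment: "continuous_on {0<..} (moment q)"
  by (intro DERIV_continuous_on) (auto intro: DERIV_subset[OF DERIV_moment])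

definition main_part :: "nat \<Rightarrow> nat \<Rightarrow> real \<Rightarrow> real" where
  "main_part N q t = (\<Sum>n\<le>N. A (i n) * (\<Prod>l<q. i n - real l) * t powr (i n - real q))"

text \<open>\<open>(- 1) ^ q * moment q\<close> is the \<open>q\<close>-th derivative of theta, and \<open>main_part N q\<close> that of the
  first \<open>N + 1\<close> terms of its expansion.\<close>
definition rest :: "nat \<Rightarrow> nat \<Rightarrow> real \<Rightarrow> real" where
  "rest N q t = (- 1) ^ q * moment q t - main_part N q t"

lemma DERIV_rest:
  assumes "0 < t"
  shows "(rest N q has_real_derivative rest N (Suc q) t) (at t)"
proof -
  have "(main_part N q has_real_derivative main_part N (Suc q) t) (at t)"
    unfolding main_part_def using assms
    by (auto intro!: derivative_eq_intros sum.cong simp: algebra_simps)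
  then show ?thesis unfolding rest_def using DERIV_moment[OF assms, of q]
    by (auto intro!: derivative_eq_intros)
qed

lemma main_part_bigo: "main_part N q \<in> O[at_right 0](\<lambda>t. t powr (- (\<mu>0 + real q)))"
  unfolding main_part_def
proof (rule big_sum_in_bigo)
  fix n
  have "(\<lambda>t. t powr (i n - real q)) \<in> O[at_right 0](\<lambda>t. t powr (- (\<mu>0 + real q)))"
    using i_0_le[of n] by (intro powr_bigo_at_right_0) simp
  then show "(\<lambda>t. A (i n) * (\<Prod>l<q. i n - real l) * t powr (i n - real q)) \<in> O[at_right 0](\<lambda>t. t powr (- (\<mu>0 + real q)))"
    by simp
qed

lemma rest_0_smallo: "rest N 0 \<in> o[at_right 0](\<lambda>t. t powr i N)"
proof -
  have "rest N 0 = (\<lambda>t. theta \<Lambda> t - (\<Sum>n\<le>N. A (i n) * t powr i n))"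
    by (simp add: rest_def main_part_def theta_eq_moment fun_eq_iff)
  then show ?thesis using theta_expansion[of N] by simp
qed

lemma moment_0_bigo: "moment 0 \<in> O[at_right 0](\<lambda>t. t powr (- \<mu>0))"
proof -
  have "rest 0 0 \<in> O[at_right 0](\<lambda>t. t powr (- \<mu>0))"
    using landau_o.small_imp_big[OF rest_0_smallo[of 0]] by simp
  moreover have "main_part 0 0 \<in> O[at_right 0](\<lambda>t. t powr (- \<mu>0))"
    using main_part_bigo[of 0 0] by simp
  ultimately have "(\<lambda>t. rest 0 0 t + main_part 0 0 t) \<in> O[at_right 0](\<lambda>t. t powr (- \<mu>0))"
    by (rule sum_in_bigo)
  then show ?thesis by (simp add: rest_def)
qed

text \<open>The expansion concerns only t near 0. Further out the exponential decay is weakened to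
  the same power, because sums over all multiples of \<alpha> need one bound valid for every t >
  0.\<close>

lemma ex_moment_0_le: "\<exists>C>0. \<forall>t>0. moment 0 t \<le> C * t powr (- \<mu>0)"
proof -
  obtain C e where C: "C > 0" "e > 0" and le: "\<And>t. 0 < t \<Longrightarrow> t < e \<Longrightarrow> \<bar>moment 0 t\<bar> \<le> C * t powr (- \<mu>0)"
    using bigo_powr_at_right_0E[OF moment_0_bigo] by blast
  define D where "D = exp e * moment 0 e * \<mu>0 powr \<mu>0"
  have D: "D > 0" using C \<mu>0_pos by (simp add: D_def moment_pos)
  have "moment 0 t \<le> (C + D) * t powr (- \<mu>0)" if t: "0 < t" for t
  proof (cases "t < e")
    case True
    then have "moment 0 t \<le> C * t powr (- \<mu>0)" using le[of t] t by simp
    also have "\<dots> \<le> (C + D) * t powr (- \<mu>0)" using D by (intro mult_right_mono) auto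
    finally show ?thesis .
  next
    case False
    have "t powr \<mu>0 \<le> \<mu>0 powr \<mu>0 * exp t"
      using powr_le_exp[OF t \<mu>0_pos] \<mu>0_pos
      by (elim order_trans) (intro mult_left_mono, auto)
    then have *: "exp (- t) \<le> \<mu>0 powr \<mu>0 * t powr (- \<mu>0)"
      using t by (simp add: powr_minus exp_minus field_simps)
    have "moment 0 t \<le> exp (- (t - e)) * moment 0 e" using C False by (intro moment_0_exp_decay) auto
    also have "\<dots> = exp e * moment 0 e * exp (- t)" by (simp add: exp_diff exp_minus field_simps)
    also have "\<dots> \<le> exp e * moment 0 e * (\<mu>0 powr \<mu>0 * t powr (- \<mu>0))"
      using * moment_pos[of e 0] C by (intro mult_left_mono) auto
    also have "\<dots> = D * t powr (- \<mu>0)" by (simp add: D_def)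
    also have "\<dots> \<le> (C + D) * t powr (- \<mu>0)" using C by (intro mult_right_mono) auto
    finally show ?thesis .
  qed
  then show ?thesis using C D by (intro exI[of _ "C + D"]) auto
qed

lemma ex_moment_le: "\<exists>C>0. \<forall>t>0. moment q t \<le> C * t powr (- (\<mu>0 + real q))"
proof -
  obtain C where C: "C > 0" and le: "\<And>t. 0 < t \<Longrightarrow> moment 0 t \<le> C * t powr (- \<mu>0)"
    using ex_moment_0_le by blast
  define D where "D = fact q * 2 ^ q * C * (1 / 2) powr (- \<mu>0)"
  have "moment q t \<le> D * t powr (- (\<mu>0 + real q))" if t: "0 < t" for t
  proof -
    have "moment q t \<le> fact q * (2 / t) ^ q * moment 0 (t / 2)" by (rule moment_le_theta[OF t])
    also have "\<dots> \<le> fact q * (2 / t) ^ q * (C * (t / 2) powr (- \<mu>0))"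
      using t by (intro mult_left_mono le) auto
    also have "(t / 2) powr (- \<mu>0) = (1 / 2) powr (- \<mu>0) * t powr (- \<mu>0)"
      using powr_mult[of "1 / 2" t "- \<mu>0"] t by simp
    also have "(2 / t) ^ q = 2 ^ q * t powr (- real q)"
      using t by (simp add: power_divide powr_minus powr_realpow field_simps)
    moreover have e: "t powr (- (\<mu>0 + real q)) = t powr (- \<mu>0) * t powr (- real q)"
      by (simp flip: powr_add)
    ultimately show ?thesis unfolding D_def e by (simp only: mult_ac)
  qed
  then show ?thesis using C by (intro exI[of _ D]) (auto simp: D_def)
qed

lemma moment_bigo: "moment q \<in> O[at_right 0](\<lambda>t. t powr (- (\<mu>0 + real q)))"
proof -
  obtain C where le: "\<And>t. 0 < t \<Longrightarrow> moment q t \<le> C * t powr (- (\<mu>0 + real q))"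
    using ex_moment_le by blast
  have "\<forall>\<^sub>F t in at_right 0. norm (moment q t) \<le> C * norm (t powr (- (\<mu>0 + real q)))"
    using eventually_at_right_less
    by eventually_elim (use le moment_pos[of _ q] in \<open>auto simp: less_imp_le\<close>)
  then show ?thesis by (rule bigoI)
qed

text \<open>Crude, but with an exponent independent of N: it serves as the bound on the second
  derivative in \<open>derivative_bigo_at_right_0\<close>.\<close>

lemma rest_bigo_trivial: "rest N q \<in> O[at_right 0](\<lambda>t. t powr (- (\<mu>0 + real q)))"
  unfolding rest_def
  using moment_bigo[of q] main_part_bigo[of N q] by (intro sum_in_bigo) auto

text \<open>Induction on q: order K for the next derivative costs order 2 * K + b for the present
  one, and a larger N supplies any order.\<close>

lemma ex_rest_bigo: "\<exists>N0. \<forall>N\<ge>N0. rest N q \<in> O[at_right 0](\<lambda>t. t powr K)"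
proof (induction q arbitrary: K)
  case 0
  have "\<forall>\<^sub>F N in sequentially. K \<le> i N" using filterlim_i by (simp add: filterlim_at_top)
  then obtain N0 where N0: "\<And>N. N \<ge> N0 \<Longrightarrow> K \<le> i N" by (auto simp: eventually_sequentially)
  have "rest N 0 \<in> O[at_right 0](\<lambda>t. t powr K)" if "N \<ge> N0" for N
    using landau_o.small_imp_big[OF rest_0_smallo[of N]] powr_bigo_at_right_0[OF N0[OF that]]
    by (rule landau_o.big_trans)
  then show ?case by blast
next
  case (Suc q)
  \<comment> \<open>K' \<ge> 1 meets the side conditions of the derivative lemma; b is the exponent
    of the crude bound two derivatives further on.\<close>
  define K' where "K' = max K 1"
  define b where "b = \<mu>0 + real (Suc (Suc q))"
  obtain N0 where N0: "\<And>N. N \<ge> N0 \<Longrightarrow> rest N q \<in> O[at_right 0](\<lambda>t. t powr (2 * K' + b))"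
    using Suc.IH[of "2 * K' + b"] by blast
  have "rest N (Suc q) \<in> O[at_right 0](\<lambda>t. t powr K)" if N: "N \<ge> N0" for N
  proof -
    have "rest N (Suc q) \<in> O[at_right 0](\<lambda>t. t powr K')"
    proof (rule derivative_bigo_at_right_0[OF DERIV_rest DERIV_rest N0[OF N]])
      show "rest N (Suc (Suc q)) \<in> O[at_right 0](\<lambda>t. t powr - b)"
        unfolding b_def by (rule rest_bigo_trivial)
    qed (use \<mu>0_pos in \<open>auto simp: b_def K'_def\<close>)
    also have "(\<lambda>t. t powr K') \<in> O[at_right (0::real)](\<lambda>t. t powr K)"
      by (rule powr_bigo_at_right_0) (simp add: K'_def)
    finally show ?thesis .
  qed
  then show ?case by blast
qed

lemma main_part_leading:
  "((\<lambda>t. t powr (\<mu>0 + real q) * main_part N q t) \<longlongrightarrow> A (i 0) * (\<Prod>l<q. i 0 - real l)) (at_right 0)"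
proof -
  let ?c = "\<lambda>n. A (i n) * (\<Prod>l<q. i n - real l)"
  have "((\<lambda>t. \<Sum>n\<le>N. ?c n * t powr (i n - i 0)) \<longlongrightarrow> (\<Sum>n\<le>N. if n = 0 then ?c 0 else 0)) (at_right 0)"
  proof (intro tendsto_sum)
    fix n
    show "((\<lambda>t. ?c n * t powr (i n - i 0)) \<longlongrightarrow> (if n = 0 then ?c 0 else 0)) (at_right 0)"
    proof (cases "n = 0")
      case True
      have "\<forall>\<^sub>F t in at_right 0. ?c n * t powr (i n - i 0) = ?c 0"
        using eventually_at_right_less by eventually_elim (use True in auto)
      then show ?thesis using True by (simp add: tendsto_eventually)
    next
      case False
      then have "i 0 < i n" using strict_mono_i by (simp add: strict_mono_less)
      then have "((\<lambda>t. t powr (i n - i 0)) \<longlongrightarrow> 0) (at_right 0)"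
        by (intro tendsto_powr_at_right_0) simp
      from tendsto_mult[OF tendsto_const[of "?c n"] this] show ?thesis using False by simp
    qed
  qed
  moreover have "\<forall>\<^sub>F t in at_right 0. (\<Sum>n\<le>N. ?c n * t powr (i n - i 0)) = t powr (\<mu>0 + real q) * main_part N q t"
    using eventually_at_right_less
  proof eventually_elim
    case (elim t)
    show ?case unfolding main_part_def sum_distrib_left
      by (intro sum.cong) (auto simp: mult_ac simp flip: powr_add)
  qed
  ultimately show ?thesis by (auto elim: Lim_transform_eventually)
qed

text \<open>For N so large that the remainder is bounded only the term with exponent
  \<open>i 0\<close> survives. The sign (- 1) ^ q cancels that of the product, whose q factors are
  all negative.\<close>

lemma moment_leading:
  "((\<lambda>t. t powr (\<mu>0 + real q) * moment q t) \<longlongrightarrow> (- 1) ^ q * A (i 0) * (\<Prod>l<q. i 0 - real l)) (at_right 0)"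
proof -
  obtain N where N: "rest N q \<in> O[at_right 0](\<lambda>t. t powr 0)" using ex_rest_bigo[of q 0] by blast
  obtain C e where C: "C > 0" "e > 0" and le: "\<And>t. 0 < t \<Longrightarrow> t < e \<Longrightarrow> \<bar>rest N q t\<bar> \<le> C * t powr 0"
    using bigo_powr_at_right_0E[OF N] by blast
  have "((\<lambda>t. t powr (\<mu>0 + real q) * rest N q t) \<longlongrightarrow> 0) (at_right 0)"
  proof (rule Lim_null_comparison)
    show "\<forall>\<^sub>F t in at_right 0. norm (t powr (\<mu>0 + real q) * rest N q t) \<le> C * t powr (\<mu>0 + real q)"
    proof -
      have "norm (t powr (\<mu>0 + real q) * rest N q t) \<le> C * t powr (\<mu>0 + real q)" if "0 < t" "t < e" for t
        using le[OF that] that by (simp add: abs_mult mult_left_mono mult.commute[of C])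
      then show ?thesis using C by (auto simp: eventually_at_right_field)
    qed
    have "((\<lambda>t. C * t powr (\<mu>0 + real q)) \<longlongrightarrow> C * 0) (at_right 0)"
      using \<mu>0_pos by (intro tendsto_mult tendsto_const tendsto_powr_at_right_0) simp
    then show "((\<lambda>t. C * t powr (\<mu>0 + real q)) \<longlongrightarrow> 0) (at_right 0)" by simp
  qed
  from tendsto_mult[OF tendsto_const[of "(-1) ^ q"] tendsto_add[OF this main_part_leading[of q N]]]
  have "((\<lambda>t. (-1) ^ q * (t powr (\<mu>0 + real q) * rest N q t + t powr (\<mu>0 + real q) * main_part N q t)) \<longlongrightarrow>
      (-1) ^ q * (0 + A (i 0) * (\<Prod>l<q. i 0 - real l))) (at_right 0)" .
  moreover have "(-1) ^ q * (x * rest N q t + x * main_part N q t) = x * moment q t" for x t :: real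
  proof -
    have "(-1::real) ^ q * (-1) ^ q = 1" by (simp flip: power_mult_distrib)
    then have "(-1) ^ q * (x * ((-1) ^ q * y)) = x * y" for y by (metis mult.left_commute mult.right_neutral mult.assoc)
    then show ?thesis by (simp add: rest_def distrib_left right_diff_distrib)
  qed
  ultimately show ?thesis by (simp add: mult.assoc)
qed

text \<open>A nonzero limit of positive quantities. It makes the curvature at the saddle point
  positive.\<close>

lemma A_i_0_pos: "0 < A (i 0)"
proof -
  have "0 \<le> A (i 0)"
  proof (rule tendsto_lowerbound)
    show "((\<lambda>t. t powr \<mu>0 * moment 0 t) \<longlongrightarrow> A (i 0)) (at_right 0)"
      using moment_leading[of 0] by simp
    show "\<forall>\<^sub>F t in at_right 0. 0 \<le> t powr \<mu>0 * moment 0 t"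
      using eventually_at_right_less by eventually_elim (simp add: moment_pos less_imp_le)
  qed auto
  then show ?thesis using A_i_0_nonzero by simp
qed

end

subsection \<open>Riemann sums\<close>

text \<open>The model majorant: integrable over the positive half-line for positive p and q, and
  nonincreasing if also p \<le> 1; both powers are 1 at the seam t = 1.\<close>

definition two_sided :: "real \<Rightarrow> real \<Rightarrow> real \<Rightarrow> real" where
  "two_sided p q t = (if t \<le> 1 then t powr (p - 1) else t powr (- q - 1))"

lemma two_sided_nonneg: "0 \<le> two_sided p q t"
  by (simp add: two_sided_def)

lemma set_integrable_two_sided:
  assumes p: "0 < p" and q: "0 < q"
  shows "set_integrable lborel {0<..} (two_sided p q)"
proof -
  have meas: "(\<lambda>x. indicator {0<..} x *\<^sub>R two_sided p q x) \<in> borel_measurable borel"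
    unfolding two_sided_def by measurable
  have "(\<lambda>t::real. t powr (p - 1)) integrable_on {0<..1}"
    using p by (intro integrable_on_powr_from_0') auto
  then have 1: "two_sided p q integrable_on {0<..1}"
    by (rule integrable_eq) (auto simp: two_sided_def)
  have "(\<lambda>t::real. t powr (- q - 1)) integrable_on {1..}"
    using has_integral_powr_to_inf[where a = 1 and e = "- q - 1"] q unfolding integrable_on_def by fastforce
  then have 2: "two_sided p q integrable_on {1..}"
    by (rule integrable_eq) (auto simp: two_sided_def)
  have "two_sided p q integrable_on ({0<..1} \<union> {1..})"
    by (rule integrable_Un[OF _ 1 2]) (rule negligible_subset[of "{1}"], auto)
  also have "{0<..1} \<union> {1..} = {0::real<..}" by auto
  finally have "two_sided p q absolutely_integrable_on {0<..}"
    by (intro nonnegative_absolutely_integrable_1) (auto simp: two_sided_nonneg)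
  \<comment> \<open>Absolute gauge integrability refers to the completed Lebesgue measure; Borel
    measurability transfers it to \<open>lborel\<close>.\<close>
  then show ?thesis
    unfolding set_integrable_def using meas
    by (subst (asm) integrable_completion) auto
qed

lemma two_sided_antimono:
  assumes "0 < s" "s \<le> t" "p \<le> 1" "0 \<le> q"
  shows "two_sided p q t \<le> two_sided p q s"
proof (cases "t \<le> 1 \<or> 1 < s")
  case True
  then show ?thesis using assms by (auto simp: two_sided_def intro!: powr_mono2')
next
  case False
  then have "t powr (- q - 1) \<le> 1 powr (- q - 1)" using assms by (intro powr_mono2') auto
  moreover have "1 powr (p - 1) \<le> s powr (p - 1)" using assms False by (intro powr_mono2') auto
  ultimately show ?thesis using False by (simp add: two_sided_def)
qed

lemma set_integrable_two_sided_bound: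
  fixes g :: "real \<Rightarrow> 'a::{banach, second_countable_topology}"
  assumes "g \<in> borel_measurable borel" "0 < p" "0 < q"
    and "\<And>t. 0 < t \<Longrightarrow> norm (g t) \<le> C * two_sided p q t"
  shows "set_integrable lborel {0<..} g"
proof -
  have C: "0 \<le> C * two_sided p q t" if "0 < t" for t using assms(4)[OF that] norm_ge_zero order_trans by blast
  show ?thesis
    unfolding set_integrable_def
  proof (rule Bochner_Integration.integrable_bound)
    show "integrable lborel (\<lambda>x. C * (indicat_real {0<..} x *\<^sub>R two_sided p q x))"
      using set_integrable_two_sided[OF assms(2,3)] unfolding set_integrable_def by simp
    show "AE x in lborel. norm (indicat_real {0<..} x *\<^sub>R g x) \<le> norm (C * (indicat_real {0<..} x *\<^sub>R two_sided p q x))"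
      using assms(4) C by (intro AE_I2) (auto simp: indicator_def)
  qed (use assms(1) in measurable)
qed

lemma summable_Suc_powr: "1 < x \<Longrightarrow> summable (\<lambda>k. real (Suc k) powr (- x))"
  using summable_real_powr_iff[of "- x"] summable_Suc_iff[of "\<lambda>n. real n powr (- x)"] by simp

text \<open>The dominating function decreases, so it also dominates the step functions of the Riemann sums.\<close>
lemma riemann_sum_tendsto:
  fixes g :: "real \<Rightarrow> real"
  assumes cont: "continuous_on {0<..} g"
    and p: "0 < p" "p \<le> 1" and q: "0 < q"
    and bound: "\<And>t. 0 < t \<Longrightarrow> \<bar>g t\<bar> \<le> C * two_sided p q t"
  shows "((\<lambda>\<alpha>. \<Sum>k. \<alpha> * g (real (Suc k) * \<alpha>)) \<longlongrightarrow> (LINT t:{0<..}|lborel. g t)) (at_right 0)"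
  unfolding tendsto_at_iff_sequentially
proof (intro allI impI)
  fix X :: "nat \<Rightarrow> real"
  assume X: "\<forall>n. X n \<in> {0<..} - {0}" "X \<longlonglongrightarrow> 0"
  then have Xpos: "0 < X n" for n by auto
  have C: "0 \<le> C"
  proof -
    have "0 \<le> C * two_sided p q 1" using bound[of 1] by linarith
    then show ?thesis by (simp add: two_sided_def)
  qed
  \<comment> \<open>Sampling at right endpoints is what lets a decreasing majorant work. For t > 0
    exactly one k contributes, called \<open>m \<alpha> t\<close> below.\<close>
  define S where "S \<alpha> k t = (if real k * \<alpha> < t \<and> t \<le> real (Suc k) * \<alpha> then g (real (Suc k) * \<alpha>) else 0)" for \<alpha> k and t :: real
  define m where "m \<alpha> t = nat (\<lceil>t / \<alpha>\<rceil> - 1)" for \<alpha> t :: real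
  have interval_iff: "real k * \<alpha> < t \<and> t \<le> real (Suc k) * \<alpha> \<longleftrightarrow> k = m \<alpha> t" if "0 < \<alpha>" "0 < t" for k \<alpha> t
  proof -
    have "real k * \<alpha> < t \<and> t \<le> real (Suc k) * \<alpha> \<longleftrightarrow> real k < t / \<alpha> \<and> t / \<alpha> \<le> real k + 1"
      using that by (simp add: pos_less_divide_eq pos_divide_le_eq algebra_simps)
    also have "\<dots> \<longleftrightarrow> \<lceil>t / \<alpha>\<rceil> = int k + 1" by (auto simp: ceiling_eq_iff)
    also have "\<dots> \<longleftrightarrow> k = m \<alpha> t"
    proof -
      have "1 \<le> \<lceil>t / \<alpha>\<rceil>" using that by (simp add: one_le_ceiling)
      then show ?thesis by (auto simp: m_def)
    qed
    finally show ?thesis .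
  qed
  have S_eq: "S \<alpha> k t = (if k = m \<alpha> t \<and> 0 < t then g (real (Suc k) * \<alpha>) else 0)" if "0 < \<alpha>" for \<alpha> k t
  proof (cases "0 < t")
    case True
    then show ?thesis using interval_iff[OF that True, of k] by (simp add: S_def)
  next
    case False
    have "0 \<le> real k * \<alpha>" using that by simp
    then show ?thesis using False by (auto simp: S_def)
  qed
  define G where "G \<alpha> t = (if 0 < t then g (real (Suc (m \<alpha> t)) * \<alpha>) else 0)" for \<alpha> t
  have S_sums: "(\<lambda>k. S \<alpha> k t) sums G \<alpha> t" if "0 < \<alpha>" for \<alpha> t
    unfolding S_eq[OF that] G_def using sums_single[of "m \<alpha> t" "\<lambda>k. g (real (Suc k) * \<alpha>)"]
    by (cases "0 < t") (auto simp: eq_commute[of _ "m \<alpha> t"] if_distrib cong: if_cong)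
  have S_int: "integrable lborel (S \<alpha> k)" "integral\<^sup>L lborel (S \<alpha> k) = \<alpha> * g (real (Suc k) * \<alpha>)"
    "integral\<^sup>L lborel (\<lambda>t. norm (S \<alpha> k t)) = \<alpha> * \<bar>g (real (Suc k) * \<alpha>)\<bar>" if "0 < \<alpha>" for \<alpha> k
  proof -
    have e: "S \<alpha> k = (\<lambda>t. indicator {real k * \<alpha><..real (Suc k) * \<alpha>} t *\<^sub>R g (real (Suc k) * \<alpha>))"
      "(\<lambda>t. norm (S \<alpha> k t)) = (\<lambda>t. indicator {real k * \<alpha><..real (Suc k) * \<alpha>} t *\<^sub>R \<bar>g (real (Suc k) * \<alpha>)\<bar>)"
      by (auto simp: S_def indicator_def fun_eq_iff)
    have le: "real k * \<alpha> \<le> real (Suc k) * \<alpha>" using that by (intro mult_right_mono) auto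
    have ms: "measure lborel {real k * \<alpha><..real (Suc k) * \<alpha>} = \<alpha>" "emeasure lborel {real k * \<alpha><..real (Suc k) * \<alpha>} < \<infinity>"
      using le by (auto simp: algebra_simps)
    have fin: "integrable lborel (\<lambda>t. indicator {real k * \<alpha><..real (Suc k) * \<alpha>} t *\<^sub>R c)" for c :: real
      using ms(2) by (intro integrable_scaleR_left integrable_real_indicator) auto
    show "integrable lborel (S \<alpha> k)" unfolding e by (rule fin)
    have ic: "(\<integral>t. indicator {real k * \<alpha><..real (Suc k) * \<alpha>} t *\<^sub>R c \<partial>lborel) = \<alpha> * c" for c :: real
      using ms by (subst integral_scaleR_left) (auto intro!: integrable_real_indicator)
    show "integral\<^sup>L lborel (S \<alpha> k) = \<alpha> * g (real (Suc k) * \<alpha>)"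
      unfolding e(1) ic by (rule refl)
    show "integral\<^sup>L lborel (\<lambda>t. norm (S \<alpha> k t)) = \<alpha> * \<bar>g (real (Suc k) * \<alpha>)\<bar>"
      unfolding e(2) ic by (rule refl)
  qed
  \<comment> \<open>This permits exchanging sum and integral. The decay at infinity suffices, since
    (k + 1) * \<alpha> > 1 from some k on.\<close>
  have g_summable: "summable (\<lambda>k. \<bar>g (real (Suc k) * \<alpha>)\<bar>)" if \<alpha>: "0 < \<alpha>" for \<alpha>
  proof (rule summable_comparison_test_ev)
    have "summable (\<lambda>k. real (Suc k) powr (- (q + 1)))" using q by (intro summable_Suc_powr) auto
    then show "summable (\<lambda>k. C * \<alpha> powr (- (q + 1)) * real (Suc k) powr (- (q + 1)))" by (rule summable_mult)
    obtain K :: nat where K: "1 / \<alpha> < real K" using reals_Archimedean2 by blast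
    show "\<forall>\<^sub>F k in sequentially. norm \<bar>g (real (Suc k) * \<alpha>)\<bar> \<le> C * \<alpha> powr (- (q + 1)) * real (Suc k) powr (- (q + 1))"
      using eventually_ge_at_top[of K]
    proof eventually_elim
      case (elim k)
      have "1 < real K * \<alpha>" using K \<alpha> by (simp add: field_simps)
      also have "\<dots> \<le> real (Suc k) * \<alpha>" using elim \<alpha> by (intro mult_right_mono) auto
      finally have 1: "1 < real (Suc k) * \<alpha>" .
      then have "\<bar>g (real (Suc k) * \<alpha>)\<bar> \<le> C * two_sided p q (real (Suc k) * \<alpha>)" by (intro bound) simp
      also have "two_sided p q (real (Suc k) * \<alpha>) = (real (Suc k) * \<alpha>) powr (- (q + 1))" using 1 by (simp add: two_sided_def)
      also have "\<dots> = \<alpha> powr (- (q + 1)) * real (Suc k) powr (- (q + 1))" using \<alpha> by (simp add: powr_mult mult.commute)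
      finally show ?case by (simp add: mult_ac)
    qed
  qed
  have sum_eq: "integral\<^sup>L lborel (G \<alpha>) = (\<Sum>k. \<alpha> * g (real (Suc k) * \<alpha>))" if \<alpha>: "0 < \<alpha>" for \<alpha>
  proof -
    have Geq: "G \<alpha> = (\<lambda>t. \<Sum>k. S \<alpha> k t)" using S_sums[OF \<alpha>] by (simp add: sums_iff fun_eq_iff)
    have "(\<lambda>k. integral\<^sup>L lborel (S \<alpha> k)) sums (\<integral>t. (\<Sum>k. S \<alpha> k t) \<partial>lborel)"
    proof (rule sums_integral)
      show "AE t in lborel. summable (\<lambda>k. norm (S \<alpha> k t))"
      proof (rule AE_I2)
        fix t
        show "summable (\<lambda>k. norm (S \<alpha> k t))"
          unfolding S_eq[OF \<alpha>] by (rule summable_finite[of "{m \<alpha> t}"]) auto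
      qed
      show "summable (\<lambda>k. \<integral>t. norm (S \<alpha> k t) \<partial>lborel)"
        unfolding S_int(3)[OF \<alpha>] by (intro summable_mult g_summable \<alpha>)
    qed (rule S_int(1)[OF \<alpha>])
    then show ?thesis unfolding Geq S_int(2)[OF \<alpha>] by (simp add: sums_iff)
  qed
  have G_meas: "G \<alpha> \<in> borel_measurable borel" if \<alpha>: "0 < \<alpha>" for \<alpha>
  proof -
    have Geq: "G \<alpha> = (\<lambda>t. \<Sum>k. S \<alpha> k t)" using S_sums[OF \<alpha>] by (simp add: sums_iff fun_eq_iff)
    show ?thesis unfolding Geq S_def by measurable
  qed
  define g0 where "g0 t = indicator {0<..} t *\<^sub>R g t" for t
  have g0_meas: "g0 \<in> borel_measurable borel"
    unfolding g0_def by (rule borel_measurable_continuous_on_indicator[OF _ cont]) auto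
  have step: "t \<le> real (Suc (m \<alpha> t)) * \<alpha>" "real (Suc (m \<alpha> t)) * \<alpha> < t + \<alpha>" if "0 < \<alpha>" "0 < t" for \<alpha> t
    using interval_iff[OF that, of "m \<alpha> t"] by (auto simp: algebra_simps)
  have "(\<lambda>n. integral\<^sup>L lborel (G (X n))) \<longlonglongrightarrow> integral\<^sup>L lborel g0"
  proof (rule integral_dominated_convergence)
    show "g0 \<in> borel_measurable lborel" using g0_meas by simp
    show "G (X n) \<in> borel_measurable lborel" for n using G_meas[OF Xpos] by simp
    show "integrable lborel (\<lambda>t. C * (indicator {0<..} t *\<^sub>R two_sided p q t))"
      using set_integrable_two_sided[OF p(1) q] unfolding set_integrable_def by simp
    show "AE t in lborel. (\<lambda>n. G (X n) t) \<longlonglongrightarrow> g0 t"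
    proof (rule AE_I2)
      fix t :: real
      show "(\<lambda>n. G (X n) t) \<longlonglongrightarrow> g0 t"
      proof (cases "0 < t")
        case True
        have "(\<lambda>n. real (Suc (m (X n) t)) * X n) \<longlonglongrightarrow> t"
        proof (rule tendsto_sandwich[OF _ _ tendsto_const])
          show "(\<lambda>n. t + X n) \<longlonglongrightarrow> t" using tendsto_add[OF tendsto_const X(2), of t] by simp
        qed (use step[OF Xpos True] in \<open>auto simp: less_imp_le\<close>)
        moreover have "isCont g t" using cont True by (simp add: continuous_on_eq_continuous_at open_greaterThan)
        ultimately have "(\<lambda>n. g (real (Suc (m (X n) t)) * X n)) \<longlonglongrightarrow> g t"
          using isCont_tendsto_compose by blast
        then show ?thesis using True by (simp add: G_def g0_def)
      qed (simp add: G_def g0_def)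
    qed
    show "AE t in lborel. norm (G (X n) t) \<le> C * (indicator {0<..} t *\<^sub>R two_sided p q t)" for n
    proof (rule AE_I2)
      fix t :: real
      show "norm (G (X n) t) \<le> C * (indicator {0<..} t *\<^sub>R two_sided p q t)"
      proof (cases "0 < t")
        case True
        have "\<bar>g (real (Suc (m (X n) t)) * X n)\<bar> \<le> C * two_sided p q (real (Suc (m (X n) t)) * X n)"
          using Xpos by (intro bound mult_pos_pos) auto
        also have "\<dots> \<le> C * two_sided p q t"
          using step(1)[OF Xpos True] True p q C by (intro mult_left_mono two_sided_antimono) auto
        finally show ?thesis using True by (simp add: G_def)
      qed (simp add: G_def)
    qed
  qed
  then show "((\<lambda>\<alpha>. \<Sum>k. \<alpha> * g (real (Suc k) * \<alpha>)) \<circ> X) \<longlonglongrightarrow> (LINT t:{0<..}|lborel. g t)"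
    using sum_eq[OF Xpos] by (simp add: o_def set_lebesgue_integral_def g0_def[abs_def])
qed

text \<open>The asymptotic bounds apply near 0 and near infinity; on the compact interval between,
  continuity gives a bound.\<close>

lemma ex_two_sided_bound:
  fixes g :: "real \<Rightarrow> real"
  assumes cont: "continuous_on {0<..} g"
    and near_0: "g \<in> O[at_right 0](\<lambda>t. t powr (p - 1))"
    and near_top: "g \<in> O[at_top](\<lambda>t. t powr (- q - 1))"
  shows "\<exists>C. \<forall>t>0. \<bar>g t\<bar> \<le> C * two_sided p q t"
proof -
  obtain C1 e where C1: "C1 > 0" "e > 0" "\<And>t. 0 < t \<Longrightarrow> t < e \<Longrightarrow> \<bar>g t\<bar> \<le> C1 * t powr (p - 1)"
    using bigo_powr_at_right_0E[OF near_0] by blast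
  obtain C2 where C2: "C2 > 0" "\<forall>\<^sub>F t in at_top. norm (g t) \<le> C2 * norm (t powr (- q - 1))"
    using near_top by (rule landau_o.bigE)
  then obtain T where T: "\<And>t. t \<ge> T \<Longrightarrow> norm (g t) \<le> C2 * norm (t powr (- q - 1))"
    by (auto simp: eventually_at_top_linorder)
  define a b where "a = min 1 (e / 2)" and "b = max 1 T"
  have ab: "0 < a" "a \<le> 1" "a < e" "1 \<le> b" "T \<le> b" using C1 by (auto simp: a_def b_def)
  \<comment> \<open>The minimum of the two powers is continuous and positive, and it is at most
    \<open>two_sided\<close> on either side of 1.\<close>
  have cts: "continuous_on {a..b} (\<lambda>t. \<bar>g t\<bar> / min (t powr (p - 1)) (t powr (- q - 1)))"
    using ab by (intro continuous_intros continuous_on_subset[OF cont]) (auto simp: min_def)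
  obtain K where K: "\<And>t. t \<in> {a..b} \<Longrightarrow> \<bar>g t\<bar> / min (t powr (p - 1)) (t powr (- q - 1)) \<le> K"
    using continuous_attains_sup[OF compact_Icc _ cts] ab by fastforce
  have "\<bar>g t\<bar> \<le> (C1 + C2 + \<bar>K\<bar>) * two_sided p q t" if t: "0 < t" for t
  proof -
    consider "t < a" | "t \<in> {a..b}" | "b < t" by fastforce
    then show ?thesis
    proof cases
      case 1
      then have "\<bar>g t\<bar> \<le> C1 * two_sided p q t" using C1(3)[of t] t ab by (simp add: two_sided_def)
      also have "\<dots> \<le> (C1 + C2 + \<bar>K\<bar>) * two_sided p q t"
        using C2 by (intro mult_right_mono two_sided_nonneg) auto
      finally show ?thesis .
    next
      case 2
      let ?m = "min (t powr (p - 1)) (t powr (- q - 1))"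
      have "0 < ?m" using t by (simp add: min_def)
      then have "\<bar>g t\<bar> \<le> K * ?m" using K[OF 2] by (simp add: divide_le_eq)
      also have "\<dots> \<le> (C1 + C2 + \<bar>K\<bar>) * ?m"
        using C1 C2 \<open>0 < ?m\<close> by (intro mult_right_mono) auto
      also have "\<dots> \<le> (C1 + C2 + \<bar>K\<bar>) * two_sided p q t"
        using C1 C2 by (intro mult_left_mono) (auto simp: two_sided_def)
      finally show ?thesis .
    next
      case 3
      then have "\<bar>g t\<bar> \<le> C2 * two_sided p q t" using T[of t] t ab by (simp add: two_sided_def)
      also have "\<dots> \<le> (C1 + C2 + \<bar>K\<bar>) * two_sided p q t"
        using C1 by (intro mult_right_mono two_sided_nonneg) auto
      finally show ?thesis .
    qed
  qed
  then show ?thesis by blast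
qed

subsection \<open>Expansion of the logarithm on the real axis\<close>

lemma powr_bigo_at_top:
  assumes "a \<le> b"
  shows "(\<lambda>t. t powr a) \<in> O[at_top](\<lambda>t::real. t powr b)"
proof (rule bigoI[where c = 1])
  show "\<forall>\<^sub>F t in at_top. norm (t powr a) \<le> 1 * norm (t powr b :: real)"
    using eventually_ge_at_top[of 1] by eventually_elim (use assms in \<open>auto intro: powr_mono\<close>)
qed

text \<open>The maximum with 1 admits exponents x \<le> 0, which \<open>powr_le_exp\<close> does not
  cover.\<close>

lemma exp_minus_le_powr:
  assumes "1 \<le> (t::real)"
  shows "exp (- t) \<le> max 1 x powr max 1 x * t powr (- x)"
proof -
  let ?y = "max 1 x"
  have "t powr x \<le> t powr ?y" using assms by (intro powr_mono) auto
  also have "\<dots> \<le> ?y powr ?y * exp (t - ?y)" using assms by (intro powr_le_exp) auto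
  also have "\<dots> \<le> ?y powr ?y * exp t" by (intro mult_left_mono) auto
  finally show ?thesis using assms by (simp add: powr_minus exp_minus field_simps)
qed

lemma exp_minus_bigo_at_top: "(\<lambda>t. exp (- t)) \<in> O[at_top](\<lambda>t::real. t powr (- x))"
proof (rule bigoI)
  show "\<forall>\<^sub>F t in at_top. norm (exp (- t)) \<le> (max 1 x powr max 1 x) * norm (t powr (- x) :: real)"
    using eventually_ge_at_top[of 1] by eventually_elim (simp add: exp_minus_le_powr)
qed

lemma riemann_zeta_sums:
  assumes "1 < x"
  shows "(\<lambda>k. real (Suc k) powr (- x)) sums riemann_zeta x"
  unfolding riemann_zeta_def using summable_Suc_powr[OF assms] by (rule summable_sums)

lemma riemann_zeta_pos: "1 < x \<Longrightarrow> 0 < riemann_zeta x"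
  unfolding riemann_zeta_def by (rule suminf_pos[OF summable_Suc_powr]) auto

context admissible_seq
begin

text \<open>
  \<open>log_moment 0 \<alpha>\<close> is the logarithm of the generating function at \<open>exp (- \<alpha>)\<close>, and \<open>log_moment p\<close>
  is \<open>(- 1) ^ p\<close> times its \<open>p\<close>-th derivative in \<open>\<alpha>\<close>.
\<close>
definition log_moment :: "nat \<Rightarrow> real \<Rightarrow> real" where
  "log_moment p \<alpha> = (\<Sum>k. real (Suc k) ^ p / real (Suc k) * moment p (real (Suc k) * \<alpha>))"

text \<open>The powers of k + 1 combine to the exponent - (\<mu>0 + 1) whatever p is, so the bounds
  sum to a zeta value.\<close>

lemma ex_log_moment_term_le:
  "\<exists>C>0. \<forall>\<alpha>>0. \<forall>k. real (Suc k) ^ p / real (Suc k) * moment p (real (Suc k) * \<alpha>)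
     \<le> C * \<alpha> powr (- (\<mu>0 + real p)) * real (Suc k) powr (- (\<mu>0 + 1))"
proof -
  obtain C where C: "C > 0" "\<And>t. 0 < t \<Longrightarrow> moment p t \<le> C * t powr (- (\<mu>0 + real p))"
    using ex_moment_le by blast
  have "real (Suc k) ^ p / real (Suc k) * moment p (real (Suc k) * \<alpha>)
     \<le> C * \<alpha> powr (- (\<mu>0 + real p)) * real (Suc k) powr (- (\<mu>0 + 1))" if \<alpha>: "0 < \<alpha>" for \<alpha> k
  proof -
    let ?k = "real (Suc k)"
    have kp: "?k ^ p / ?k = ?k powr (real p - 1)" by (simp add: powr_diff powr_realpow)
    have "?k ^ p / ?k * moment p (?k * \<alpha>) \<le> ?k ^ p / ?k * (C * (?k * \<alpha>) powr (- (\<mu>0 + real p)))"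
      using \<alpha> by (intro mult_left_mono C(2)) auto
    also have "(?k * \<alpha>) powr (- (\<mu>0 + real p)) = ?k powr (- (\<mu>0 + real p)) * \<alpha> powr (- (\<mu>0 + real p))"
      by (rule powr_mult)
    also have "?k ^ p / ?k * (C * (?k powr (- (\<mu>0 + real p)) * \<alpha> powr (- (\<mu>0 + real p))))
      = C * \<alpha> powr (- (\<mu>0 + real p)) * (?k powr (real p - 1) * ?k powr (- (\<mu>0 + real p)))" unfolding kp by (simp only: mult_ac)
    also have "?k powr (real p - 1) * ?k powr (- (\<mu>0 + real p)) = ?k powr (- (\<mu>0 + 1))"
      by (simp flip: powr_add)
    finally show ?thesis .
  qed
  then show ?thesis using C(1) by blast
qed

lemma summable_log_moment:
  assumes \<alpha>: "0 < \<alpha>"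
  shows "summable (\<lambda>k. real (Suc k) ^ p / real (Suc k) * moment p (real (Suc k) * \<alpha>))"
proof -
  obtain C where C: "\<And>k. real (Suc k) ^ p / real (Suc k) * moment p (real (Suc k) * \<alpha>)
     \<le> C * \<alpha> powr (- (\<mu>0 + real p)) * real (Suc k) powr (- (\<mu>0 + 1))"
    using ex_log_moment_term_le[of p] \<alpha> by blast
  show ?thesis
  proof (rule summable_comparison_test')
    show "summable (\<lambda>k. C * \<alpha> powr (- (\<mu>0 + real p)) * real (Suc k) powr (- (\<mu>0 + 1)))"
      using \<mu>0_pos by (intro summable_mult summable_Suc_powr) auto
    show "norm (real (Suc k) ^ p / real (Suc k) * moment p (real (Suc k) * \<alpha>))
        \<le> C * \<alpha> powr (- (\<mu>0 + real p)) * real (Suc k) powr (- (\<mu>0 + 1))" if "k \<ge> 0" for k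
    proof -
      have "0 \<le> real (Suc k) ^ p / real (Suc k) * moment p (real (Suc k) * \<alpha>)"
        using \<alpha> by (intro mult_nonneg_nonneg less_imp_le[OF moment_pos]) auto
      then show ?thesis using C[of k] by simp
    qed
  qed
qed

lemma ex_log_moment_le: "\<exists>C>0. \<forall>\<alpha>>0. log_moment p \<alpha> \<le> C * \<alpha> powr (- (\<mu>0 + real p))"
proof -
  obtain C where C: "C > 0" "\<And>\<alpha> k. 0 < \<alpha> \<Longrightarrow> real (Suc k) ^ p / real (Suc k) * moment p (real (Suc k) * \<alpha>)
     \<le> C * \<alpha> powr (- (\<mu>0 + real p)) * real (Suc k) powr (- (\<mu>0 + 1))"
    using ex_log_moment_term_le[of p] by blast
  have z: "1 < \<mu>0 + 1" using \<mu>0_pos by simp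
  have "log_moment p \<alpha> \<le> C * riemann_zeta (\<mu>0 + 1) * \<alpha> powr (- (\<mu>0 + real p))" if \<alpha>: "0 < \<alpha>" for \<alpha>
  proof -
    have "log_moment p \<alpha> \<le> (\<Sum>k. C * \<alpha> powr (- (\<mu>0 + real p)) * real (Suc k) powr (- (\<mu>0 + 1)))"
      unfolding log_moment_def using \<alpha> z
      by (intro suminf_le C(2) summable_log_moment summable_mult summable_Suc_powr) auto
    also have "\<dots> = C * \<alpha> powr (- (\<mu>0 + real p)) * riemann_zeta (\<mu>0 + 1)"
      by (rule sums_unique[symmetric, OF sums_mult[OF riemann_zeta_sums[OF z]]])
    finally show ?thesis by (simp only: mult_ac)
  qed
  then show ?thesis using C(1) riemann_zeta_pos[OF z] by (intro exI[of _ "C * riemann_zeta (\<mu>0 + 1)"]) auto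
qed

text \<open>After scaling, the k-th term tends to a multiple of (k + 1) powr (- (\<mu>0 + 1)), and
  the bound on the second moment for all t > 0 dominates it by the same power. This second
  derivative of the logarithm governs the width of the peak.\<close>

lemma log_moment_2_leading:
  "((\<lambda>\<alpha>. \<alpha> powr (\<mu>0 + 2) * log_moment 2 \<alpha>) \<longlongrightarrow> \<mu>0 * (\<mu>0 + 1) * riemann_zeta (\<mu>0 + 1) * A (i 0)) (at_right 0)"
proof -
  let ?c = "\<mu>0 * (\<mu>0 + 1) * A (i 0)"
  have z: "1 < \<mu>0 + 1" using \<mu>0_pos by simp
  obtain C where C: "C > 0" "\<And>t. 0 < t \<Longrightarrow> moment 2 t \<le> C * t powr (- (\<mu>0 + real 2))"
    using ex_moment_le by blast
  have lead: "((\<lambda>t. t powr (\<mu>0 + 2) * moment 2 t) \<longlongrightarrow> ?c) (at_right 0)"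
  proof -
    have "(\<Prod>l<2. i 0 - real l) = \<mu>0 * (\<mu>0 + 1)" by (simp add: numeral_2_eq_2 algebra_simps)
    then show ?thesis using moment_leading[of 2] by (simp add: mult_ac)
  qed
  define a where "a k \<alpha> = ((real (Suc k) * \<alpha>) powr (\<mu>0 + 2) * moment 2 (real (Suc k) * \<alpha>)) * real (Suc k) powr (- (\<mu>0 + 1))" for k \<alpha>
  have "((\<lambda>\<alpha>. \<Sum>k. a k \<alpha>) \<longlongrightarrow> (\<Sum>k. ?c * real (Suc k) powr (- (\<mu>0 + 1)))) (at_right 0)"
  proof (rule tannerys_theorem[THEN conjunct2, THEN conjunct2])
    fix k
    have "filterlim (\<lambda>\<alpha>. real (Suc k) * \<alpha>) (at_right 0) (at_right 0)"
      by (auto simp: filterlim_at intro!: tendsto_eq_intros eventually_mono[OF eventually_at_right_less])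
    from tendsto_mult[OF filterlim_compose[OF lead this] tendsto_const]
    show "((\<lambda>\<alpha>. a k \<alpha>) \<longlongrightarrow> ?c * real (Suc k) powr (- (\<mu>0 + 1))) (at_right 0)"
      unfolding a_def .
  next
    have "norm (a k \<alpha>) \<le> C * real (Suc k) powr (- (\<mu>0 + 1))" if \<alpha>: "0 < \<alpha>" for k \<alpha>
    proof -
      let ?t = "real (Suc k) * \<alpha>"
      have t: "0 < ?t" using \<alpha> by simp
      have "?t powr (\<mu>0 + 2) * moment 2 ?t \<le> ?t powr (\<mu>0 + 2) * (C * ?t powr (- (\<mu>0 + real 2)))"
        using t by (intro mult_left_mono C(2)) auto
      also have "\<dots> = C * (?t powr (\<mu>0 + 2) * ?t powr (- (\<mu>0 + 2)))" by simp
      also have "?t powr (\<mu>0 + 2) * ?t powr (- (\<mu>0 + 2)) = 1" using t \<alpha> unfolding powr_add[symmetric] by simp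
      finally have "?t powr (\<mu>0 + 2) * moment 2 ?t \<le> C" by simp
      moreover have "0 \<le> ?t powr (\<mu>0 + 2) * moment 2 ?t" using t by (intro mult_nonneg_nonneg less_imp_le[OF moment_pos]) auto
      ultimately have "\<bar>?t powr (\<mu>0 + 2) * moment 2 ?t\<bar> \<le> C" by linarith
      then show ?thesis unfolding a_def norm_mult by (intro mult_mono) auto
    qed
    then show "\<forall>\<^sub>F (k, \<alpha>) in sequentially \<times>\<^sub>F at_right 0. norm (a k \<alpha>) \<le> C * real (Suc k) powr (- (\<mu>0 + 1))"
      using eventually_prod2[of sequentially "\<lambda>\<alpha>. 0 < \<alpha>" "at_right (0::real)"] eventually_at_right_less
      by (auto elim!: eventually_mono)
    show "summable (\<lambda>k. C * real (Suc k) powr (- (\<mu>0 + 1)))" by (intro summable_mult summable_Suc_powr z)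
  qed simp
  moreover have "(\<Sum>k. ?c * real (Suc k) powr (- (\<mu>0 + 1))) = ?c * riemann_zeta (\<mu>0 + 1)"
    by (rule sums_unique[symmetric, OF sums_mult[OF riemann_zeta_sums[OF z]]])
  moreover have "\<forall>\<^sub>F \<alpha> in at_right 0. (\<Sum>k. a k \<alpha>) = \<alpha> powr (\<mu>0 + 2) * log_moment 2 \<alpha>"
    using eventually_at_right_less
  proof eventually_elim
    case (elim \<alpha>)
    have "a k \<alpha> = \<alpha> powr (\<mu>0 + 2) * (real (Suc k) ^ 2 / real (Suc k) * moment 2 (real (Suc k) * \<alpha>))" for k
    proof -
      let ?k = "real (Suc k)"
      have "a k \<alpha> = ?k powr (\<mu>0 + 2) * \<alpha> powr (\<mu>0 + 2) * moment 2 (?k * \<alpha>) * ?k powr (- (\<mu>0 + 1))"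
        unfolding a_def using elim by (subst powr_mult) auto
      also have "\<dots> = \<alpha> powr (\<mu>0 + 2) * ((?k powr (\<mu>0 + 2) * ?k powr (- (\<mu>0 + 1))) * moment 2 (?k * \<alpha>))"
        by (simp only: mult_ac)
      also have "?k powr (\<mu>0 + 2) * ?k powr (- (\<mu>0 + 1)) = ?k ^ 2 / ?k"
        unfolding powr_add[symmetric] by (simp add: power2_eq_square)
      finally show ?thesis .
    qed
    then show ?case by (simp only: log_moment_def suminf_mult[OF summable_log_moment[OF elim]])
  qed
  ultimately have "((\<lambda>\<alpha>. \<alpha> powr (\<mu>0 + 2) * log_moment 2 \<alpha>) \<longlongrightarrow> ?c * riemann_zeta (\<mu>0 + 1)) (at_right 0)"
    by (auto elim: Lim_transform_eventually)
  then show ?thesis by (simp add: mult_ac)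
qed

lemma continuous_on_rest: "continuous_on {0<..} (rest N q)"
  by (intro DERIV_continuous_on) (auto intro: DERIV_subset[OF DERIV_rest])

text \<open>At infinity the moment is small and the subtracted powers remain, the largest exponent
  among them being that of index N.\<close>

lemma rest_bigo_at_top: "rest N q \<in> O[at_top](\<lambda>t. t powr (i N - real q))"
  unfolding rest_def[abs_def] main_part_def
proof (intro sum_in_bigo(2) big_sum_in_bigo)
  obtain C where C: "C > 0" "\<And>t. 0 < t \<Longrightarrow> moment q t \<le> C * t powr (- (\<mu>0 + real q))"
    using ex_moment_le by blast
  have "moment q \<in> O[at_top](\<lambda>t. t powr (- (\<mu>0 + real q)))"
  proof (rule bigoI[where c = C])
    show "\<forall>\<^sub>F t in at_top. norm (moment q t) \<le> C * norm (t powr (- (\<mu>0 + real q)))"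
      using eventually_gt_at_top[of 0]
      by eventually_elim (use C(2) moment_pos[of _ q] in \<open>auto simp: less_imp_le\<close>)
  qed
  also have "(\<lambda>t. t powr (- (\<mu>0 + real q))) \<in> O[at_top](\<lambda>t::real. t powr (i N - real q))"
    using i_0_le[of N] by (intro powr_bigo_at_top) simp
  finally show "(\<lambda>t. (- 1) ^ q * moment q t) \<in> O[at_top](\<lambda>t. t powr (i N - real q))" by simp
next
  fix n assume "n \<in> {..N}"
  then have "(\<lambda>t. t powr (i n - real q)) \<in> O[at_top](\<lambda>t::real. t powr (i N - real q))"
    using strict_mono_i by (intro powr_bigo_at_top) (simp add: strict_mono_less_eq)
  then show "(\<lambda>t. A (i n) * (\<Prod>l<q. i n - real l) * t powr (i n - real q)) \<in> O[at_top](\<lambda>t. t powr (i N - real q))"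
    by simp
qed

end

section \<open>Expansions up to o(1), including the constant terms\<close>

locale admissible_split = admissible_seq +
  fixes d :: nat
  assumes d: "0 < - i n \<longleftrightarrow> n \<le> d"
begin

text \<open>\<open>\<delta>\<close> bounds the positive exponents from below; the exponent \<open>0\<close>, if it occurs, has index \<open>Suc d\<close>.\<close>
definition \<delta> :: real where
  "\<delta> = min 1 (if 0 < i (Suc d) then i (Suc d) else i (Suc (Suc d)))"

text \<open>The smallest positive \<mu>. In \<open>rest d\<close> only negative powers are
  subtracted, so it decays at least like t powr (- \<epsilon>) at infinity.\<close>

definition \<epsilon> :: real where "\<epsilon> = - i d"

lemma \<epsilon>_pos: "0 < \<epsilon>"
  using d[of d] by (simp add: \<epsilon>_def)

lemma i_Suc_d_nonneg: "0 \<le> i (Suc d)"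
  using d[of "Suc d"] by simp

lemma \<delta>_bounds: "0 < \<delta>" "\<delta> \<le> 1"
proof -
  have "i (Suc d) < i (Suc (Suc d))" using strict_mono_i by (simp add: strict_mono_less)
  then show "0 < \<delta>" "\<delta> \<le> 1" using i_Suc_d_nonneg by (auto simp: \<delta>_def)
qed

lemma i_gt_d:
  assumes "d < n"
  shows "i n = 0 \<and> n = Suc d \<or> \<delta> \<le> i n"
proof (cases "0 < i (Suc d) \<or> Suc d < n")
  case True
  have "i (Suc d) \<le> i n" using strict_mono_i assms by (simp add: strict_mono_less_eq)
  moreover have "i (Suc (Suc d)) \<le> i n" if "Suc d < n" using strict_mono_i that by (simp add: strict_mono_less_eq)
  ultimately show ?thesis using True by (auto simp: \<delta>_def min_def)
next
  case False
  then have "n = Suc d" using assms by simp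
  then show ?thesis using False i_Suc_d_nonneg by auto
qed

lemma i_le_d: "n \<le> d \<Longrightarrow> i n \<le> - \<epsilon>"
  using strict_mono_i by (simp add: \<epsilon>_def strict_mono_less_eq)

text \<open>The exponent 0 can only have index \<open>Suc d\<close>; if it does not occur,
  \<open>A 0\<close> is 0 by the convention in \<open>admissible\<close>.\<close>

lemma constant_term:
  assumes "Suc d \<le> N"
  shows "(\<Sum>n\<in>{d<..N}. if i n = 0 then A (i n) else 0) = A 0"
proof (cases "i (Suc d) = 0")
  case True
  then have e: "A (i (Suc d)) = A 0" by (rule arg_cong)
  have "i n = 0 \<longleftrightarrow> n = Suc d" if "d < n" for n
    using i_gt_d[OF that] \<delta>_bounds True by auto
  then have "(if i n = 0 then A (i n) else 0) = (if n = Suc d then A 0 else 0)" if "d < n" for n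
    using that by (cases "n = Suc d") (simp_all add: e)
  then have "(\<Sum>n\<in>{d<..N}. if i n = 0 then A (i n) else 0) = (\<Sum>n\<in>{d<..N}. if n = Suc d then A 0 else 0)"
    by (intro sum.cong refl) simp
  also have "\<dots> = A 0" using assms by (simp add: sum.delta)
  finally show ?thesis .
next
  case False
  have "i n \<noteq> 0" for n
  proof (cases "n \<le> d")
    case True
    then show ?thesis using d[of n] by auto
  next
    case False
    then show ?thesis using i_gt_d[of n] \<delta>_bounds \<open>i (Suc d) \<noteq> 0\<close> by auto
  qed
  then have "A 0 = 0" by (intro A_eq_0) (auto simp: image_iff)
  then show ?thesis using \<open>\<And>n. i n \<noteq> 0\<close> by simp
qed

text \<open>The remainder bounds for derivatives hold only for large N. Statements on
  \<open>rest d\<close> are therefore obtained from such a \<open>rest N\<close> by adding finitely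
  many explicit powers.\<close>

lemma ex_rest_expansion:
  "\<exists>N>d. rest N 0 \<in> O[at_right 0](\<lambda>t. t powr 1) \<and> rest N 1 \<in> O[at_right 0](\<lambda>t. t powr 0)"
proof -
  obtain N0 where N0: "\<And>N. N \<ge> N0 \<Longrightarrow> rest N 0 \<in> O[at_right 0](\<lambda>t. t powr 1)" using ex_rest_bigo by blast
  obtain N1 where N1: "\<And>N. N \<ge> N1 \<Longrightarrow> rest N 1 \<in> O[at_right 0](\<lambda>t. t powr 0)" using ex_rest_bigo by blast
  show ?thesis using N0[of "max (Suc d) (max N0 N1)"] N1[of "max (Suc d) (max N0 N1)"]
    by (intro exI[of _ "max (Suc d) (max N0 N1)"]) auto
qed

lemma rest_split:
  assumes "d < N"
  shows "rest d q t = rest N q t + (\<Sum>n\<in>{d<..N}. A (i n) * (\<Prod>l<q. i n - real l) * t powr (i n - real q))"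
proof -
  have "{..N} = {..d} \<union> {d<..N}" using assms by auto
  then have "main_part N q t = main_part d q t + (\<Sum>n\<in>{d<..N}. A (i n) * (\<Prod>l<q. i n - real l) * t powr (i n - real q))"
    unfolding main_part_def by (simp add: sum.union_disjoint ivl_disj_int)
  then show ?thesis by (simp add: rest_def)
qed

lemma rest_0_bigo: "(\<lambda>t. rest d 0 t - A 0) \<in> O[at_right 0](\<lambda>t. t powr \<delta>)"
proof -
  obtain N where N: "d < N" and rN: "rest N 0 \<in> O[at_right 0](\<lambda>t. t powr 1)" using ex_rest_expansion by blast
  have "(\<lambda>t. rest N 0 t + (\<Sum>n\<in>{d<..N}. if i n = 0 then 0 else A (i n) * t powr i n)) \<in> O[at_right 0](\<lambda>t. t powr \<delta>)"
  proof (intro sum_in_bigo(1) big_sum_in_bigo)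
    show "rest N 0 \<in> O[at_right 0](\<lambda>t. t powr \<delta>)"
      using rN powr_bigo_at_right_0[OF \<delta>_bounds(2)] by (rule landau_o.big_trans)
    fix n assume n: "n \<in> {d<..N}"
    show "(\<lambda>t. if i n = 0 then 0 else A (i n) * t powr i n) \<in> O[at_right 0](\<lambda>t. t powr \<delta>)"
      using i_gt_d[of n] n powr_bigo_at_right_0[of \<delta> "i n"] by (cases "i n = 0") auto
  qed
  also have "?this \<longleftrightarrow> ?thesis"
  proof (rule landau_o.big.in_cong)
    show "\<forall>\<^sub>F t in at_right 0. rest N 0 t + (\<Sum>n\<in>{d<..N}. if i n = 0 then 0 else A (i n) * t powr i n) = rest d 0 t - A 0"
      using eventually_at_right_less
    proof eventually_elim
      case (elim t)
      have "(\<Sum>n\<in>{d<..N}. A (i n) * t powr i n) = (\<Sum>n\<in>{d<..N}. if i n = 0 then 0 else A (i n) * t powr i n)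
          + (\<Sum>n\<in>{d<..N}. if i n = 0 then A (i n) else 0)"
        unfolding sum.distrib[symmetric] using elim by (intro sum.cong) auto
      then show ?case using rest_split[OF N, of 0 t] constant_term[of N] N by simp
    qed
  qed
  finally show ?thesis .
qed

text \<open>A constant term disappears on differentiation, and all other exponents after index d are
  at least \<delta>.\<close>

lemma rest_1_bigo: "rest d 1 \<in> O[at_right 0](\<lambda>t. t powr (\<delta> - 1))"
proof -
  obtain N where N: "d < N" and rN: "rest N 1 \<in> O[at_right 0](\<lambda>t. t powr 0)" using ex_rest_expansion by blast
  have "(\<lambda>t. rest N 1 t + (\<Sum>n\<in>{d<..N}. A (i n) * i n * t powr (i n - 1))) \<in> O[at_right 0](\<lambda>t. t powr (\<delta> - 1))"
  proof (intro sum_in_bigo(1) big_sum_in_bigo)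
    show "rest N 1 \<in> O[at_right 0](\<lambda>t. t powr (\<delta> - 1))"
      using rN powr_bigo_at_right_0[of "\<delta> - 1" 0] \<delta>_bounds by (auto intro: landau_o.big_trans)
    fix n assume n: "n \<in> {d<..N}"
    show "(\<lambda>t. A (i n) * i n * t powr (i n - 1)) \<in> O[at_right 0](\<lambda>t. t powr (\<delta> - 1))"
      using i_gt_d[of n] n powr_bigo_at_right_0[of "\<delta> - 1" "i n - 1"] by (cases "i n = 0") auto
  qed
  also have "(\<lambda>t. rest N 1 t + (\<Sum>n\<in>{d<..N}. A (i n) * i n * t powr (i n - 1))) = rest d 1"
    using rest_split[OF N, of 1] by (simp add: fun_eq_iff)
  finally show ?thesis .
qed

text \<open>
  Both terms with \<open>A 0\<close> in the theorem come from the subtracted \<open>A 0 * exp (- t)\<close>: summed over the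
  multiples of \<open>\<alpha>\<close> it gives \<open>- A 0 * ln (1 - exp (- \<alpha>))\<close>, and its Mellin transform \<open>A 0 * Gamma s\<close>
  accounts for the value \<open>A 0\<close> of the zeta function at \<open>0\<close>.
\<close>
definition const_integrand :: "real \<Rightarrow> real" where
  "const_integrand t = (rest d 0 t - A 0 * exp (- t)) / t"

lemma rest_d_bigo_at_top: "rest d q \<in> O[at_top](\<lambda>t. t powr (- \<epsilon> - real q))"
  using rest_bigo_at_top[of d q] by (simp add: \<epsilon>_def)

text \<open>At 0 the subtracted exponential cancels the constant term up to O(t), leaving t powr
  \<delta> in the numerator; at infinity it is negligible against t powr (- \<epsilon>).\<close>

lemma ex_const_integrand_bound: "\<exists>C. \<forall>t>0. \<bar>const_integrand t\<bar> \<le> C * two_sided \<delta> \<epsilon> t"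
proof (rule ex_two_sided_bound)
  show "continuous_on {0<..} const_integrand"
    unfolding const_integrand_def[abs_def] by (intro continuous_intros continuous_on_rest) auto
  have inv_0: "(\<lambda>t. x t / t) \<in> O[at_right 0](\<lambda>t. t powr (\<delta> - 1))" if "x \<in> O[at_right 0](\<lambda>t. t powr \<delta>)" for x :: "real \<Rightarrow> real"
  proof -
    have "(\<lambda>t. x t * inverse t) \<in> O[at_right 0](\<lambda>t. t powr \<delta> * inverse t)"
      by (intro landau_o.big.mult that landau_o.big_refl)
    also have "O[at_right 0](\<lambda>t. t powr \<delta> * inverse t) = O[at_right 0](\<lambda>t. t powr (\<delta> - 1))"
      by (rule landau_o.big.cong, rule eventually_mono[OF eventually_at_right_less])
         (auto simp: powr_diff divide_inverse)
    finally show ?thesis by (simp add: divide_inverse)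
  qed
  have "(\<lambda>t. 1 - exp (- t)) \<in> O[at_right 0](\<lambda>t::real. t powr 1)"
  proof (rule bigoI[where c = 1])
    have "norm (1 - exp (- t)) \<le> 1 * norm (t powr 1)" if "0 < t" for t :: real
      using that exp_ge_add_one_self[of "- t"] by simp
    then show "\<forall>\<^sub>F t in at_right 0. norm (1 - exp (- t)) \<le> 1 * norm (t powr 1 :: real)"
      by (intro eventually_mono[OF eventually_at_right_less])
  qed
  then have "(\<lambda>t. 1 - exp (- t)) \<in> O[at_right 0](\<lambda>t::real. t powr \<delta>)"
    using powr_bigo_at_right_0[OF \<delta>_bounds(2)] by (rule landau_o.big_trans)
  then have "(\<lambda>t. (rest d 0 t - A 0) + A 0 * (1 - exp (- t))) \<in> O[at_right 0](\<lambda>t. t powr \<delta>)"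
    by (intro sum_in_bigo(1) rest_0_bigo) simp
  then have "(\<lambda>t. ((rest d 0 t - A 0) + A 0 * (1 - exp (- t))) / t) \<in> O[at_right 0](\<lambda>t. t powr (\<delta> - 1))"
    by (rule inv_0)
  then show "const_integrand \<in> O[at_right 0](\<lambda>t. t powr (\<delta> - 1))"
    by (simp add: const_integrand_def[abs_def] algebra_simps)
  have "(\<lambda>t. rest d 0 t - A 0 * exp (- t)) \<in> O[at_top](\<lambda>t. t powr (- \<epsilon>))"
    using rest_d_bigo_at_top[of 0] exp_minus_bigo_at_top[of \<epsilon>] by (intro sum_in_bigo(2)) auto
  then have "(\<lambda>t. (rest d 0 t - A 0 * exp (- t)) * inverse t) \<in> O[at_top](\<lambda>t. t powr (- \<epsilon>) * inverse t)"
    by (intro landau_o.big.mult landau_o.big_refl)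
  also have "O[at_top](\<lambda>t. t powr (- \<epsilon>) * inverse t) = O[at_top](\<lambda>t. t powr (- \<epsilon> - 1))"
    by (rule landau_o.big.cong, rule eventually_mono[OF eventually_gt_at_top[of 0]])
       (auto simp: powr_diff divide_inverse)
  finally show "const_integrand \<in> O[at_top](\<lambda>t. t powr (- \<epsilon> - 1))"
    by (simp add: const_integrand_def[abs_def] divide_inverse)
qed

lemma ex_rest_1_bound: "\<exists>C. \<forall>t>0. \<bar>- rest d 1 t\<bar> \<le> C * two_sided \<delta> \<epsilon> t"
  using rest_d_bigo_at_top[of 1] rest_1_bigo
  by (intro ex_two_sided_bound continuous_intros continuous_on_rest) auto

text \<open>The primitive \<open>- rest d 0\<close> goes from - A 0 at 0 to 0 at infinity. This is
  the source of the summand \<open>A 0\<close> in the exponent of the theorem.\<close>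

lemma integral_rest_1: "(LINT t:{0<..}|lborel. - rest d 1 t) = A 0"
proof -
  have si: "set_integrable lborel {0<..} (\<lambda>t. - rest d 1 t)"
  proof -
    obtain C where C: "\<And>t. 0 < t \<Longrightarrow> \<bar>- rest d 1 t\<bar> \<le> C * two_sided \<delta> \<epsilon> t" using ex_rest_1_bound by blast
    define g where "g t = indicator {0<..} t *\<^sub>R (- rest d 1 t)" for t
    have "g \<in> borel_measurable borel" unfolding g_def
      by (rule borel_measurable_continuous_on_indicator) (auto intro!: continuous_intros continuous_on_rest)
    then have "set_integrable lborel {0<..} g"
      by (rule set_integrable_two_sided_bound[OF _ \<delta>_bounds(1) \<epsilon>_pos, of _ C]) (use C in \<open>auto simp: g_def\<close>)
    then show ?thesis by (subst (asm) set_integrable_cong[OF refl refl, of _ _ "\<lambda>t. - rest d 1 t"]) (auto simp: g_def)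
  qed
  have "(LBINT t=0..\<infinity>. - rest d 1 t) = 0 - (- A 0)"
  proof (rule interval_integral_FTC_integrable[where F = "\<lambda>t. - rest d 0 t"])
    show "((\<lambda>t. - rest d 0 t) has_vector_derivative - rest d 1 x) (at x)" if "0 < ereal x" "ereal x < \<infinity>" for x
      using that DERIV_rest[of x d 0] by (auto intro!: derivative_eq_intros simp flip: has_real_derivative_iff_has_vector_derivative)
    show "isCont (\<lambda>t. - rest d 1 t) x" if "0 < ereal x" "ereal x < \<infinity>" for x
      using that DERIV_isCont[OF DERIV_rest[of x d 1]] by (auto intro: isCont_minus)
    have e: "einterval 0 \<infinity> = {0<..}" by (auto simp: einterval_def)
    show "set_integrable lborel (einterval 0 \<infinity>) (\<lambda>t. - rest d 1 t)" using si unfolding e .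
    obtain C e where C: "C > 0" "e > 0" "\<And>t. 0 < t \<Longrightarrow> t < e \<Longrightarrow> \<bar>rest d 0 t - A 0\<bar> \<le> C * t powr \<delta>"
      using bigo_powr_at_right_0E[OF rest_0_bigo] by blast
    have "((\<lambda>t. rest d 0 t - A 0) \<longlongrightarrow> 0) (at_right 0)"
    proof (rule Lim_null_comparison)
      show "\<forall>\<^sub>F t in at_right 0. norm (rest d 0 t - A 0) \<le> C * t powr \<delta>"
        using C by (auto simp: eventually_at_right_field)
      have "((\<lambda>t. C * t powr \<delta>) \<longlongrightarrow> C * 0) (at_right 0)"
        using \<delta>_bounds by (intro tendsto_mult tendsto_const tendsto_powr_at_right_0)
      then show "((\<lambda>t. C * t powr \<delta>) \<longlongrightarrow> 0) (at_right 0)" by simp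
    qed
    from tendsto_minus[OF tendsto_add[OF this tendsto_const[of "A 0"]]]
    have "((\<lambda>t. - rest d 0 t) \<longlongrightarrow> - A 0) (at_right 0)" by simp
    then show "(((\<lambda>t. - rest d 0 t) \<circ> real_of_ereal) \<longlongrightarrow> - A 0) (at_right 0)"
      unfolding zero_ereal_def ereal_tendsto_simps .
    have "(rest d 0 \<longlongrightarrow> 0) at_top"
    proof -
      obtain C where C: "C > 0" "\<forall>\<^sub>F t in at_top. norm (rest d 0 t) \<le> C * norm (t powr (- \<epsilon> - real 0))"
        using rest_d_bigo_at_top by (rule landau_o.bigE)
      have "((\<lambda>t. t powr (- \<epsilon>)) \<longlongrightarrow> 0) at_top" using \<epsilon>_pos by (intro tendsto_neg_powr filterlim_ident) auto
      from tendsto_mult[OF tendsto_const[of C] this] show ?thesis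
        by (intro Lim_null_comparison[OF C(2)]) simp
    qed
    from tendsto_minus[OF this]
    have "((\<lambda>t. - rest d 0 t) \<longlongrightarrow> 0) at_top" by simp
    then show "(((\<lambda>t. - rest d 0 t) \<circ> real_of_ereal) \<longlongrightarrow> 0) (at_left \<infinity>)"
      unfolding ereal_tendsto_simps .
  qed simp
  then show ?thesis
    by (simp add: interval_lebesgue_integral_def einterval_def greaterThan_def)
qed

text \<open>For n \<le> d the exponent is negative, so the zeta series at 1 - i n converges. It
  would diverge for the later exponents, which are left to the Riemann sum.\<close>

lemma powr_main_sums:
  assumes \<alpha>: "0 < \<alpha>"
  shows "(\<lambda>k. (\<Sum>n\<le>d. c n * (real (Suc k) * \<alpha>) powr i n) / real (Suc k)) sums
     (\<Sum>n\<le>d. c n * \<alpha> powr i n * riemann_zeta (1 - i n))"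
proof -
  have "(\<lambda>k. \<Sum>n\<le>d. c n * \<alpha> powr i n * real (Suc k) powr (- (1 - i n))) sums
     (\<Sum>n\<le>d. c n * \<alpha> powr i n * riemann_zeta (1 - i n))"
  proof (intro sums_sum sums_mult riemann_zeta_sums)
    fix n assume "n \<in> {..d}"
    then show "1 < 1 - i n" using d[of n] by simp
  qed
  moreover have "(\<Sum>n\<le>d. c n * \<alpha> powr i n * real (Suc k) powr (- (1 - i n)))
     = (\<Sum>n\<le>d. c n * (real (Suc k) * \<alpha>) powr i n) / real (Suc k)" for k
    unfolding sum_divide_distrib powr_mult
    by (intro sum.cong refl) (simp add: powr_diff)
  ultimately show ?thesis by simp
qed

lemma exp_over_sums:
  assumes "0 < \<alpha>"
  shows "(\<lambda>k. exp (- (real (Suc k) * \<alpha>)) / real (Suc k)) sums (- ln (1 - exp (- \<alpha>)))"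
proof -
  have "\<bar>- exp (- \<alpha>)\<bar> < 1" using assms by simp
  from sums_minus[OF ln_series'[OF this]]
  have "(\<lambda>n. exp (- \<alpha>) ^ n / real n) sums (- ln (1 - exp (- \<alpha>)))" by simp
  then have "(\<lambda>n. exp (- \<alpha>) ^ Suc n / real (Suc n)) sums (- ln (1 - exp (- \<alpha>)))"
    by (subst sums_Suc_iff) simp
  then show ?thesis by (simp add: exp_of_nat_mult[symmetric] del: power_Suc of_nat_Suc)
qed

text \<open>In theta at (k + 1) * \<alpha>, divided by k + 1, the negative powers give zeta values
  and the exponential gives a logarithm. For what remains, 1 / (k + 1) = \<alpha> / ((k + 1) *
  \<alpha>) exhibits a Riemann sum.\<close>

theorem log_moment_0_expansion:
  "((\<lambda>\<alpha>. log_moment 0 \<alpha> - (\<Sum>n\<le>d. A (i n) * \<alpha> powr i n * riemann_zeta (1 - i n)) + A 0 * ln \<alpha>)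
     \<longlongrightarrow> (LINT t:{0<..}|lborel. const_integrand t)) (at_right 0)"
proof -
  obtain C where C: "\<And>t. 0 < t \<Longrightarrow> \<bar>const_integrand t\<bar> \<le> C * two_sided \<delta> \<epsilon> t"
    using ex_const_integrand_bound by blast
  have "continuous_on {0<..} const_integrand"
    unfolding const_integrand_def[abs_def] by (intro continuous_intros continuous_on_rest) auto
  from riemann_sum_tendsto[OF this \<delta>_bounds \<epsilon>_pos C]
  have 1: "((\<lambda>\<alpha>. \<Sum>k. \<alpha> * const_integrand (real (Suc k) * \<alpha>)) \<longlongrightarrow> (LINT t:{0<..}|lborel. const_integrand t)) (at_right 0)"
    by blast
  \<comment> \<open>This replaces ln (1 - exp (- \<alpha>)) by ln \<alpha> up to o(1).\<close>
  have "((\<lambda>\<alpha>::real. ln ((1 - exp (- \<alpha>)) / \<alpha>)) \<longlongrightarrow> ln 1) (at_right 0)"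
  proof (rule tendsto_ln)
    have "((\<lambda>x::real. - exp (- x)) has_real_derivative 1) (at 0)"
      by (auto intro!: derivative_eq_intros)
    then have "((\<lambda>h::real. (1 - exp (- h)) / h) \<longlongrightarrow> 1) (at 0)"
      by (simp add: DERIV_def)
    then show "((\<lambda>\<alpha>::real. (1 - exp (- \<alpha>)) / \<alpha>) \<longlongrightarrow> 1) (at_right 0)"
      by (rule filterlim_mono[OF _ order_refl at_le]) simp
  qed simp
  from tendsto_diff[OF 1 tendsto_mult[OF tendsto_const[of "A 0"] this]]
  have "((\<lambda>\<alpha>. (\<Sum>k. \<alpha> * const_integrand (real (Suc k) * \<alpha>)) - A 0 * ln ((1 - exp (- \<alpha>)) / \<alpha>))
    \<longlongrightarrow> (LINT t:{0<..}|lborel. const_integrand t)) (at_right 0)" by simp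
  moreover have "\<forall>\<^sub>F \<alpha> in at_right 0. (\<Sum>k. \<alpha> * const_integrand (real (Suc k) * \<alpha>)) - A 0 * ln ((1 - exp (- \<alpha>)) / \<alpha>)
    = log_moment 0 \<alpha> - (\<Sum>n\<le>d. A (i n) * \<alpha> powr i n * riemann_zeta (1 - i n)) + A 0 * ln \<alpha>"
    using eventually_at_right_less
  proof eventually_elim
    case (elim \<alpha>)
    have "(\<lambda>k. real (Suc k) ^ 0 / real (Suc k) * moment 0 (real (Suc k) * \<alpha>)
        - (\<Sum>n\<le>d. A (i n) * (real (Suc k) * \<alpha>) powr i n) / real (Suc k)
        - A 0 * (exp (- (real (Suc k) * \<alpha>)) / real (Suc k))) sums
      (log_moment 0 \<alpha> - (\<Sum>n\<le>d. A (i n) * \<alpha> powr i n * riemann_zeta (1 - i n)) - A 0 * (- ln (1 - exp (- \<alpha>))))"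
      unfolding log_moment_def
      by (intro sums_diff sums_mult powr_main_sums exp_over_sums summable_sums summable_log_moment elim)
    also have "(\<lambda>k. real (Suc k) ^ 0 / real (Suc k) * moment 0 (real (Suc k) * \<alpha>)
        - (\<Sum>n\<le>d. A (i n) * (real (Suc k) * \<alpha>) powr i n) / real (Suc k)
        - A 0 * (exp (- (real (Suc k) * \<alpha>)) / real (Suc k))) = (\<lambda>k. \<alpha> * const_integrand (real (Suc k) * \<alpha>))"
      using elim by (intro ext) (simp add: const_integrand_def rest_def main_part_def field_simps del: of_nat_Suc)
    finally have "(\<Sum>k. \<alpha> * const_integrand (real (Suc k) * \<alpha>)) =
      log_moment 0 \<alpha> - (\<Sum>n\<le>d. A (i n) * \<alpha> powr i n * riemann_zeta (1 - i n)) - A 0 * (- ln (1 - exp (- \<alpha>)))"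
      by (simp add: sums_iff)
    moreover have "ln ((1 - exp (- \<alpha>)) / \<alpha>) = ln (1 - exp (- \<alpha>)) - ln \<alpha>"
      using elim by (simp add: ln_div)
    ultimately show ?case by (simp only: right_diff_distrib mult_minus_right)
  qed
  ultimately show ?thesis by (rule Lim_transform_eventually)
qed

text \<open>At the saddle point the first term is n * \<alpha>. Its negative powers are \<mu> times
  those of \<open>log_moment_0_expansion\<close>, whence the factors \<mu> + 1 in the
  theorem.\<close>

theorem log_moment_1_expansion:
  "((\<lambda>\<alpha>. \<alpha> * log_moment 1 \<alpha> - (\<Sum>n\<le>d. - i n * A (i n) * \<alpha> powr i n * riemann_zeta (1 - i n)))
     \<longlongrightarrow> A 0) (at_right 0)"
proof -
  obtain C where C: "\<And>t. 0 < t \<Longrightarrow> \<bar>- rest d 1 t\<bar> \<le> C * two_sided \<delta> \<epsilon> t"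
    using ex_rest_1_bound by blast
  have "continuous_on {0<..} (\<lambda>t. - rest d 1 t)"
    by (intro continuous_intros continuous_on_rest)
  from riemann_sum_tendsto[OF this \<delta>_bounds \<epsilon>_pos C]
  have "((\<lambda>\<alpha>. \<Sum>k. \<alpha> * - rest d 1 (real (Suc k) * \<alpha>)) \<longlongrightarrow> A 0) (at_right 0)"
    unfolding integral_rest_1 by blast
  moreover have "\<forall>\<^sub>F \<alpha> in at_right 0. (\<Sum>k. \<alpha> * - rest d 1 (real (Suc k) * \<alpha>)) =
     \<alpha> * log_moment 1 \<alpha> - (\<Sum>n\<le>d. - i n * A (i n) * \<alpha> powr i n * riemann_zeta (1 - i n))"
    using eventually_at_right_less
  proof eventually_elim
    case (elim \<alpha>)
    have "(\<lambda>k. \<alpha> * (real (Suc k) ^ 1 / real (Suc k) * moment 1 (real (Suc k) * \<alpha>))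
        - (\<Sum>n\<le>d. - i n * A (i n) * (real (Suc k) * \<alpha>) powr i n) / real (Suc k)) sums
      (\<alpha> * log_moment 1 \<alpha> - (\<Sum>n\<le>d. - i n * A (i n) * \<alpha> powr i n * riemann_zeta (1 - i n)))"
      unfolding log_moment_def
      by (intro sums_diff sums_mult powr_main_sums summable_sums summable_log_moment elim)
    moreover have "\<alpha> * (real (Suc k) ^ 1 / real (Suc k) * moment 1 (real (Suc k) * \<alpha>))
        - (\<Sum>n\<le>d. - i n * A (i n) * (real (Suc k) * \<alpha>) powr i n) / real (Suc k) = \<alpha> * - rest d 1 (real (Suc k) * \<alpha>)" for k
    proof -
      let ?t = "real (Suc k) * \<alpha>"
      have t: "0 < ?t" using elim by simp
      have "\<alpha> * (\<Sum>n\<le>d. A (i n) * i n * ?t powr (i n - 1)) = (\<Sum>n\<le>d. i n * A (i n) * ?t powr i n) / real (Suc k)"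
        unfolding sum_distrib_left sum_divide_distrib
      proof (intro sum.cong refl)
        fix n
        have "?t powr (i n - 1) = ?t powr i n / ?t" using t by (simp add: powr_diff)
        then show "\<alpha> * (A (i n) * i n * ?t powr (i n - 1)) = i n * A (i n) * ?t powr i n / real (Suc k)"
          using elim by (simp add: field_simps del: of_nat_Suc)
      qed
      then show ?thesis by (simp add: rest_def main_part_def sum_negf algebra_simps)
    qed
    ultimately show ?case by (simp add: sums_iff)
  qed
  ultimately show ?thesis by (rule Lim_transform_eventually)
qed

end

subsection \<open>Mellin transforms\<close>

text \<open>This is t powr (s - 1) for t > 0, in a form whose measurability in t and derivative in s
  are immediate.\<close>

definition mellin_kernel :: "complex \<Rightarrow> real \<Rightarrow> complex" where
  "mellin_kernel s t = exp ((s - 1) * of_real (ln t))"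

definition mellin :: "(real \<Rightarrow> real) \<Rightarrow> complex \<Rightarrow> complex" where
  "mellin h s = (LINT t:{0<..}|lborel. of_real (h t) * mellin_kernel s t)"

lemma mellin_kernel_eq_powr: "0 < t \<Longrightarrow> mellin_kernel s t = of_real t powr (s - 1)"
  by (simp add: mellin_kernel_def powr_def Ln_of_real)

lemma norm_mellin_kernel: "0 < t \<Longrightarrow> norm (mellin_kernel s t) = t powr (Re s - 1)"
  by (simp add: mellin_kernel_def powr_def)

lemma measurable_mellin_kernel [measurable]: "mellin_kernel s \<in> borel_measurable borel"
  unfolding mellin_kernel_def[abs_def] by measurable

text \<open>The bound is t powr a below 1 and t powr (- b) above, up to C, so that the transform
  exists for - a < Re s < b; the shifts by 1 match the exponents in
  \<open>two_sided\<close>.\<close>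

locale mellin_strip =
  fixes h :: "real \<Rightarrow> real" and C a b :: real
  assumes meas [measurable]: "h \<in> borel_measurable borel"
    and bound: "0 < t \<Longrightarrow> \<bar>h t\<bar> \<le> C * two_sided (a + 1) (b - 1) t"
begin

lemma C_nonneg: "0 \<le> C"
  using bound[of 1] by (auto simp: two_sided_def intro: order_trans[OF abs_ge_zero])

lemma set_integrable_mellin:
  assumes "- a < Re s" "Re s < b"
  shows "set_integrable lborel {0<..} (\<lambda>t. of_real (h t) * mellin_kernel s t)"
proof (rule set_integrable_two_sided_bound[where C = C and p = "a + Re s" and q = "b - Re s"])
  show "norm (of_real (h t) * mellin_kernel s t) \<le> C * two_sided (a + Re s) (b - Re s) t" if t: "0 < t" for t
  proof -
    have "norm (of_real (h t) * mellin_kernel s t) \<le> C * two_sided (a + 1) (b - 1) t * t powr (Re s - 1)"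
      using bound[OF t] t by (simp add: norm_mult norm_mellin_kernel mult_right_mono)
    also have "\<dots> = C * two_sided (a + Re s) (b - Re s) t"
      by (simp add: two_sided_def mult.assoc algebra_simps flip: powr_add)
    finally show ?thesis .
  qed
qed (use assms in \<open>auto, measurable\<close>)

lemma DERIV_mellin:
  assumes s: "- a < Re s" "Re s < b"
  shows "(mellin h has_field_derivative
     (LINT t:{0<..}|lborel. of_real (h t) * mellin_kernel s t * of_real (ln t))) (at s)"
proof -
  \<comment> \<open>A third of the distance to the boundary: the majorant of the difference
    quotients loses 2 * \<eta> in the exponent at either end, and p and q have to stay
    positive.\<close>
  define \<eta> where "\<eta> = min (a + Re s) (b - Re s) / 3"
  have \<eta>: "0 < \<eta>" "2 * \<eta> < a + Re s" "2 * \<eta> < b - Re s"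
    using s by (auto simp: \<eta>_def min_def)
  define p q where "p = a + Re s - 2 * \<eta>" and "q = b - Re s - 2 * \<eta>"
  have pq: "0 < p" "0 < q" using \<eta> by (auto simp: p_def q_def)
  define F where "F w t = indicator {0<..} t *\<^sub>R (of_real (h t) * mellin_kernel s t * ((exp (w * of_real (ln t)) - 1) / w))" for w :: complex and t
  define F0 where "F0 t = indicator {0<..} t *\<^sub>R (of_real (h t) * mellin_kernel s t * of_real (ln t))" for t
  have quotient: "(mellin h (s + w) - mellin h s) / w = integral\<^sup>L lborel (F w)" if w: "w \<noteq> 0" "norm w < \<eta>" for w
  proof -
    have "\<bar>Re w\<bar> < \<eta>" using w abs_Re_le_cmod[of w] by linarith
    then have sw: "- a < Re (s + w)" "Re (s + w) < b" using \<eta> by auto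
    have "mellin h (s + w) - mellin h s = (LINT t:{0<..}|lborel. of_real (h t) * mellin_kernel (s + w) t - of_real (h t) * mellin_kernel s t)"
      unfolding mellin_def by (subst set_integral_diff) (auto intro!: set_integrable_mellin s sw)
    then have "(mellin h (s + w) - mellin h s) / w = (LINT t:{0<..}|lborel. (of_real (h t) * mellin_kernel (s + w) t - of_real (h t) * mellin_kernel s t) / w)"
      by (simp add: set_integral_divide_zero)
    also have "\<dots> = integral\<^sup>L lborel (F w)"
      unfolding set_lebesgue_integral_def F_def
      by (intro Bochner_Integration.integral_cong arg_cong2[where f = scaleR] refl)
         (simp add: mellin_kernel_def algebra_simps exp_add diff_divide_distrib flip: exp_add)
    finally show ?thesis .
  qed
  have F_le: "norm (F w t) \<le> C / \<eta> * (indicator {0<..} t *\<^sub>R two_sided p q t)" if w: "w \<noteq> 0" "norm w < \<eta>" for w t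
  proof (cases "0 < t")
    case t: True
    let ?L = "\<bar>ln t\<bar>"
    have "norm (exp (w * of_real (ln t)) - 1) \<le> exp (norm (w * of_real (ln t))) * norm (w * of_real (ln t))"
      using Taylor_exp_field[of "w * of_real (ln t)" 0] by simp
    also have "\<dots> = norm w * (?L * exp (norm w * ?L))" by (simp add: norm_mult)
    also have "\<dots> \<le> norm w * (?L * exp (\<eta> * ?L))"
      using w by (intro mult_left_mono iffD2[OF exp_le_cancel_iff] mult_right_mono) auto
    finally have "norm ((exp (w * of_real (ln t)) - 1) / w) \<le> ?L * exp (\<eta> * ?L)"
      using w by (simp add: norm_divide divide_le_eq mult.commute)
    \<comment> \<open>A second factor exp (\<eta> * ?L) absorbs the logarithm.\<close>
    also have "?L \<le> exp (\<eta> * ?L) / \<eta>"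
    proof -
      have "\<eta> * ?L \<le> exp (\<eta> * ?L)" using exp_ge_add_one_self[of "\<eta> * ?L"] by linarith
      then show ?thesis using \<eta>(1) by (simp add: le_divide_eq mult.commute)
    qed
    then have "?L * exp (\<eta> * ?L) \<le> exp (\<eta> * ?L) / \<eta> * exp (\<eta> * ?L)" by (rule mult_right_mono) simp
    also have "\<dots> = exp (2 * \<eta> * ?L) / \<eta>" by (simp flip: exp_add)
    also have "exp (2 * \<eta> * ?L) = (if t \<le> 1 then t powr (- 2 * \<eta>) else t powr (2 * \<eta>))"
      using t by (auto simp: powr_def)
    finally have 1: "norm ((exp (w * of_real (ln t)) - 1) / w) \<le> (if t \<le> 1 then t powr (- 2 * \<eta>) else t powr (2 * \<eta>)) / \<eta>" .
    have 2: "norm (of_real (h t) * mellin_kernel s t) \<le> C * two_sided (a + 1) (b - 1) t * t powr (Re s - 1)"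
      using bound[OF t] t by (simp add: norm_mult norm_mellin_kernel mult_right_mono)
    have "norm (F w t) = norm (of_real (h t) * mellin_kernel s t) * norm ((exp (w * of_real (ln t)) - 1) / w)"
      using t by (simp add: F_def norm_mult norm_divide)
    also have "\<dots> \<le> (C * two_sided (a + 1) (b - 1) t * t powr (Re s - 1)) * ((if t \<le> 1 then t powr (- 2 * \<eta>) else t powr (2 * \<eta>)) / \<eta>)"
      using 1 2 C_nonneg by (intro mult_mono) (auto simp: two_sided_nonneg)
    also have "\<dots> = C / \<eta> * two_sided p q t"
    proof -
      have "t powr a * t powr (Re s - 1) * t powr (- 2 * \<eta>) = t powr (p - 1)"
        by (simp add: p_def algebra_simps flip: powr_add)
      moreover have "t powr (- b) * t powr (Re s - 1) * t powr (2 * \<eta>) = t powr (- q - 1)"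
        by (simp add: q_def algebra_simps flip: powr_add)
      ultimately show ?thesis by (simp add: two_sided_def mult.assoc)
    qed
    finally show ?thesis using t by simp
  qed (simp add: F_def)
  have "(\<lambda>w. (mellin h (s + w) - mellin h s) / w) \<midarrow>0\<rightarrow> integral\<^sup>L lborel F0"
    unfolding tendsto_at_iff_sequentially
  proof (intro allI impI)
    fix X :: "nat \<Rightarrow> complex"
    assume X: "\<forall>n. X n \<in> UNIV - {0}" "X \<longlonglongrightarrow> 0"
    have "\<forall>\<^sub>F n in sequentially. norm (X n) < \<eta>"
      using tendsto_norm[OF X(2)] \<eta>(1) by (auto dest: order_tendstoD(2))
    then obtain N where N: "\<And>n. n \<ge> N \<Longrightarrow> norm (X n) < \<eta>" by (auto simp: eventually_sequentially)
    have X': "X (n + N) \<noteq> 0" "norm (X (n + N)) < \<eta>" for n using X N by auto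
    have lim: "(\<lambda>n. X (n + N)) \<longlonglongrightarrow> 0" using X(2) LIMSEQ_ignore_initial_segment by blast
    have "(\<lambda>n. integral\<^sup>L lborel (F (X (n + N)))) \<longlonglongrightarrow> integral\<^sup>L lborel F0"
    proof (rule integral_dominated_convergence)
      show "integrable lborel (\<lambda>t. C / \<eta> * (indicator {0<..} t *\<^sub>R two_sided p q t))"
        using set_integrable_two_sided[OF pq] unfolding set_integrable_def by (rule integrable_mult_right)
      show "AE t in lborel. norm (F (X (n + N)) t) \<le> C / \<eta> * (indicator {0<..} t *\<^sub>R two_sided p q t)" for n
        by (rule AE_I2) (rule F_le[OF X'])
      show "F0 \<in> borel_measurable lborel" unfolding F0_def by measurable
      show "F (X (n + N)) \<in> borel_measurable lborel" for n unfolding F_def by measurable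
      show "AE t in lborel. (\<lambda>n. F (X (n + N)) t) \<longlonglongrightarrow> F0 t"
      proof (rule AE_I2)
        fix t :: real
        have "((\<lambda>w. exp (w * of_real (ln t))) has_field_derivative of_real (ln t)) (at (0::complex))"
          by (auto intro!: derivative_eq_intros)
        then have "(\<lambda>w. (exp (w * of_real (ln t)) - 1) / w) \<midarrow>(0::complex)\<rightarrow> of_real (ln t)"
          by (simp add: DERIV_def)
        then have "(\<lambda>n. (exp (X (n + N) * of_real (ln t)) - 1) / X (n + N)) \<longlonglongrightarrow> of_real (ln t)"
          by (rule filterlim_compose) (use lim X' in \<open>auto simp: filterlim_at\<close>)
        then show "(\<lambda>n. F (X (n + N)) t) \<longlonglongrightarrow> F0 t"
          unfolding F_def F0_def by (intro tendsto_intros)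
      qed
    qed
    then have "(\<lambda>n. (mellin h (s + X (n + N)) - mellin h s) / X (n + N)) \<longlonglongrightarrow> integral\<^sup>L lborel F0"
      using quotient[OF X'] by simp
    then have "(\<lambda>n. (mellin h (s + X n) - mellin h s) / X n) \<longlonglongrightarrow> integral\<^sup>L lborel F0"
      by (rule LIMSEQ_offset)
    then show "((\<lambda>w. (mellin h (s + w) - mellin h s) / w) \<circ> X) \<longlonglongrightarrow> integral\<^sup>L lborel F0"
      by (simp add: o_def)
  qed
  then show ?thesis
    by (simp add: DERIV_def F0_def[abs_def] set_lebesgue_integral_def)
qed

lemma mellin_holomorphic: "mellin h holomorphic_on {s. - a < Re s \<and> Re s < b}"
proof (rule holomorphic_onI)
  fix s assume "s \<in> {s. - a < Re s \<and> Re s < b}"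
  then show "mellin h field_differentiable at s within {s. - a < Re s \<and> Re s < b}"
    using DERIV_mellin field_differentiable_at_within field_differentiable_def by blast
qed

end

definition mellin_integrable :: "(real \<Rightarrow> real) \<Rightarrow> complex \<Rightarrow> bool" where
  "mellin_integrable h s \<longleftrightarrow> set_integrable lborel {0<..} (\<lambda>t. of_real (h t) * mellin_kernel s t)"

lemma mellin_add:
  assumes "mellin_integrable f s" "mellin_integrable g s"
  shows "mellin_integrable (\<lambda>t. f t + g t) s" "mellin (\<lambda>t. f t + g t) s = mellin f s + mellin g s"
  using assms set_integral_add[of lborel "{0<..}" "\<lambda>t. of_real (f t) * mellin_kernel s t" "\<lambda>t. of_real (g t) * mellin_kernel s t"]
  by (simp_all add: mellin_integrable_def mellin_def distrib_right)

lemma mellin_cmult: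
  assumes "mellin_integrable f s"
  shows "mellin_integrable (\<lambda>t. c * f t) s" "mellin (\<lambda>t. c * f t) s = of_real c * mellin f s"
  using assms by (simp_all add: mellin_integrable_def mellin_def mult.assoc)

lemma mellin_sum:
  assumes "\<And>n. n \<in> S \<Longrightarrow> mellin_integrable (f n) s"
  shows "mellin_integrable (\<lambda>t. \<Sum>n\<in>S. f n t) s \<and> mellin (\<lambda>t. \<Sum>n\<in>S. f n t) s = (\<Sum>n\<in>S. mellin (f n) s)"
  using assms
proof (induction S rule: infinite_finite_induct)
  case (insert x S)
  then show ?case using mellin_add[of "f x" s "\<lambda>t. \<Sum>n\<in>S. f n t"] by simp
qed (simp_all add: mellin_integrable_def mellin_def set_integrable_def)

lemma mellin_cong:
  assumes "\<And>t. 0 < t \<Longrightarrow> f t = g t"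
  shows "mellin f s = mellin g s" "mellin_integrable f s \<longleftrightarrow> mellin_integrable g s"
proof -
  show "mellin f s = mellin g s"
    unfolding mellin_def by (rule set_lebesgue_integral_cong) (use assms in auto)
  show "mellin_integrable f s \<longleftrightarrow> mellin_integrable g s"
    unfolding mellin_integrable_def by (rule set_integrable_cong) (use assms in auto)
qed

lemma (in mellin_strip) mellin_integrable: "- a < Re s \<Longrightarrow> Re s < b \<Longrightarrow> mellin_integrable h s"
  unfolding mellin_integrable_def by (rule set_integrable_mellin)

lemma has_vector_derivative_mellin_primitive:
  assumes "0 < x" "s + of_real a \<noteq> 0"
  shows "((\<lambda>t. exp ((s + of_real a) * of_real (ln t)) / (s + of_real a)) has_vector_derivative
     of_real (x powr a) * mellin_kernel s x) (at x)"
proof -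
  let ?w = "s + of_real a"
  have "((\<lambda>z. exp (w * ln z) / w) has_field_derivative exp (w * ln (of_real x)) * (w * inverse (of_real x)) / w) (at (of_real x))"
    if "w \<noteq> 0" for w :: complex
    using assms(1) that by (auto intro!: derivative_eq_intros simp: complex_nonpos_Reals_iff field_simps)
  from has_vector_derivative_real_field[OF this[OF assms(2)]]
  have "((\<lambda>t. exp (?w * ln (of_real t)) / ?w) has_vector_derivative exp (?w * ln (of_real x)) * inverse (of_real x)) (at x)"
    using assms by simp
  moreover have "exp (?w * ln (of_real x)) * inverse (of_real x) = of_real (x powr a) * mellin_kernel s x"
  proof -
    have "exp (?w * of_real (ln x)) = exp (of_real a * of_real (ln x)) * exp ((s - 1) * of_real (ln x)) * exp (of_real (ln x))"
      by (simp add: algebra_simps flip: exp_add)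
    moreover have "exp (of_real (ln x)) = (of_real x :: complex)" using assms by (simp add: exp_of_real)
    moreover have "exp (of_real a * of_real (ln x)) = (of_real (x powr a) :: complex)"
      using assms by (simp add: powr_def exp_of_real flip: of_real_mult)
    ultimately show ?thesis using assms by (simp add: mellin_kernel_def Ln_of_real)
  qed
  ultimately have "((\<lambda>t. exp (?w * ln (of_real t)) / ?w) has_vector_derivative of_real (x powr a) * mellin_kernel s x) (at x)"
    by simp
  then show ?thesis
    by (rule has_vector_derivative_transform_within_open[of _ _ _ "{0<..}"])
       (use assms in \<open>auto simp: Ln_of_real\<close>)
qed

lemma isCont_powr_mellin_kernel: "0 < x \<Longrightarrow> isCont (\<lambda>t. of_real (t powr a) * mellin_kernel s t) x"
  unfolding mellin_kernel_def by (intro continuous_intros) auto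

lemma norm_mellin_primitive:
  "0 < t \<Longrightarrow> norm (exp ((s + of_real a) * of_real (ln t)) / (s + of_real a)) = t powr (Re s + a) / norm (s + of_real a)"
  by (simp add: norm_divide powr_def)

lemma mellin_powr_lower:
  assumes s: "- a < Re s"
  shows "mellin_integrable (\<lambda>t. if t \<le> 1 then t powr a else 0) s"
    and "mellin (\<lambda>t. if t \<le> 1 then t powr a else 0) s = 1 / (s + of_real a)"
proof -
  let ?h = "\<lambda>t::real. if t \<le> 1 then t powr a else 0"
  let ?w = "s + of_real a"
  have w: "?w \<noteq> 0" using s by (auto simp: complex_eq_iff)
  \<comment> \<open>The function vanishes beyond 1, so the right end of the strip is arbitrary;
    \<open>Re s + 1\<close> merely includes s.\<close>
  have "mellin_strip ?h 1 a (Re s + 1)"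
    by unfold_locales (measurable, auto simp: two_sided_def)
  then show mi: "mellin_integrable ?h s"
    by (rule mellin_strip.mellin_integrable) (use s in auto)
  then have "set_integrable lborel {0<..<1} (\<lambda>t. of_real (?h t) * mellin_kernel s t)"
    unfolding mellin_integrable_def by (rule set_integrable_subset) auto
  then have si: "set_integrable lborel {0<..<1} (\<lambda>t. of_real (t powr a) * mellin_kernel s t)"
    by (subst (asm) set_integrable_cong[OF refl refl, of _ _ "\<lambda>t. of_real (t powr a) * mellin_kernel s t"]) auto
  have e: "einterval 0 1 = {0<..<1::real}" by (auto simp: einterval_def)
  have "(LBINT t=0..1. of_real (t powr a) * mellin_kernel s t) = 1 / ?w - 0"
  proof (rule interval_integral_FTC_integrable[where F = "\<lambda>t. exp (?w * of_real (ln t)) / ?w"])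
    show "((\<lambda>t. exp (?w * of_real (ln t)) / ?w) has_vector_derivative of_real (x powr a) * mellin_kernel s x) (at x)"
      if "0 < ereal x" "ereal x < 1" for x
      using that w by (intro has_vector_derivative_mellin_primitive) auto
    show "isCont (\<lambda>t. of_real (t powr a) * mellin_kernel s t) x" if "0 < ereal x" "ereal x < 1" for x
      using that by (intro isCont_powr_mellin_kernel) auto
    show "set_integrable lborel (einterval 0 1) (\<lambda>t. of_real (t powr a) * mellin_kernel s t)" unfolding e by (rule si)
    have "((\<lambda>t. exp (?w * of_real (ln t)) / ?w) \<longlongrightarrow> 0) (at_right 0)"
    proof (rule Lim_null_comparison)
      show "\<forall>\<^sub>F t in at_right 0. norm (exp (?w * of_real (ln t)) / ?w) \<le> t powr (Re s + a) / norm ?w"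
        by (rule eventually_mono[OF eventually_at_right_less]) (simp add: norm_mellin_primitive)
      have "((\<lambda>t. t powr (Re s + a) / norm ?w) \<longlongrightarrow> 0 / norm ?w) (at_right 0)"
        using s w by (intro tendsto_divide tendsto_const tendsto_powr_at_right_0) simp_all
      then show "((\<lambda>t. t powr (Re s + a) / norm ?w) \<longlongrightarrow> 0) (at_right 0)" by simp
    qed
    then show "(((\<lambda>t. exp (?w * of_real (ln t)) / ?w) \<circ> real_of_ereal) \<longlongrightarrow> 0) (at_right 0)"
      unfolding zero_ereal_def ereal_tendsto_simps .
    have "isCont (\<lambda>t::real. exp (?w * of_real (ln t)) / ?w) 1" using w by (intro continuous_intros) auto
    then have "((\<lambda>t. exp (?w * of_real (ln t)) / ?w) \<longlongrightarrow> 1 / ?w) (at_left 1)"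
      unfolding isCont_def by (simp add: filterlim_at_split)
    then show "(((\<lambda>t. exp (?w * of_real (ln t)) / ?w) \<circ> real_of_ereal) \<longlongrightarrow> 1 / ?w) (at_left 1)"
      unfolding one_ereal_def ereal_tendsto_simps .
  qed simp
  also have "(LBINT t=0..1. of_real (t powr a) * mellin_kernel s t) = (LINT t:{0<..<1}|lborel. of_real (t powr a) * mellin_kernel s t)"
    by (simp add: interval_lebesgue_integral_def e)
  also have "\<dots> = mellin ?h s"
    unfolding mellin_def set_lebesgue_integral_def
  proof (rule integral_discrete_difference[of "{1}"])
    show "indicat_real {0<..<1} x *\<^sub>R (of_real (x powr a) * mellin_kernel s x) = indicat_real {0<..} x *\<^sub>R (of_real (?h x) * mellin_kernel s x)"
      if "x \<in> space lborel" "x \<notin> {1}" for x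
      using that by (auto simp: indicator_def)
  qed auto
  finally show "mellin ?h s = 1 / ?w" by simp
qed

lemma mellin_powr_upper:
  assumes s: "Re s < - a"
  shows "mellin_integrable (\<lambda>t. if 1 < t then t powr a else 0) s"
    and "mellin (\<lambda>t. if 1 < t then t powr a else 0) s = - 1 / (s + of_real a)"
proof -
  let ?h = "\<lambda>t::real. if 1 < t then t powr a else 0"
  let ?w = "s + of_real a"
  have w: "?w \<noteq> 0" using s by (auto simp: complex_eq_iff)
  have "mellin_strip ?h 1 (- Re s + 1) (- a)"
    by unfold_locales (measurable, auto simp: two_sided_def)
  then show mi: "mellin_integrable ?h s"
    by (rule mellin_strip.mellin_integrable) (use s in auto)
  then have "set_integrable lborel {1<..} (\<lambda>t. of_real (?h t) * mellin_kernel s t)"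
    unfolding mellin_integrable_def by (rule set_integrable_subset) auto
  then have si: "set_integrable lborel {1<..} (\<lambda>t. of_real (t powr a) * mellin_kernel s t)"
    by (subst (asm) set_integrable_cong[OF refl refl, of _ _ "\<lambda>t. of_real (t powr a) * mellin_kernel s t"]) auto
  have e: "einterval 1 \<infinity> = {1::real<..}" by (auto simp: einterval_def)
  have "(LBINT t=1..\<infinity>. of_real (t powr a) * mellin_kernel s t) = 0 - 1 / ?w"
  proof (rule interval_integral_FTC_integrable[where F = "\<lambda>t. exp (?w * of_real (ln t)) / ?w"])
    show "((\<lambda>t. exp (?w * of_real (ln t)) / ?w) has_vector_derivative of_real (x powr a) * mellin_kernel s x) (at x)"
      if "1 < ereal x" "ereal x < \<infinity>" for x
      using that w by (intro has_vector_derivative_mellin_primitive) auto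
    show "isCont (\<lambda>t. of_real (t powr a) * mellin_kernel s t) x" if "1 < ereal x" "ereal x < \<infinity>" for x
      using that by (intro isCont_powr_mellin_kernel) auto
    show "set_integrable lborel (einterval 1 \<infinity>) (\<lambda>t. of_real (t powr a) * mellin_kernel s t)" unfolding e by (rule si)
    have "((\<lambda>t. exp (?w * of_real (ln t)) / ?w) \<longlongrightarrow> 0) at_top"
    proof (rule Lim_null_comparison)
      show "\<forall>\<^sub>F t in at_top. norm (exp (?w * of_real (ln t)) / ?w) \<le> t powr (Re s + a) / norm ?w"
        by (rule eventually_mono[OF eventually_gt_at_top[of 0]]) (simp add: norm_mellin_primitive)
      have "((\<lambda>t. t powr (Re s + a)) \<longlongrightarrow> 0) at_top" using s by (intro tendsto_neg_powr filterlim_ident) auto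
      from tendsto_divide[OF this tendsto_const[of "norm ?w"]] w
      show "((\<lambda>t. t powr (Re s + a) / norm ?w) \<longlongrightarrow> 0) at_top" by simp
    qed
    then show "(((\<lambda>t. exp (?w * of_real (ln t)) / ?w) \<circ> real_of_ereal) \<longlongrightarrow> 0) (at_left \<infinity>)"
      unfolding ereal_tendsto_simps .
    have "isCont (\<lambda>t::real. exp (?w * of_real (ln t)) / ?w) 1" using w by (intro continuous_intros) auto
    then have "((\<lambda>t. exp (?w * of_real (ln t)) / ?w) \<longlongrightarrow> 1 / ?w) (at_right 1)"
      unfolding isCont_def by (simp add: filterlim_at_split)
    then show "(((\<lambda>t. exp (?w * of_real (ln t)) / ?w) \<circ> real_of_ereal) \<longlongrightarrow> 1 / ?w) (at_right 1)"
      unfolding one_ereal_def ereal_tendsto_simps .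
  qed simp
  also have "(LBINT t=1..\<infinity>. of_real (t powr a) * mellin_kernel s t) = (LINT t:{1<..}|lborel. of_real (t powr a) * mellin_kernel s t)"
    by (simp add: interval_lebesgue_integral_def e)
  also have "\<dots> = mellin ?h s"
    unfolding mellin_def set_lebesgue_integral_def
    by (intro Bochner_Integration.integral_cong) (auto simp: indicator_def)
  finally show "mellin ?h s = - 1 / ?w" by simp
qed

text \<open>Scaling t by c reduces this to the Gamma integral.\<close>

lemma mellin_exp:
  assumes s: "0 < Re s" and c: "0 < c"
  shows "mellin_integrable (\<lambda>t. exp (- (c * t))) s"
    and "mellin (\<lambda>t. exp (- (c * t))) s = Gamma s * of_real c powr (- s)"
proof -
  let ?f = "\<lambda>c t. indicat_real {0<..} t *\<^sub>R (of_real (exp (- (c * t))) * mellin_kernel s t)"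
  have e1: "?f 1 t = indicat_real {0<..} t *\<^sub>R (of_real t powr (s - 1) / of_real (exp t))" for t
    by (auto simp: indicator_def mellin_kernel_eq_powr exp_minus field_simps)
  have meas1: "?f 1 \<in> borel_measurable borel" by measurable
  have "(\<lambda>t. of_real t powr (s - 1) / of_real (exp t)) absolutely_integrable_on {0<..}"
    using absolutely_integrable_Gamma_integral[OF s, of 1] by simp
  then have int0: "set_integrable lborel {0<..} (\<lambda>t. of_real t powr (s - 1) / of_real (exp t) :: complex)"
    unfolding set_integrable_def using meas1[unfolded e1] by (subst (asm) integrable_completion) auto
  then have int1: "integrable lborel (?f 1)"
    unfolding set_integrable_def e1 .
  have "(LINT t:{0<..}|lborel. of_real t powr (s - 1) / of_real (exp t)) = integral {0<..} (\<lambda>t. of_real t powr (s - 1) / of_real (exp t))"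
    by (rule set_borel_integral_eq_integral[OF int0])
  also have "\<dots> = Gamma s" using Gamma_integral_complex'[OF s] by (rule integral_unique)
  finally have Gamma_eq: "integral\<^sup>L lborel (?f 1) = Gamma s"
    unfolding set_lebesgue_integral_def e1 .
  have scale: "?f 1 (c * t) = of_real c powr (s - 1) * ?f c t" for t
    using c by (auto simp: indicator_def zero_less_mult_iff mellin_kernel_def powr_def Ln_of_real ln_mult distrib_left exp_add)
  have "integrable lborel (\<lambda>t. ?f 1 (0 + c * t))"
    by (rule lborel_integrable_real_affine[OF int1]) (use c in simp)
  then have "integrable lborel (\<lambda>t. inverse (of_real c powr (s - 1)) * (of_real c powr (s - 1) * ?f c t))"
    unfolding add_0 scale by (rule integrable_mult_right)
  moreover have "inverse (of_real c powr (s - 1)) * (of_real c powr (s - 1) * y) = y" for y :: complex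
    using c by (simp add: field_simps)
  ultimately show "mellin_integrable (\<lambda>t. exp (- (c * t))) s"
    unfolding mellin_integrable_def set_integrable_def by (simp only:)
  have "Gamma s = \<bar>c\<bar> *\<^sub>R integral\<^sup>L lborel (\<lambda>t. ?f 1 (0 + c * t))"
    unfolding Gamma_eq[symmetric] by (rule lborel_integral_real_affine) (use c in simp)
  also have "\<dots> = of_real c * (of_real c powr (s - 1) * integral\<^sup>L lborel (?f c))"
    unfolding add_0 scale using c by (simp add: scaleR_conv_of_real)
  also have "integral\<^sup>L lborel (?f c) = mellin (\<lambda>t. exp (- (c * t))) s"
    by (simp add: mellin_def set_lebesgue_integral_def)
  also have "of_real c * (of_real c powr (s - 1) * mellin (\<lambda>t. exp (- (c * t))) s) = of_real c powr s * mellin (\<lambda>t. exp (- (c * t))) s"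
    using c by (simp add: powr_diff)
  finally show "mellin (\<lambda>t. exp (- (c * t))) s = Gamma s * of_real c powr (- s)"
    using c by (simp add: powr_minus field_simps)
qed

subsection \<open>Meromorphic continuation\<close>

text \<open>Both functions agree with their \<open>remove_sings\<close>, whose value at z depends
  only on the values near z and not on the one at z.\<close>

lemma nicely_meromorphic_eqI:
  assumes "f nicely_meromorphic_on A" "g nicely_meromorphic_on A" "z \<in> A"
    and "eventually (\<lambda>w. f w = g w) (at z)"
  shows "f z = g z"
proof -
  have "remove_sings f z = f z \<and> remove_sings g z = g z"
    using assms(1-3) by (auto simp: nicely_meromorphic_on_def)
  then show ?thesis using remove_sings_cong[OF assms(4) refl] by metis
qed

text \<open>On a connected open set a meromorphic function either vanishes or is nonzero, off a
  sparse set; that f - g is 0 on the open set B excludes the latter.\<close>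

lemma meromorphic_identity:
  assumes f: "f meromorphic_on A" and g: "g meromorphic_on A" and A: "open A" "connected A"
    and B: "open B" "B \<subseteq> A" "B \<noteq> {}" "\<And>z. z \<in> B \<Longrightarrow> f z = g z" and z: "z \<in> A"
  shows "eventually (\<lambda>w. f w = g w) (at z)"
proof -
  have "(\<lambda>z. f z - g z) meromorphic_on A" using f g by (intro meromorphic_intros)
  from meromorphic_imp_constant_or_avoid[OF this A, of 0]
  have "eventually (\<lambda>z. f z - g z = 0) (cosparse A)"
  proof
    assume *: "eventually (\<lambda>z. f z - g z \<noteq> 0) (cosparse A)"
    obtain b where b: "b \<in> B" using B by blast
    have "eventually (\<lambda>z. f z - g z \<noteq> 0) (at b)"
      using * B b by (intro eventually_cosparse_imp_eventually_at[of _ A]) auto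
    moreover have "eventually (\<lambda>z. z \<in> B) (at b)" using B b by (intro eventually_at_in_open') auto
    ultimately have "eventually (\<lambda>z. False) (at b)" by eventually_elim (use B in auto)
    then show ?thesis by simp
  qed
  then have "eventually (\<lambda>w. f w - g w = 0) (at z)" using z by (rule eventually_cosparse_imp_eventually_at)
  then show ?thesis by eventually_elim simp
qed

lemma open_vertical_strip: "open {s. a < Re s \<and> Re s < b}"
  by (intro open_Collect_conj open_halfspace_Re_gt open_halfspace_Re_lt)

section \<open>Continuation of the Dirichlet series\<close>

context admissible_seq
begin

lemma i_less: "m < n \<Longrightarrow> i m < i n"
  using strict_mono_i by (rule strict_monoD)

lemma measurable_moment [measurable]: "moment q \<in> borel_measurable borel"
  unfolding moment_def[abs_def] by measurable

lemma measurable_rest [measurable]: "rest N q \<in> borel_measurable borel"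
  unfolding rest_def[abs_def] main_part_def by measurable

text \<open>The remainder o(t powr i N) alone would not give a strip reaching to - i (Suc N); going
  one term further gives the sharper bound.\<close>

lemma rest_0_bigo_next: "rest N 0 \<in> O[at_right 0](\<lambda>t. t powr i (Suc N))"
proof -
  have "(\<lambda>t. rest (Suc N) 0 t + A (i (Suc N)) * t powr i (Suc N)) \<in> O[at_right 0](\<lambda>t. t powr i (Suc N))"
    using landau_o.small_imp_big[OF rest_0_smallo[of "Suc N"]] by (intro sum_in_bigo(1)) simp_all
  also have "(\<lambda>t. rest (Suc N) 0 t + A (i (Suc N)) * t powr i (Suc N)) = rest N 0"
    by (simp add: rest_def main_part_def fun_eq_iff)
  finally show ?thesis .
qed

lemma ex_rest_0_bound: "\<exists>C. \<forall>t>0. \<bar>rest N 0 t\<bar> \<le> C * two_sided (i (Suc N) + 1) (- i N - 1) t"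
  using rest_0_bigo_next[of N] rest_bigo_at_top[of N 0]
  by (intro ex_two_sided_bound continuous_on_rest) simp_all

definition rest_lower :: "nat \<Rightarrow> real \<Rightarrow> real" where
  "rest_lower N t = (if t \<le> 1 then rest N 0 t else 0)"

definition theta_upper :: "real \<Rightarrow> real" where
  "theta_upper t = (if 1 < t then moment 0 t else 0)"

lemma ex_mellin_strip_rest_lower: "\<exists>C. mellin_strip (rest_lower N) C (i (Suc N)) b"
proof -
  obtain C where C: "\<And>t. 0 < t \<Longrightarrow> \<bar>rest N 0 t\<bar> \<le> C * two_sided (i (Suc N) + 1) (- i N - 1) t"
    using ex_rest_0_bound by blast
  have "0 \<le> C" using C[of 1] by (auto simp: two_sided_def intro: order_trans[OF abs_ge_zero])
  have "mellin_strip (rest_lower N) C (i (Suc N)) b"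
  proof
    show "rest_lower N \<in> borel_measurable borel" unfolding rest_lower_def[abs_def] by measurable
    show "\<bar>rest_lower N t\<bar> \<le> C * two_sided (i (Suc N) + 1) (b - 1) t" if "0 < t" for t
      using C[OF that] \<open>0 \<le> C\<close> by (auto simp: rest_lower_def two_sided_def)
  qed
  then show ?thesis by blast
qed

text \<open>Support beyond 1 allows any left end of the strip, and exponential decay any right
  end.\<close>

lemma ex_mellin_strip_theta_upper: "\<exists>C. mellin_strip theta_upper C a b"
proof -
  define C where "C = exp 1 * moment 0 1 * max 1 b powr max 1 b"
  have C: "0 \<le> C" using moment_pos[of 1 0] by (simp add: C_def)
  have "mellin_strip theta_upper C a b"
  proof
    show "theta_upper \<in> borel_measurable borel" unfolding theta_upper_def[abs_def] by measurable
    show "\<bar>theta_upper t\<bar> \<le> C * two_sided (a + 1) (b - 1) t" if t: "0 < t" for t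
    proof (cases "1 < t")
      case True
      have "moment 0 t \<le> exp (- (t - 1)) * moment 0 1" using True by (intro moment_0_exp_decay) auto
      also have "\<dots> = exp 1 * moment 0 1 * exp (- t)" by (simp add: exp_diff exp_minus field_simps)
      also have "\<dots> \<le> exp 1 * moment 0 1 * (max 1 b powr max 1 b * t powr (- b))"
        using True moment_pos[of 1 0] by (intro mult_left_mono exp_minus_le_powr) auto
      also have "\<dots> = C * two_sided (a + 1) (b - 1) t" using True by (simp add: C_def two_sided_def)
      finally show ?thesis using True moment_pos[of t 0] by (simp add: theta_upper_def)
    next
      case False
      then show ?thesis using C by (simp add: theta_upper_def two_sided_nonneg)
    qed
  qed
  then show ?thesis by blast
qed

lemma mellin_integrable_rest_lower: "- i (Suc N) < Re s \<Longrightarrow> mellin_integrable (rest_lower N) s"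
proof -
  obtain C where "mellin_strip (rest_lower N) C (i (Suc N)) (Re s + 1)" using ex_mellin_strip_rest_lower by blast
  then show "- i (Suc N) < Re s \<Longrightarrow> ?thesis" by (rule mellin_strip.mellin_integrable) auto
qed

lemma mellin_integrable_theta_upper: "mellin_integrable theta_upper s"
proof -
  obtain C where "mellin_strip theta_upper C (1 - Re s) (Re s + 1)" using ex_mellin_strip_theta_upper by blast
  then show ?thesis by (rule mellin_strip.mellin_integrable) auto
qed

text \<open>
  The Mellin transform of theta, split at \<open>1\<close>, with the first \<open>N + 1\<close> terms of the expansion
  integrated over the lower part: it continues \<open>Gamma s\<close> times the Dirichlet series to
  \<open>- i (Suc N) < Re s\<close>.
\<close>
definition completed_zeta :: "nat \<Rightarrow> complex \<Rightarrow> complex" where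
  "completed_zeta N s = mellin (rest_lower N) s + (\<Sum>n\<le>N. of_real (A (i n)) / (s + of_real (i n))) + mellin theta_upper s"

text \<open>One more term of the expansion moves a cut-off power from the integral to the rational
  part, where its transform stands.\<close>

lemma completed_zeta_Suc:
  assumes s: "- i (Suc N) < Re s"
  shows "completed_zeta (Suc N) s = completed_zeta N s"
proof -
  let ?p = "\<lambda>t::real. if t \<le> 1 then t powr i (Suc N) else 0"
  have "i (Suc N) < i (Suc (Suc N))" by (rule i_less) simp
  then have s': "- i (Suc (Suc N)) < Re s" using s by simp
  note p = mellin_cmult[OF mellin_powr_lower(1)[OF s], of "A (i (Suc N))"]
  have "mellin (rest_lower N) s = mellin (\<lambda>t. rest_lower (Suc N) t + A (i (Suc N)) * ?p t) s"
    by (rule mellin_cong) (simp add: rest_lower_def rest_def main_part_def)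
  also have "\<dots> = mellin (rest_lower (Suc N)) s + of_real (A (i (Suc N))) * (1 / (s + of_real (i (Suc N))))"
    unfolding mellin_add(2)[OF mellin_integrable_rest_lower[OF s'] p(1)] p(2) mellin_powr_lower(2)[OF s] ..
  finally show ?thesis by (simp add: completed_zeta_def)
qed

lemma completed_zeta_eq:
  assumes "- i (Suc N) < Re s" "N \<le> N'"
  shows "completed_zeta N' s = completed_zeta N s"
  using assms(2)
proof (induction N' rule: dec_induct)
  case base
  show ?case ..
next
  case (step n)
  have "i (Suc N) \<le> i (Suc n)" using strict_mono_i step(1) by (simp add: strict_mono_less_eq)
  then have "completed_zeta (Suc n) s = completed_zeta n s" using assms(1) by (intro completed_zeta_Suc) simp
  then show ?case using step.IH by (rule trans)
qed

lemma ex_half_plane: "\<exists>N. - i (Suc N) < x"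
proof -
  have "\<forall>\<^sub>F N in sequentially. - x < i N" using filterlim_i by (simp add: filterlim_at_top_dense)
  then obtain N where "\<And>n. n \<ge> N \<Longrightarrow> - x < i n" by (auto simp: eventually_sequentially)
  from this[of "Suc N"] show ?thesis by (intro exI[of _ N]) auto
qed

text \<open>All N with - i (Suc N) < Re s give the same value, so taking the least is merely a
  choice. The entire function \<open>rGamma\<close> avoids dividing by Gamma.\<close>

definition zeta_continuation :: "complex \<Rightarrow> complex" where
  "zeta_continuation s = rGamma s * completed_zeta (LEAST N. - i (Suc N) < Re s) s"

lemma zeta_continuation_eq:
  assumes "- i (Suc N) < Re s"
  shows "zeta_continuation s = rGamma s * completed_zeta N s"
proof -
  let ?L = "LEAST N. - i (Suc N) < Re s"
  have "- i (Suc ?L) < Re s" by (rule LeastI[of _ N]) (rule assms)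
  moreover have "?L \<le> N" by (rule Least_le) (rule assms)
  ultimately have "completed_zeta N s = completed_zeta ?L s" by (rule completed_zeta_eq)
  then show ?thesis unfolding zeta_continuation_def by (rule arg_cong[OF sym])
qed

lemma completed_zeta_meromorphic: "completed_zeta N meromorphic_on {s. - i (Suc N) < Re s}"
proof -
  have "(\<lambda>s. mellin (rest_lower N) s) meromorphic_on {s. - i (Suc N) < Re s}"
  proof (subst meromorphic_on_meromorphic_at, intro ballI)
    fix s assume "s \<in> {s. - i (Suc N) < Re s}"
    then have s: "s \<in> {z. - i (Suc N) < Re z \<and> Re z < Re s + 1}" by simp
    obtain C where "mellin_strip (rest_lower N) C (i (Suc N)) (Re s + 1)" using ex_mellin_strip_rest_lower by blast
    then have "mellin (rest_lower N) analytic_on {z. - i (Suc N) < Re z \<and> Re z < Re s + 1}"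
      using mellin_strip.mellin_holomorphic analytic_on_open open_vertical_strip by blast
    then have "mellin (rest_lower N) meromorphic_on {z. - i (Suc N) < Re z \<and> Re z < Re s + 1}"
      by (rule analytic_on_imp_meromorphic_on)
    then show "(\<lambda>s. mellin (rest_lower N) s) meromorphic_on {s}"
      by (rule meromorphic_on_subset) (use s in simp)
  qed
  moreover have "(\<lambda>s. mellin theta_upper s) meromorphic_on {s. - i (Suc N) < Re s}"
  proof (subst meromorphic_on_meromorphic_at, intro ballI)
    fix s :: complex
    obtain C where "mellin_strip theta_upper C (1 - Re s) (Re s + 1)" using ex_mellin_strip_theta_upper by blast
    then have "mellin theta_upper analytic_on {z. - (1 - Re s) < Re z \<and> Re z < Re s + 1}"
      using mellin_strip.mellin_holomorphic analytic_on_open open_vertical_strip by blast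
    then have "mellin theta_upper meromorphic_on {z. - (1 - Re s) < Re z \<and> Re z < Re s + 1}"
      by (rule analytic_on_imp_meromorphic_on)
    then show "(\<lambda>s. mellin theta_upper s) meromorphic_on {s}"
      by (rule meromorphic_on_subset) simp
  qed
  moreover have "(\<lambda>s. \<Sum>n\<le>N. of_real (A (i n)) / (s + of_real (i n))) meromorphic_on {s. - i (Suc N) < Re s}"
    by (intro meromorphic_on_sum meromorphic_on_divide analytic_on_imp_meromorphic_on analytic_intros)
  ultimately show ?thesis
    unfolding completed_zeta_def[abs_def] by (intro meromorphic_on_add)
qed

lemma zeta_continuation_meromorphic: "zeta_continuation meromorphic_on UNIV"
proof (subst meromorphic_on_meromorphic_at, intro ballI)
  fix s :: complex
  obtain N where N: "- i (Suc N) < Re s" using ex_half_plane by blast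
  have "completed_zeta N meromorphic_on {s}"
    by (rule meromorphic_on_subset[OF completed_zeta_meromorphic]) (use N in simp)
  moreover have "rGamma meromorphic_on {s}"
    by (intro analytic_on_imp_meromorphic_on analytic_intros)
  ultimately have "(\<lambda>s. rGamma s * completed_zeta N s) meromorphic_on {s}"
    by (intro meromorphic_intros)
  moreover have "\<forall>\<^sub>F w in at s. rGamma w * completed_zeta N w = zeta_continuation w"
  proof -
    have "\<forall>\<^sub>F w in at s. w \<in> {w. - i (Suc N) < Re w}"
      using N by (intro eventually_at_in_open' open_halfspace_Re_gt) auto
    then show ?thesis by eventually_elim (simp add: zeta_continuation_eq)
  qed
  ultimately show "zeta_continuation meromorphic_on {s}"
    using meromorphic_on_cong[of "{s}" "\<lambda>s. rGamma s * completed_zeta N s" zeta_continuation "{s}"] by simp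
qed

text \<open>To the right of \<mu>0 the cut-off leading power is integrable at 0 as well, so the
  pieces recombine to the transform of theta.\<close>

lemma mellin_theta:
  assumes s: "\<mu>0 < Re s"
  shows "mellin_integrable (moment 0) s" "mellin (moment 0) s = completed_zeta 0 s"
proof -
  let ?p = "\<lambda>t::real. if t \<le> 1 then t powr i 0 else 0"
  have "i 0 < i (Suc 0)" by (rule i_less) simp
  then have s': "- i (Suc 0) < Re s" using s by simp
  have c: "moment 0 t = rest_lower 0 t + A (i 0) * ?p t + theta_upper t" for t
    by (simp add: rest_lower_def theta_upper_def rest_def main_part_def)
  have p: "mellin_integrable (\<lambda>t. A (i 0) * ?p t) s" "mellin (\<lambda>t. A (i 0) * ?p t) s = of_real (A (i 0)) * (1 / (s + of_real (i 0)))"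
    using mellin_cmult[OF mellin_powr_lower(1)[OF s], of "A (i 0)"] unfolding mellin_powr_lower(2)[OF s] .
  note q = mellin_add[OF mellin_integrable_rest_lower[OF s'] p(1)]
  note r = mellin_add[OF q(1) mellin_integrable_theta_upper]
  show "mellin_integrable (moment 0) s" using r(1) unfolding c[symmetric] .
  show "mellin (moment 0) s = completed_zeta 0 s"
    using r(2) unfolding c[symmetric] q(2) p(2) by (simp add: completed_zeta_def)
qed

text \<open>Partial sums of theta have as transforms Gamma s times partial sums of the Dirichlet
  series. Their terms are positive, so theta dominates them and the limit may be taken under the
  integral.\<close>

lemma zeta_series:
  assumes s: "\<mu>0 < Re s"
  shows "(\<lambda>j. of_nat (\<Lambda> j) powr (- s)) sums zeta_continuation s"
proof -
  have s0: "0 < Re s" using s \<mu>0_pos by simp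
  let ?g = "\<lambda>j t. exp (- (real (\<Lambda> j) * t))"
  have L: "0 < real (\<Lambda> j)" for j using pos by simp
  have fin: "mellin (\<lambda>t. \<Sum>j<J. ?g j t) s = (\<Sum>j<J. Gamma s * of_nat (\<Lambda> j) powr (- s))" for J
    using mellin_sum[of "{..<J}" ?g s] mellin_exp[OF s0 L] by simp
  have "(\<lambda>J. mellin (\<lambda>t. \<Sum>j<J. ?g j t) s) \<longlonglongrightarrow> mellin (moment 0) s"
    unfolding mellin_def set_lebesgue_integral_def
  proof (rule integral_dominated_convergence)
    show "integrable lborel (\<lambda>t. norm (indicat_real {0<..} t *\<^sub>R (of_real (moment 0 t) * mellin_kernel s t)))"
      using mellin_theta(1)[OF s] unfolding mellin_integrable_def set_integrable_def by (rule integrable_norm)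
    show "AE t in lborel. (\<lambda>J. indicat_real {0<..} t *\<^sub>R (of_real (\<Sum>j<J. ?g j t) * mellin_kernel s t))
        \<longlonglongrightarrow> indicat_real {0<..} t *\<^sub>R (of_real (moment 0 t) * mellin_kernel s t)"
    proof (rule AE_I2)
      fix t :: real
      show "(\<lambda>J. indicat_real {0<..} t *\<^sub>R (of_real (\<Sum>j<J. ?g j t) * mellin_kernel s t))
        \<longlonglongrightarrow> indicat_real {0<..} t *\<^sub>R (of_real (moment 0 t) * mellin_kernel s t)"
      proof (cases "0 < t")
        case True
        have "(\<lambda>J. \<Sum>j<J. ?g j t) \<longlonglongrightarrow> moment 0 t"
          using summable_LIMSEQ[OF summable_theta[OF True]] by (simp add: moment_def)
        then show ?thesis by (intro tendsto_intros)
      qed simp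
    qed
    show "AE t in lborel. norm (indicat_real {0<..} t *\<^sub>R (of_real (\<Sum>j<J. ?g j t) * mellin_kernel s t))
        \<le> norm (indicat_real {0<..} t *\<^sub>R (of_real (moment 0 t) * mellin_kernel s t))" for J
    proof (rule AE_I2)
      fix t :: real
      have "\<bar>\<Sum>j<J. ?g j t\<bar> \<le> \<bar>moment 0 t\<bar>" if "0 < t"
      proof -
        have "(\<Sum>j<J. ?g j t) \<le> (\<Sum>j. ?g j t)" by (rule sum_le_suminf[OF summable_theta[OF that]]) auto
        moreover have "0 \<le> (\<Sum>j<J. ?g j t)" by (intro sum_nonneg) auto
        ultimately show ?thesis by (simp add: moment_def)
      qed
      then show "norm (indicat_real {0<..} t *\<^sub>R (of_real (\<Sum>j<J. ?g j t) * mellin_kernel s t))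
        \<le> norm (indicat_real {0<..} t *\<^sub>R (of_real (moment 0 t) * mellin_kernel s t))"
        by (cases "0 < t") (simp_all add: norm_mult mult_right_mono del: of_real_sum)
    qed
  qed measurable
  then have "(\<lambda>j. Gamma s * of_nat (\<Lambda> j) powr (- s)) sums completed_zeta 0 s"
    unfolding fin mellin_theta(2)[OF s] sums_def .
  then have "(\<lambda>j. rGamma s * (Gamma s * of_nat (\<Lambda> j) powr (- s))) sums (rGamma s * completed_zeta 0 s)"
    by (rule sums_mult)
  moreover have "rGamma s * (Gamma s * x) = x" for x
  proof -
    have "s \<notin> \<int>\<^sub>\<le>\<^sub>0" using s0 by (auto elim!: nonpos_Ints_cases)
    then have "rGamma s \<noteq> 0" by (simp add: rGamma_eq_zero_iff)
    then show ?thesis by (simp add: Gamma_def field_simps)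
  qed
  moreover have "- i (Suc 0) < Re s"
    using s i_less[of 0 "Suc 0"] by simp
  ultimately show ?thesis using zeta_continuation_eq[of 0 s] by simp
qed

text \<open>The witness for the definite description is
  \<open>remove_sings zeta_continuation\<close>; uniqueness is the identity theorem, starting from
  the half plane of convergence.\<close>

lemma zeta_seq_nicely_meromorphic: "zeta_seq \<Lambda> \<mu>0 nicely_meromorphic_on UNIV"
  and zeta_seq_eventually_eq: "\<forall>\<^sub>F w in at z. zeta_seq \<Lambda> \<mu>0 w = zeta_continuation w"
proof -
  define Z where "Z = remove_sings zeta_continuation"
  let ?P = "\<lambda>Z. Z nicely_meromorphic_on UNIV \<and> (\<forall>s. \<mu>0 < Re s \<longrightarrow> (\<lambda>j. of_nat (\<Lambda> j) powr (- s)) sums Z s)"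
  have nice: "Z nicely_meromorphic_on UNIV"
    unfolding Z_def by (rule remove_sings_nicely_meromorphic[OF zeta_continuation_meromorphic])
  have Z_eq: "\<forall>\<^sub>F w in at z. Z w = zeta_continuation w" for z
  proof -
    have "\<forall>\<^sub>F w in cosparse UNIV. remove_sings zeta_continuation w = zeta_continuation w"
      by (rule eventually_remove_sings_eq[OF zeta_continuation_meromorphic])
    then show ?thesis unfolding Z_def by (rule eventually_cosparse_imp_eventually_at) simp
  qed
  \<comment> \<open>The series must be matched at every point of the half plane; as
    \<open>zeta_continuation\<close> is analytic there, removing singularities changes no
    value.\<close>
  have series: "Z s = zeta_continuation s" if s: "\<mu>0 < Re s" for s
  proof -
    have "i 0 < i (Suc 0)" by (rule i_less) simp
    let ?S = "{z. \<mu>0 < Re z \<and> Re z < Re s + 1}"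
    obtain C where C: "mellin_strip (rest_lower 0) C (i (Suc 0)) (Re s + 1)" using ex_mellin_strip_rest_lower by blast
    obtain C' where C': "mellin_strip theta_upper C' (i 0) (Re s + 1)" using ex_mellin_strip_theta_upper by blast
    have "(\<lambda>z. rGamma z * (mellin (rest_lower 0) z + of_real (A (i 0)) / (z + of_real (i 0)) + mellin theta_upper z)) holomorphic_on ?S"
    proof (intro holomorphic_intros)
      show "mellin (rest_lower 0) holomorphic_on ?S"
        by (rule holomorphic_on_subset[OF mellin_strip.mellin_holomorphic[OF C]]) (use \<open>i 0 < i (Suc 0)\<close> in auto)
      show "mellin theta_upper holomorphic_on ?S"
        by (rule holomorphic_on_subset[OF mellin_strip.mellin_holomorphic[OF C']]) auto
    qed (auto simp: complex_eq_iff)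
    then have "(\<lambda>z. rGamma z * completed_zeta 0 z) holomorphic_on ?S"
      by (simp add: completed_zeta_def)
    then have "zeta_continuation holomorphic_on ?S"
      by (rule holomorphic_transform) (use \<open>i 0 < i (Suc 0)\<close> in \<open>auto simp: zeta_continuation_eq[of 0]\<close>)
    then have "zeta_continuation analytic_on ?S" using analytic_on_open open_vertical_strip by blast
    then have "zeta_continuation analytic_on {s}" by (rule analytic_on_subset) (use s in auto)
    then show ?thesis unfolding Z_def by (rule remove_sings_at_analytic)
  qed
  have "zeta_seq \<Lambda> \<mu>0 = Z"
    unfolding zeta_seq_def
  proof (rule the_equality)
    show "?P Z" using nice series zeta_series by simp
    fix Y assume Y: "?P Y"
    show "Y = Z"
    proof
      fix z
      have "eventually (\<lambda>w. Y w = Z w) (at z)"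
      proof (rule meromorphic_identity[where A = UNIV and B = "{s. \<mu>0 < Re s}"])
        show "Y meromorphic_on UNIV" "Z meromorphic_on UNIV" using Y nice by (auto simp: nicely_meromorphic_on_def)
        show "open {s. \<mu>0 < Re s}" by (rule open_halfspace_Re_gt)
        have "of_real (\<mu>0 + 1) \<in> {s. \<mu>0 < Re s}" by simp
        then show "{s. \<mu>0 < Re s} \<noteq> {}" by blast
        show "Y w = Z w" if "w \<in> {s. \<mu>0 < Re s}" for w
          using that Y series zeta_series sums_unique2 by (metis mem_Collect_eq)
      qed auto
      then show "Y z = Z z" using Y nice by (intro nicely_meromorphic_eqI[of _ UNIV]) auto
    qed
  qed
  then show "zeta_seq \<Lambda> \<mu>0 nicely_meromorphic_on UNIV" "\<forall>\<^sub>F w in at z. zeta_seq \<Lambda> \<mu>0 w = zeta_continuation w"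
    using nice Z_eq by auto
qed

end

section \<open>The derivative of the zeta function at 0\<close>

context admissible_split
begin

definition rest_exp :: "real \<Rightarrow> real" where
  "rest_exp t = rest d 0 t - A 0 * exp (- t)"

lemma ex_mellin_strip_rest_exp: "\<exists>C. mellin_strip rest_exp C \<delta> \<epsilon>"
proof -
  obtain C where C: "\<And>t. 0 < t \<Longrightarrow> \<bar>const_integrand t\<bar> \<le> C * two_sided \<delta> \<epsilon> t"
    using ex_const_integrand_bound by blast
  have "mellin_strip rest_exp C \<delta> \<epsilon>"
  proof
    show "rest_exp \<in> borel_measurable borel" unfolding rest_exp_def[abs_def] by measurable
    show "\<bar>rest_exp t\<bar> \<le> C * two_sided (\<delta> + 1) (\<epsilon> - 1) t" if t: "0 < t" for t
    proof -
      have "\<bar>rest_exp t\<bar> = t * \<bar>const_integrand t\<bar>"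
        using t by (simp add: rest_exp_def const_integrand_def abs_mult)
      also have "\<dots> \<le> t * (C * two_sided \<delta> \<epsilon> t)" using t C by (intro mult_left_mono) auto
      also have "\<dots> = C * two_sided (\<delta> + 1) (\<epsilon> - 1) t"
        using t by (simp add: two_sided_def powr_diff)
      finally show ?thesis .
    qed
  qed
  then show ?thesis by blast
qed

text \<open>
  A power \<open>t powr a\<close> cut off at \<open>1\<close> from either side has the transforms \<open>1 / (s + a)\<close> and
  \<open>- 1 / (s + a)\<close>, so the polar terms of \<open>completed_zeta d\<close> can be absorbed into the upper part.
\<close>
lemma completed_zeta_fundamental_strip:
  assumes s: "0 < Re s" "Re s < \<epsilon>"
  shows "completed_zeta d s = mellin rest_exp s + of_real (A 0) * Gamma s"
proof -
  let ?u = "\<lambda>n t. if 1 < t then t powr i n else (0::real)"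
  have s': "- i (Suc d) < Re s" using s i_Suc_d_nonneg by simp
  have u: "mellin_integrable (\<lambda>t. - A (i n) * ?u n t) s"
    "mellin (\<lambda>t. - A (i n) * ?u n t) s = of_real (A (i n)) / (s + of_real (i n))" if "n \<le> d" for n
  proof -
    have "Re s < - i n" using s i_le_d[OF that] by simp
    note m = mellin_powr_upper[OF this]
    show "mellin_integrable (\<lambda>t. - A (i n) * ?u n t) s"
      by (rule mellin_cmult(1)[OF m(1)])
    show "mellin (\<lambda>t. - A (i n) * ?u n t) s = of_real (A (i n)) / (s + of_real (i n))"
      unfolding mellin_cmult(2)[OF m(1)] m(2) by simp
  qed
  have sum: "mellin_integrable (\<lambda>t. \<Sum>n\<le>d. - A (i n) * ?u n t) s"
    "mellin (\<lambda>t. \<Sum>n\<le>d. - A (i n) * ?u n t) s = (\<Sum>n\<le>d. of_real (A (i n)) / (s + of_real (i n)))"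
    using mellin_sum[of "{..d}" "\<lambda>n t. - A (i n) * ?u n t" s] u by simp_all
  note p = mellin_add[OF mellin_integrable_rest_lower[OF s'] sum(1)]
  note q = mellin_add[OF p(1) mellin_integrable_theta_upper]
  have e: "rest d 0 = (\<lambda>t. rest_lower d t + (\<Sum>n\<le>d. - A (i n) * ?u n t) + theta_upper t)"
    by (simp add: rest_lower_def theta_upper_def rest_def main_part_def sum_negf fun_eq_iff)
  have 1: "mellin (rest d 0) s = completed_zeta d s"
    unfolding e q(2) p(2) sum(2) completed_zeta_def ..
  obtain C where "mellin_strip rest_exp C \<delta> \<epsilon>" using ex_mellin_strip_rest_exp by blast
  then have "mellin_integrable rest_exp s"
    by (rule mellin_strip.mellin_integrable) (use s \<delta>_bounds in auto)
  moreover have "mellin_integrable (\<lambda>t. A 0 * exp (- (1 * t))) s" "mellin (\<lambda>t. A 0 * exp (- (1 * t))) s = of_real (A 0) * Gamma s"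
    using mellin_cmult[OF mellin_exp(1)[OF s(1), of 1], of "A 0"] mellin_exp(2)[OF s(1), of 1] by simp_all
  ultimately have "mellin (\<lambda>t. rest_exp t + A 0 * exp (- (1 * t))) s = mellin rest_exp s + of_real (A 0) * Gamma s"
    by (simp only: mellin_add)
  then show ?thesis using 1 by (simp add: rest_exp_def)
qed

text \<open>Near 0 the zeta function is A 0 + rGamma s * mellin rest_exp s. As \<open>rGamma\<close>
  has a simple zero with slope 1 at 0, the derivative there is the transform at 0.\<close>

theorem deriv_zeta_seq_0: "deriv (zeta_seq \<Lambda> \<mu>0) 0 = of_real (LINT t:{0<..}|lborel. const_integrand t)"
proof -
  let ?S = "{s. - \<delta> < Re s \<and> Re s < \<epsilon>}"
  obtain C where "mellin_strip rest_exp C \<delta> \<epsilon>" using ex_mellin_strip_rest_exp by blast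
  then have hol: "mellin rest_exp holomorphic_on ?S" by (rule mellin_strip.mellin_holomorphic)
  let ?g = "\<lambda>s. of_real (A 0) + rGamma s * mellin rest_exp s"
  have "?g holomorphic_on ?S" by (intro holomorphic_intros hol)
  then have an: "?g analytic_on ?S" using analytic_on_open open_vertical_strip by blast
  have zero: "0 \<in> ?S" using \<delta>_bounds \<epsilon>_pos by simp
  \<comment> \<open>The equation is known only for 0 < Re w < \<epsilon>; the identity theorem
    carries it across 0.\<close>
  have ev: "\<forall>\<^sub>F w in at z. zeta_continuation w = ?g w" if "z \<in> ?S" for z
  proof (rule meromorphic_identity[where A = ?S and B = "{s. 0 < Re s \<and> Re s < \<epsilon>}"])
    show "zeta_continuation meromorphic_on ?S" using zeta_continuation_meromorphic by (rule meromorphic_on_subset) simp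
    show "?g meromorphic_on ?S" using an by (rule analytic_on_imp_meromorphic_on)
    have "convex ?S" unfolding Collect_conj_eq by (intro convex_Int convex_halfspace_Re_gt convex_halfspace_Re_lt)
    then show "connected ?S" by (rule convex_connected)
    have "of_real (\<epsilon> / 2) \<in> {s. 0 < Re s \<and> Re s < \<epsilon>}" using \<epsilon>_pos by simp
    then show "{s. 0 < Re s \<and> Re s < \<epsilon>} \<noteq> {}" by blast
    fix w assume w: "w \<in> {s. 0 < Re s \<and> Re s < \<epsilon>}"
    then have "zeta_continuation w = rGamma w * completed_zeta d w"
      using i_Suc_d_nonneg by (intro zeta_continuation_eq) auto
    moreover have "rGamma w * Gamma w = 1"
    proof -
      have "w \<notin> \<int>\<^sub>\<le>\<^sub>0" using w by (auto elim!: nonpos_Ints_cases)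
      then have "rGamma w \<noteq> 0" by (simp add: rGamma_eq_zero_iff)
      then show ?thesis by (simp add: Gamma_def field_simps)
    qed
    ultimately show "zeta_continuation w = ?g w"
      using completed_zeta_fundamental_strip[of w] w by (simp add: algebra_simps)
  qed (use that \<delta>_bounds open_vertical_strip in auto)
  have "zeta_seq \<Lambda> \<mu>0 nicely_meromorphic_on ?S"
    using zeta_seq_nicely_meromorphic by (rule nicely_meromorphic_on_subset) simp
  moreover have "?g nicely_meromorphic_on ?S" using an by (rule analytic_on_imp_nicely_meromorphic_on)
  moreover have "\<forall>\<^sub>F w in at z. zeta_seq \<Lambda> \<mu>0 w = ?g w" if "z \<in> ?S" for z
    using zeta_seq_eventually_eq ev[OF that] by eventually_elim simp
  ultimately have eq: "zeta_seq \<Lambda> \<mu>0 z = ?g z" if "z \<in> ?S" for z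
    using that by (intro nicely_meromorphic_eqI[of _ ?S])
  have "\<forall>\<^sub>F z in nhds 0. z \<in> ?S" using zero open_vertical_strip by (intro eventually_nhds_in_open) auto
  then have "\<forall>\<^sub>F z in nhds 0. zeta_seq \<Lambda> \<mu>0 z = ?g z" by eventually_elim (rule eq)
  then have "deriv (zeta_seq \<Lambda> \<mu>0) 0 = deriv ?g 0" by (rule deriv_cong_ev) simp
  also have "\<dots> = mellin rest_exp 0"
  proof (rule DERIV_imp_deriv)
    have "(mellin rest_exp has_field_derivative deriv (mellin rest_exp) 0) (at 0)"
      using hol open_vertical_strip zero by (intro holomorphic_derivI)
    moreover have "(rGamma has_field_derivative 1) (at (0::complex))"
      using has_field_derivative_rGamma_nonpos_int[of 0] by simp
    ultimately show "(?g has_field_derivative mellin rest_exp 0) (at 0)"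
      by (auto intro!: derivative_eq_intros)
  qed
  also have "mellin rest_exp 0 = (LINT t:{0<..}|lborel. complex_of_real (const_integrand t))"
    unfolding mellin_def
  proof (rule set_lebesgue_integral_cong)
    show "\<forall>t. t \<in> {0<..} \<longrightarrow> of_real (rest_exp t) * mellin_kernel 0 t = complex_of_real (const_integrand t)"
      by (auto simp: mellin_kernel_eq_powr powr_minus_divide rest_exp_def const_integrand_def)
  qed simp
  also have "\<dots> = of_real (LINT t:{0<..}|lborel. const_integrand t)"
    by (rule set_integral_complex_of_real)
  finally show ?thesis .
qed

end

subsection \<open>The logarithm in the half plane\<close>

lemma exp_imaginary_taylor_2:
  "norm (exp (- \<i> * of_real y) - 1 + \<i> * of_real y + of_real (y\<^sup>2 / 2)) \<le> \<bar>y\<bar> ^ 3"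
proof -
  have "norm (exp (\<i> * of_real (- y)) - (\<Sum>k\<le>2. (\<i> * of_real (- y)) ^ k / fact k)) \<le> \<bar>- y\<bar> ^ Suc 2 / fact (Suc 2)"
    by (rule iexp_approx1)
  also have "\<dots> \<le> \<bar>y\<bar> ^ 3" by (simp add: numeral_3_eq_3[symmetric] fact_numeral)
  also have "(\<Sum>k\<le>2. (\<i> * complex_of_real (- y)) ^ k / fact k) = 1 - \<i> * of_real y - of_real (y\<^sup>2 / 2)"
    by (simp add: numeral_2_eq_2 power2_eq_square algebra_simps)
  finally show ?thesis by (simp add: algebra_simps)
qed

text \<open>The real part of the third-order Taylor bound for exp (\<i> x), whose cubic term is
  imaginary.\<close>

lemma cos_taylor_4: "1 - cos x \<ge> x\<^sup>2 / 2 - x ^ 4 / 24" for x :: real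
proof -
  have "norm (exp (\<i> * of_real x) - (\<Sum>k\<le>3. (\<i> * of_real x) ^ k / fact k)) \<le> \<bar>x\<bar> ^ Suc 3 / fact (Suc 3)"
    by (rule iexp_approx1)
  then have "\<bar>Re (exp (\<i> * of_real x) - (\<Sum>k\<le>3. (\<i> * of_real x) ^ k / fact k))\<bar> \<le> \<bar>x\<bar> ^ Suc 3 / fact (Suc 3)"
    using abs_Re_le_cmod order_trans by blast
  moreover have "Re (\<Sum>k\<le>3. (\<i> * complex_of_real x) ^ k / fact k) = 1 - x\<^sup>2 / 2"
    by (simp add: numeral_3_eq_3 power2_eq_square)
  moreover have "\<bar>x\<bar> ^ Suc 3 / fact (Suc 3) = x ^ 4 / 24"
    by (simp add: fact_numeral power_even_abs)
  moreover have "Re (exp (\<i> * complex_of_real x)) = cos x" by (simp add: exp_eq_polar)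
  ultimately have "\<bar>cos x - (1 - x\<^sup>2 / 2)\<bar> \<le> x ^ 4 / 24" by (simp only: minus_complex.sel)
  then show ?thesis by linarith
qed

text \<open>With u = cis a - 1 and v = cis b - 1 this is norm (u - v) ^ 2 \<le> 2 * norm u ^ 2 + 2 *
  norm v ^ 2, as norm u ^ 2 = 2 * (1 - cos a). By the parallelogram law the difference is norm (u +
  v) ^ 2, the square in the proof.\<close>

lemma one_minus_cos_diff_le: "1 - cos (a - b) \<le> 2 * (1 - cos a) + 2 * (1 - cos b :: real)"
proof -
  have "0 \<le> (cos a + cos b - 2)\<^sup>2 + (sin a + sin b)\<^sup>2" by simp
  also have "\<dots> = ((cos a)\<^sup>2 + (sin a)\<^sup>2) + ((cos b)\<^sup>2 + (sin b)\<^sup>2) + 2 * (cos a * cos b + sin a * sin b) - 4 * cos a - 4 * cos b + 4"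
    by algebra
  also have "\<dots> = 6 + 2 * cos (a - b) - 4 * cos a - 4 * cos b" by (simp add: cos_diff)
  finally show ?thesis by (simp add: algebra_simps)
qed

context admissible_seq
begin

text \<open>Indexing by pairs lets either index be summed first: summing over j gives
  \<open>moment\<close>, summing over k the factors of the product and the saddle equation.\<close>

definition log_term :: "nat \<Rightarrow> real \<Rightarrow> nat \<times> nat \<Rightarrow> real" where
  "log_term p \<alpha> = (\<lambda>(j, k). real (Suc k) ^ p / real (Suc k) * (real (\<Lambda> j) ^ p * exp (- (real (\<Lambda> j) * (real (Suc k) * \<alpha>)))))"

lemma log_term_nonneg: "0 \<le> log_term p \<alpha> x"
  by (auto simp: log_term_def split: prod.splits)

lemma has_sum_log_moment:
  assumes \<alpha>: "0 < \<alpha>"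
  shows "(log_term p \<alpha> has_sum log_moment p \<alpha>) UNIV"
proof -
  let ?f = "\<lambda>(k, j). log_term p \<alpha> (j, k)"
  let ?g = "\<lambda>k. real (Suc k) ^ p / real (Suc k) * moment p (real (Suc k) * \<alpha>)"
  have inner: "((\<lambda>j. ?f (k, j)) has_sum ?g k) UNIV" for k
  proof -
    have "((\<lambda>j. real (\<Lambda> j) ^ p * exp (- (real (\<Lambda> j) * (real (Suc k) * \<alpha>)))) has_sum moment p (real (Suc k) * \<alpha>)) UNIV"
      unfolding moment_def using \<alpha> by (intro sums_nonneg_imp_has_sum summable_sums summable_moment) auto
    from has_sum_cmult_right[OF this, of "real (Suc k) ^ p / real (Suc k)"]
    show ?thesis by (simp add: log_term_def)
  qed
  have outer: "(?g has_sum log_moment p \<alpha>) UNIV"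
    unfolding log_moment_def
  proof (intro sums_nonneg_imp_has_sum summable_sums summable_log_moment \<alpha>)
    show "0 \<le> ?g k" for k
      using \<alpha> by (intro mult_nonneg_nonneg less_imp_le[OF moment_pos]) auto
  qed
  have "?f summable_on (SIGMA k:UNIV. UNIV)"
    by (rule summable_on_SigmaI[OF inner]) (use outer in \<open>auto simp: has_sum_imp_summable log_term_nonneg\<close>)
  with inner outer have "(?f has_sum log_moment p \<alpha>) (SIGMA k:UNIV. UNIV)"
    by (rule has_sum_SigmaI)
  then have "(?f has_sum log_moment p \<alpha>) (UNIV \<times> UNIV)" by simp
  then show ?thesis by (subst (asm) has_sum_swap) (simp add: case_prod_unfold)
qed

definition gf_term :: "complex \<Rightarrow> nat \<times> nat \<Rightarrow> complex" where
  "gf_term s = (\<lambda>(j, k). exp (- of_nat (Suc k * \<Lambda> j) * s) / of_nat (Suc k))"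

text \<open>Taking the double series as the logarithm avoids choosing a branch for the infinite
  product.\<close>

definition log_gf :: "complex \<Rightarrow> complex" where
  "log_gf s = infsum (gf_term s) UNIV"

lemma norm_gf_term: "norm (gf_term s x) = log_term 0 (Re s) x"
proof (cases x)
  case (Pair j k)
  have "norm (exp (- of_nat (Suc k * \<Lambda> j) * s)) = exp (- (real (\<Lambda> j) * (real (Suc k) * Re s)))"
    by (simp add: algebra_simps)
  then show ?thesis
    unfolding gf_term_def log_term_def Pair prod.case norm_divide norm_of_nat by simp
qed

lemma has_sum_log_gf:
  assumes "0 < Re s"
  shows "(gf_term s has_sum log_gf s) UNIV"
proof -
  have "(\<lambda>x. norm (gf_term s x)) summable_on UNIV"
    unfolding norm_gf_term using has_sum_log_moment[OF assms] by (rule has_sum_imp_summable)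
  then have "gf_term s summable_on UNIV" by (rule abs_summable_summable)
  then show ?thesis unfolding log_gf_def by (rule has_sum_infsum)
qed

lemma log_gf_of_real:
  assumes "0 < \<alpha>"
  shows "log_gf (of_real \<alpha>) = of_real (log_moment 0 \<alpha>)"
proof -
  have "((\<lambda>x. complex_of_real (log_term 0 \<alpha> x)) has_sum of_real (log_moment 0 \<alpha>)) UNIV"
    by (intro has_sum_of_real has_sum_log_moment assms)
  moreover have "complex_of_real (log_term 0 \<alpha> x) = gf_term (of_real \<alpha>) x" for x
  proof (cases x)
    case (Pair j k)
    have "exp (- of_nat (Suc k * \<Lambda> j) * of_real \<alpha>) = complex_of_real (exp (- (real (\<Lambda> j) * (real (Suc k) * \<alpha>))))"
      unfolding exp_of_real[symmetric] by (simp add: algebra_simps)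
    then show ?thesis unfolding gf_term_def log_term_def Pair prod.case by simp
  qed
  ultimately have "(gf_term (of_real \<alpha>) has_sum of_real (log_moment 0 \<alpha>)) UNIV" by simp
  moreover have "(gf_term (of_real \<alpha>) has_sum log_gf (of_real \<alpha>)) UNIV" using assms by (intro has_sum_log_gf) simp
  ultimately show ?thesis by (rule has_sum_unique[symmetric])
qed

text \<open>The principal branch is the right one, since 1 - z has positive real part for norm z < 1
  and the power series gives exactly this value.\<close>

definition factor_log :: "nat \<Rightarrow> complex \<Rightarrow> complex" where
  "factor_log j s = - ln (1 - exp (- of_nat (\<Lambda> j) * s))"

lemma norm_exp_lt_1: "0 < Re s \<Longrightarrow> norm (exp (- of_nat (\<Lambda> j) * s)) < 1"
  using pos[of j] by simp

lemma factor_log_has_sum: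
  assumes s: "0 < Re s"
  shows "((\<lambda>k. gf_term s (j, k)) has_sum factor_log j s) UNIV"
proof -
  let ?z = "exp (- of_nat (\<Lambda> j) * s)"
  have z: "norm (- ?z) < 1" using norm_exp_lt_1[OF s] by simp
  from sums_minus[OF Ln_series'[OF z]]
  have "(\<lambda>n. ?z ^ n / of_nat n) sums factor_log j s" by (simp add: factor_log_def)
  then have "(\<lambda>n. ?z ^ Suc n / of_nat (Suc n)) sums factor_log j s"
    by (subst sums_Suc_iff) simp
  also have "(\<lambda>n. ?z ^ Suc n / of_nat (Suc n)) = (\<lambda>k. gf_term s (j, k))"
    by (simp add: gf_term_def exp_of_nat_mult[symmetric] fun_eq_iff algebra_simps del: power_Suc)
  finally have "(\<lambda>k. gf_term s (j, k)) sums factor_log j s" .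
  moreover have "summable (\<lambda>k. norm (gf_term s (j, k)))"
  proof -
    have "(\<lambda>k. norm (gf_term s (j, k))) summable_on UNIV"
    proof -
      have "log_term 0 (Re s) summable_on (SIGMA j:UNIV. UNIV)"
        using has_sum_log_moment[OF s, of 0] by (auto dest: has_sum_imp_summable)
      then have "(\<lambda>(j, k). norm (gf_term s (j, k))) summable_on (SIGMA j:UNIV. UNIV)"
        by (simp add: norm_gf_term case_prod_unfold)
      then show ?thesis by (rule summable_on_SigmaD1) simp
    qed
    then show ?thesis by (rule summable_on_imp_summable)
  qed
  ultimately show ?thesis by (intro norm_summable_imp_has_sum)
qed

lemma factor_log_sums:
  assumes s: "0 < Re s"
  shows "(\<lambda>j. factor_log j s) sums log_gf s"
proof -
  have "(gf_term s has_sum log_gf s) (SIGMA j:UNIV. UNIV)" using has_sum_log_gf[OF s] by simp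
  then have "((\<lambda>j. factor_log j s) has_sum log_gf s) UNIV"
    by (rule has_sum_SigmaD) (rule factor_log_has_sum[OF s])
  then show ?thesis by (rule has_sum_imp_sums)
qed

lemma prod_factors_tendsto:
  assumes s: "0 < Re s"
  shows "(\<lambda>J. \<Prod>j<J. 1 / (1 - exp (- s) ^ \<Lambda> j)) \<longlonglongrightarrow> exp (log_gf s)"
proof -
  have "(\<lambda>J. exp (\<Sum>j<J. factor_log j s)) \<longlonglongrightarrow> exp (log_gf s)"
    using factor_log_sums[OF s] unfolding sums_def by (rule tendsto_exp)
  moreover have "exp (\<Sum>j<J. factor_log j s) = (\<Prod>j<J. 1 / (1 - exp (- s) ^ \<Lambda> j))" for J
  proof -
    have "exp (factor_log j s) = 1 / (1 - exp (- s) ^ \<Lambda> j)" for j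
    proof -
      have "1 - exp (- of_nat (\<Lambda> j) * s) \<noteq> 0"
      proof
        assume "1 - exp (- of_nat (\<Lambda> j) * s) = 0"
        then have "exp (- of_nat (\<Lambda> j) * s) = 1" by simp
        then show False using norm_exp_lt_1[OF s, of j] by simp
      qed
      moreover have "exp (- ln w) = 1 / w" if "w \<noteq> 0" for w :: complex
        using that by (simp add: exp_minus divide_inverse)
      moreover have "exp (- of_nat (\<Lambda> j) * s) = exp (- s) ^ \<Lambda> j" by (simp add: exp_of_nat_mult[symmetric])
      ultimately show ?thesis unfolding factor_log_def by metis
    qed
    then show ?thesis by (simp add: exp_sum)
  qed
  ultimately show ?thesis by simp
qed

text \<open>Every factor is at least 1, so the partial products increase to their limit.\<close>

lemma ex_prod_factors_bound:
  fixes \<alpha> :: real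
  assumes \<alpha>: "0 < \<alpha>"
  shows "\<exists>B. \<forall>J. (\<Prod>j<J. 1 / (1 - exp (- \<alpha>) ^ \<Lambda> j)) \<le> B"
proof -
  have "(\<lambda>J. complex_of_real (\<Prod>j<J. 1 / (1 - exp (- \<alpha>) ^ \<Lambda> j))) \<longlonglongrightarrow> exp (log_gf (of_real \<alpha>))"
    using prod_factors_tendsto[of "of_real \<alpha>"] \<alpha> by (simp add: exp_of_real[symmetric])
  from tendsto_Re[OF this]
  have lim: "(\<lambda>J. \<Prod>j<J. 1 / (1 - exp (- \<alpha>) ^ \<Lambda> j)) \<longlonglongrightarrow> Re (exp (log_gf (of_real \<alpha>)))" by (simp only: Re_complex_of_real)
  have lt: "exp (- \<alpha>) ^ \<Lambda> j < 1" for j using \<alpha> pos[of j] by (simp add: power_less_one_iff)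
  have "incseq (\<lambda>J. \<Prod>j<J. 1 / (1 - exp (- \<alpha>) ^ \<Lambda> j))"
  proof (rule incseq_SucI)
    fix J
    have "0 \<le> (\<Prod>j<J. 1 / (1 - exp (- \<alpha>) ^ \<Lambda> j))" using lt by (intro prod_nonneg) (auto simp: less_imp_le)
    moreover have "1 \<le> 1 / (1 - exp (- \<alpha>) ^ \<Lambda> J)" using lt[of J] by simp
    ultimately have "(\<Prod>j<J. 1 / (1 - exp (- \<alpha>) ^ \<Lambda> j)) * 1 \<le> (\<Prod>j<J. 1 / (1 - exp (- \<alpha>) ^ \<Lambda> j)) * (1 / (1 - exp (- \<alpha>) ^ \<Lambda> J))"
      by (intro mult_left_mono)
    then show "(\<Prod>j<J. 1 / (1 - exp (- \<alpha>) ^ \<Lambda> j)) \<le> (\<Prod>j<Suc J. 1 / (1 - exp (- \<alpha>) ^ \<Lambda> j))" by simp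
  qed
  then show ?thesis using incseq_le[OF _ lim] by blast
qed

lemma generating_function:
  assumes s: "0 < Re s"
  shows "(\<lambda>n. of_nat (num_partitions \<Lambda> n) * exp (- s) ^ n) sums exp (log_gf s)"
    and "summable (\<lambda>n. real (num_partitions \<Lambda> n) * exp (- Re s) ^ n)"
proof -
  obtain B where B: "\<And>J. (\<Prod>j<J. 1 / (1 - exp (- Re s) ^ \<Lambda> j)) \<le> B" using ex_prod_factors_bound[OF s] by blast
  show "(\<lambda>n. of_nat (num_partitions \<Lambda> n) * exp (- s) ^ n) sums exp (log_gf s)"
    by (rule sums_num_partitions[OF _ _ prod_factors_tendsto[OF s], of B]) (use s B in auto)
  show "summable (\<lambda>n. real (num_partitions \<Lambda> n) * exp (- Re s) ^ n)"
    by (rule summable_num_partitions[OF _ _ B]) (use s in auto)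
qed

text \<open>
  The generating function at \<open>exp (- (\<alpha> + \<i> \<theta>))\<close> relative to its value at \<open>exp (- \<alpha>)\<close>. The phase
  \<open>\<theta> * log_moment 1 \<alpha>\<close> is the \<open>n * \<theta>\<close> of the coefficient integral when \<open>\<alpha>\<close> is the saddle point, and
  it cancels the linear Taylor term.
\<close>
definition gf_ratio :: "real \<Rightarrow> real \<Rightarrow> complex" where
  "gf_ratio \<alpha> \<theta> = exp (log_gf (Complex \<alpha> \<theta>) - of_real (log_moment 0 \<alpha>) + \<i> * of_real (\<theta> * log_moment 1 \<alpha>))"

lemma continuous_on_gf_ratio:
  assumes \<alpha>: "0 < \<alpha>"
  shows "continuous_on S (gf_ratio \<alpha>)"
proof -
  have "continuous_on UNIV (\<lambda>\<theta>. \<Sum>\<^sub>\<infinity>x. gf_term (Complex \<alpha> \<theta>) x)"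
  proof (rule uniform_limit_theorem)
    show "uniform_limit UNIV (\<lambda>X \<theta>. \<Sum>x\<in>X. gf_term (Complex \<alpha> \<theta>) x) (\<lambda>\<theta>. \<Sum>\<^sub>\<infinity>x. gf_term (Complex \<alpha> \<theta>) x) (finite_subsets_at_top UNIV)"
      by (rule Weierstrass_m_test_general[where M = "log_term 0 \<alpha>"])
         (use has_sum_log_moment[OF \<alpha>, of 0] in \<open>auto simp: norm_gf_term dest: has_sum_imp_summable\<close>)
    show "\<forall>\<^sub>F X in finite_subsets_at_top UNIV. continuous_on UNIV (\<lambda>\<theta>. \<Sum>x\<in>X. gf_term (Complex \<alpha> \<theta>) x)"
      unfolding gf_term_def Complex_eq case_prod_unfold
      by (intro always_eventually allI continuous_intros) (auto simp del: of_nat_Suc)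
  qed simp
  then have "continuous_on S (\<lambda>\<theta>. log_gf (Complex \<alpha> \<theta>))"
    unfolding log_gf_def by (rule continuous_on_subset) simp
  then show ?thesis unfolding gf_ratio_def[abs_def] by (intro continuous_intros)
qed

text \<open>Cauchy's coefficient formula on the circle of radius exp (- \<alpha>). By the assumption
  on n the phase in \<open>gf_ratio\<close> is the Fourier kernel cis (n * \<theta>).\<close>

lemma num_partitions_eq_integral:
  assumes \<alpha>: "0 < \<alpha>" and n: "log_moment 1 \<alpha> = real n"
  shows "of_nat (num_partitions \<Lambda> n) = of_real (exp (real n * \<alpha> + log_moment 0 \<alpha>) / (2 * pi)) * integral {-pi..pi} (gf_ratio \<alpha>)"
proof -
  let ?d = "\<lambda>m. of_nat (num_partitions \<Lambda> m) * of_real (exp (- \<alpha>)) ^ m :: complex"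
  have "summable (\<lambda>m. norm (?d m))"
    using generating_function(2)[of "of_real \<alpha>"] \<alpha> by (simp add: norm_mult norm_power)
  from fourier_coefficient_integral[OF this, of n]
  have hi: "((\<lambda>t. cis (real n * t) * (\<Sum>m. ?d m * cis (- (real m * t)))) has_integral (2 * pi * ?d n)) {-pi..pi}" .
  have "cis (real n * t) * (\<Sum>m. ?d m * cis (- (real m * t))) = of_real (exp (log_moment 0 \<alpha>)) * gf_ratio \<alpha> t" for t
  proof -
    have tm: "?d m * cis (- (real m * t)) = of_nat (num_partitions \<Lambda> m) * exp (- Complex \<alpha> t) ^ m" for m
    proof -
      have e1: "of_real (exp (- \<alpha>)) * cis (- t) = exp (- Complex \<alpha> t)"
        by (simp add: cis_conv_exp exp_of_real[symmetric] Complex_eq flip: exp_add)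
      have e2: "cis (- (real m * t)) = cis (- t) ^ m" using Complex.DeMoivre[of "- t" m] by simp
      show ?thesis unfolding e2 e1[symmetric] by (simp only: power_mult_distrib mult.assoc)
    qed
    have "(\<Sum>m. ?d m * cis (- (real m * t))) = exp (log_gf (Complex \<alpha> t))"
      unfolding tm using generating_function(1)[of "Complex \<alpha> t"] \<alpha> by (intro sums_unique[symmetric]) simp
    then show ?thesis
      unfolding gf_ratio_def n by (simp add: cis_conv_exp exp_of_real[symmetric] mult_ac flip: exp_add)
  qed
  with hi have "((\<lambda>t. of_real (exp (log_moment 0 \<alpha>)) * gf_ratio \<alpha> t) has_integral (2 * pi * ?d n)) {-pi..pi}" by simp
  then have "2 * pi * ?d n = integral {-pi..pi} (\<lambda>t. of_real (exp (log_moment 0 \<alpha>)) * gf_ratio \<alpha> t)"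
    by (rule integral_unique[symmetric])
  then have eq: "2 * pi * ?d n = of_real (exp (log_moment 0 \<alpha>)) * integral {-pi..pi} (gf_ratio \<alpha>)" by simp
  have "exp (real n * \<alpha>) * exp (- \<alpha>) ^ n = 1" by (simp flip: exp_of_nat_mult exp_add)
  then have "of_real (exp (real n * \<alpha>)) * of_real (exp (- \<alpha>)) ^ n = (1 :: complex)"
    by (simp only: of_real_mult[symmetric] of_real_power[symmetric] of_real_1)
  then have "of_nat (num_partitions \<Lambda> n) = of_real (exp (real n * \<alpha>) / (2 * pi)) * (2 * pi * ?d n)"
    by (simp add: field_simps)
  then show ?thesis unfolding eq by (simp add: exp_add)
qed

text \<open>Termwise: with l = (k + 1) * \<Lambda> j every \<open>log_term p\<close> is w * l ^ p
  for a common weight w \<ge> 0, so the cubic errors for exp (- \<i> \<theta> l) add up to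
  \<open>log_moment 3\<close>.\<close>

lemma log_gf_taylor:
  assumes \<alpha>: "0 < \<alpha>"
  shows "norm (log_gf (Complex \<alpha> \<theta>) - of_real (log_moment 0 \<alpha>) + \<i> * of_real (\<theta> * log_moment 1 \<alpha>)
      + of_real (\<theta>\<^sup>2 / 2 * log_moment 2 \<alpha>)) \<le> \<bar>\<theta>\<bar> ^ 3 * log_moment 3 \<alpha>"
proof -
  let ?T = "\<lambda>x. gf_term (Complex \<alpha> \<theta>) x - of_real (log_term 0 \<alpha> x) + \<i> * of_real (\<theta> * log_term 1 \<alpha> x)
      + of_real (\<theta>\<^sup>2 / 2 * log_term 2 \<alpha> x)"
  let ?S = "log_gf (Complex \<alpha> \<theta>) - of_real (log_moment 0 \<alpha>) + \<i> * of_real (\<theta> * log_moment 1 \<alpha>)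
      + of_real (\<theta>\<^sup>2 / 2 * log_moment 2 \<alpha>)"
  have "((\<lambda>x. gf_term (Complex \<alpha> \<theta>) x + - of_real (log_term 0 \<alpha> x) + \<i> * of_real (\<theta> * log_term 1 \<alpha> x)
      + of_real (\<theta>\<^sup>2 / 2 * log_term 2 \<alpha> x)) has_sum
    (log_gf (Complex \<alpha> \<theta>) + - of_real (log_moment 0 \<alpha>) + \<i> * of_real (\<theta> * log_moment 1 \<alpha>)
      + of_real (\<theta>\<^sup>2 / 2 * log_moment 2 \<alpha>))) UNIV"
    using \<alpha> by (intro has_sum_add[OF has_sum_add[OF has_sum_add[OF has_sum_log_gf has_sum_uminusI[OF has_sum_of_real[OF has_sum_log_moment]]]
        has_sum_cmult_right[OF has_sum_of_real[OF has_sum_cmult_right[OF has_sum_log_moment]]]]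
        has_sum_of_real[OF has_sum_cmult_right[OF has_sum_log_moment]]]) auto
  then have hs: "(?T has_sum ?S) UNIV" by (simp only: add_uminus_conv_diff)
  have hs3: "((\<lambda>x. \<bar>\<theta>\<bar> ^ 3 * log_term 3 \<alpha> x) has_sum (\<bar>\<theta>\<bar> ^ 3 * log_moment 3 \<alpha>)) UNIV"
    by (intro has_sum_cmult_right has_sum_log_moment \<alpha>)
  have le: "norm (?T x) \<le> \<bar>\<theta>\<bar> ^ 3 * log_term 3 \<alpha> x" for x
  proof (cases x)
    case (Pair j k)
    define l where "l = real (Suc k * \<Lambda> j)"
    define w where "w = exp (- (l * \<alpha>)) / real (Suc k)"
    have w: "0 \<le> w" by (simp add: w_def)
    have l: "0 \<le> l" by (simp add: l_def)
    have lt: "log_term p \<alpha> x = w * l ^ p" for p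
      unfolding log_term_def Pair prod.case w_def l_def of_nat_mult
      by (simp add: power_mult_distrib mult_ac del: of_nat_Suc)
    have "gf_term (Complex \<alpha> \<theta>) x = exp (- (of_real l * Complex \<alpha> \<theta>)) / of_nat (Suc k)"
      unfolding gf_term_def Pair prod.case l_def of_real_of_nat_eq mult_minus_left ..
    also have "exp (- (of_real l * Complex \<alpha> \<theta>)) = exp (of_real (- (l * \<alpha>))) * exp (- \<i> * of_real (\<theta> * l))"
      by (simp add: Complex_eq algebra_simps flip: exp_add)
    finally have g: "gf_term (Complex \<alpha> \<theta>) x = of_real w * exp (- \<i> * of_real (\<theta> * l))"
      unfolding exp_of_real w_def by (simp del: of_nat_Suc)
    have "?T x = of_real w * (exp (- \<i> * of_real (\<theta> * l)) - 1 + \<i> * of_real (\<theta> * l) + of_real ((\<theta> * l)\<^sup>2 / 2))"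
      unfolding g lt by (simp add: power_mult_distrib algebra_simps)
    then have "norm (?T x) = w * norm (exp (- \<i> * of_real (\<theta> * l)) - 1 + \<i> * of_real (\<theta> * l) + of_real ((\<theta> * l)\<^sup>2 / 2))"
      using w by (simp only: norm_mult norm_of_real abs_of_nonneg)
    also have "\<dots> \<le> w * \<bar>\<theta> * l\<bar> ^ 3"
      by (rule mult_left_mono[OF exp_imaginary_taylor_2 w])
    also have "\<dots> = \<bar>\<theta>\<bar> ^ 3 * log_term 3 \<alpha> x"
      unfolding lt using l by (simp add: abs_mult power_mult_distrib)
    finally show ?thesis .
  qed
  have abs: "(\<lambda>x. norm (?T x)) summable_on UNIV"
    by (rule summable_on_comparison_test[OF has_sum_imp_summable[OF hs3]]) (rule le, rule norm_ge_zero)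
  have "norm ?S = norm (infsum ?T UNIV)" using hs by (simp add: infsumI)
  also have "\<dots> \<le> infsum (\<lambda>x. norm (?T x)) UNIV" using abs by (rule norm_infsum_bound)
  also have "\<dots> \<le> infsum (\<lambda>x. \<bar>\<theta>\<bar> ^ 3 * log_term 3 \<alpha> x) UNIV"
    by (rule infsum_mono[OF abs has_sum_imp_summable[OF hs3] le])
  also have "\<dots> = \<bar>\<theta>\<bar> ^ 3 * log_moment 3 \<alpha>" using hs3 by (rule infsumI)
  finally show ?thesis .
qed

end

lemma pi_squared_less_10: "pi\<^sup>2 < 10"
proof -
  have "pi < 3.15" using pi_approx by simp
  then have "pi\<^sup>2 < 3.15\<^sup>2" by (intro power_strict_mono) auto
  then show ?thesis by (simp add: power2_eq_square)
qed

text \<open>The square of x is at most 10, so the quartic term takes at most 10 / 24 of it, and 1 /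
  2 - 10 / 24 = 1 / 12.\<close>

lemma one_minus_cos_ge:
  fixes x :: real
  assumes "\<bar>x\<bar> \<le> pi"
  shows "x\<^sup>2 / 12 \<le> 1 - cos x"
proof -
  have "x\<^sup>2 \<le> pi\<^sup>2" using assms abs_le_square_iff[of x pi] by simp
  then have "x\<^sup>2 \<le> 10" using pi_squared_less_10 by simp
  then have "x\<^sup>2 * x\<^sup>2 \<le> 10 * x\<^sup>2" by (intro mult_right_mono) auto
  moreover have "x ^ 4 = x\<^sup>2 * x\<^sup>2" by (simp flip: power_add)
  ultimately show ?thesis using cos_taylor_4[of x] by linarith
qed

text \<open>With r = exp (- \<alpha>) \<ge> 1 / 3 the squared norm is (1 - r) ^ 2 + 2 * r * (1 - cos
  \<theta>), which is at least \<theta> ^ 2 / 18 and hence at least \<theta> ^ 2 / 25.\<close>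

lemma norm_one_minus_exp_ge:
  assumes "0 < \<alpha>" "\<alpha> \<le> 1" "\<bar>\<theta>\<bar> \<le> pi"
  shows "\<bar>\<theta>\<bar> / 5 \<le> norm (1 - exp (- Complex \<alpha> \<theta>))"
proof -
  define r where "r = exp (- \<alpha>)"
  have "exp 1 \<le> (3::real)" by (rule exp_le)
  then have "1 / 3 \<le> exp (- 1 :: real)" by (simp add: exp_minus field_simps)
  also have "\<dots> \<le> r" using assms by (simp add: r_def)
  finally have r: "1 / 3 \<le> r" .
  have "exp (- Complex \<alpha> \<theta>) = of_real r * cis (- \<theta>)"
    by (simp add: r_def exp_eq_polar)
  then have "(norm (1 - exp (- Complex \<alpha> \<theta>)))\<^sup>2 = (1 - r * cos \<theta>)\<^sup>2 + (r * sin \<theta>)\<^sup>2"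
    by (simp add: cmod_power2)
  also have "\<dots> = 1 - 2 * r * cos \<theta> + r\<^sup>2 * ((cos \<theta>)\<^sup>2 + (sin \<theta>)\<^sup>2)" by algebra
  also have "\<dots> = (1 - r)\<^sup>2 + 2 * r * (1 - cos \<theta>)" by (simp add: power2_eq_square algebra_simps)
  also have "\<dots> \<ge> 2 * (1 / 3) * (\<theta>\<^sup>2 / 12)"
  proof -
    have "2 * (1 / 3) * (\<theta>\<^sup>2 / 12) \<le> 2 * r * (1 - cos \<theta>)"
      using r one_minus_cos_ge[OF assms(3)] by (intro mult_mono) auto
    then show ?thesis using zero_le_power2[of "1 - r"] by linarith
  qed
  finally have "2 * (1 / 3) * (\<theta>\<^sup>2 / 12) \<le> (norm (1 - exp (- Complex \<alpha> \<theta>)))\<^sup>2" .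
  moreover have "(\<bar>\<theta>\<bar> / 5)\<^sup>2 = \<theta>\<^sup>2 / 25" by (simp add: power_divide)
  ultimately have "(\<bar>\<theta>\<bar> / 5)\<^sup>2 \<le> (norm (1 - exp (- Complex \<alpha> \<theta>)))\<^sup>2"
    using zero_le_power2[of \<theta>] by linarith
  then show ?thesis by (rule power2_le_imp_le) simp
qed

subsection \<open>The saddle point\<close>

context admissible_seq
begin

lemma log_moment_1_eq: "log_moment 1 \<alpha> = (\<Sum>k. moment 1 (real (Suc k) * \<alpha>))"
  by (simp add: log_moment_def)

text \<open>Summed over k first, the double series for \<open>log_moment 1\<close> consists of
  geometric series.\<close>

lemma saddle_series:
  assumes \<alpha>: "0 < \<alpha>"
  shows "(\<lambda>j. real (\<Lambda> j) / (exp (\<alpha> * real (\<Lambda> j)) - 1)) sums log_moment 1 \<alpha>"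
proof -
  have inner: "((\<lambda>k. log_term 1 \<alpha> (j, k)) has_sum real (\<Lambda> j) / (exp (\<alpha> * real (\<Lambda> j)) - 1)) UNIV" for j
  proof -
    let ?r = "exp (- (\<alpha> * real (\<Lambda> j)))"
    have r: "?r < 1" using \<alpha> pos[of j] by simp
    have "(\<lambda>k. real (\<Lambda> j) * ?r * ?r ^ k) sums (real (\<Lambda> j) * ?r * (1 / (1 - ?r)))"
      using r by (intro sums_mult geometric_sums) auto
    also have "real (\<Lambda> j) * ?r * (1 / (1 - ?r)) = real (\<Lambda> j) / (exp (\<alpha> * real (\<Lambda> j)) - 1)"
      using r by (simp add: exp_minus field_simps)
    also have "(\<lambda>k. real (\<Lambda> j) * ?r * ?r ^ k) = (\<lambda>k. log_term 1 \<alpha> (j, k))"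
    proof
      fix k
      have "?r * ?r ^ k = exp (real (Suc k) * (- (\<alpha> * real (\<Lambda> j))))"
        by (subst exp_of_nat_mult) simp
      also have "\<dots> = exp (- (real (\<Lambda> j) * (real (Suc k) * \<alpha>)))" by (simp only: mult_minus_right mult_ac)
      finally show "real (\<Lambda> j) * ?r * ?r ^ k = log_term 1 \<alpha> (j, k)"
        by (simp add: log_term_def mult.assoc del: of_nat_Suc)
    qed
    finally show ?thesis by (intro sums_nonneg_imp_has_sum log_term_nonneg)
  qed
  have "(log_term 1 \<alpha> has_sum log_moment 1 \<alpha>) (SIGMA j:UNIV. UNIV)" using has_sum_log_moment[OF \<alpha>] by simp
  then have "((\<lambda>j. real (\<Lambda> j) / (exp (\<alpha> * real (\<Lambda> j)) - 1)) has_sum log_moment 1 \<alpha>) UNIV"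
    by (rule has_sum_SigmaD[OF _ inner])
  then show ?thesis by (rule has_sum_imp_sums)
qed

lemma log_moment_1_strict_antimono:
  assumes "0 < \<alpha>" "\<alpha> < \<beta>"
  shows "log_moment 1 \<beta> < log_moment 1 \<alpha>"
proof -
  have "0 < (\<Sum>j. real (\<Lambda> j) / (exp (\<alpha> * real (\<Lambda> j)) - 1) - real (\<Lambda> j) / (exp (\<beta> * real (\<Lambda> j)) - 1))"
  proof (rule suminf_pos)
    show "summable (\<lambda>j. real (\<Lambda> j) / (exp (\<alpha> * real (\<Lambda> j)) - 1) - real (\<Lambda> j) / (exp (\<beta> * real (\<Lambda> j)) - 1))"
      using saddle_series[of \<alpha>] saddle_series[of \<beta>] assms by (intro summable_diff) (auto simp: sums_iff)
    fix j
    have "1 < exp (\<alpha> * real (\<Lambda> j))" "exp (\<alpha> * real (\<Lambda> j)) < exp (\<beta> * real (\<Lambda> j))"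
      using assms pos[of j] by simp_all
    then show "0 < real (\<Lambda> j) / (exp (\<alpha> * real (\<Lambda> j)) - 1) - real (\<Lambda> j) / (exp (\<beta> * real (\<Lambda> j)) - 1)"
      using pos[of j] unfolding diff_gt_0_iff_gt by (intro divide_strict_left_mono mult_pos_pos) linarith+
  qed
  also have "\<dots> = log_moment 1 \<alpha> - log_moment 1 \<beta>"
    using sums_diff[OF saddle_series[of \<alpha>] saddle_series[of \<beta>]] assms by (simp add: sums_iff)
  finally show ?thesis by simp
qed

lemma isCont_log_moment_1:
  assumes \<alpha>: "0 < \<alpha>"
  shows "isCont (log_moment 1) \<alpha>"
proof -
  let ?S = "{\<alpha> / 2<..}"
  have "uniform_limit ?S (\<lambda>n x. \<Sum>k<n. moment 1 (real (Suc k) * x)) (\<lambda>x. \<Sum>k. moment 1 (real (Suc k) * x)) sequentially"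
  proof (rule Weierstrass_m_test)
    show "summable (\<lambda>k. moment 1 (real (Suc k) * (\<alpha> / 2)))"
      using summable_log_moment[of "\<alpha> / 2" 1] \<alpha> by simp
    fix k x assume x: "x \<in> ?S"
    have le: "real (Suc k) * (\<alpha> / 2) \<le> real (Suc k) * x" using x by (intro mult_left_mono) auto
    have p: "0 < real (Suc k) * (\<alpha> / 2)" using \<alpha> by simp
    have "moment 1 (real (Suc k) * x) \<le> moment 1 (real (Suc k) * (\<alpha> / 2))"
      unfolding moment_def
    proof (rule suminf_le)
      show "real (\<Lambda> j) ^ 1 * exp (- (real (\<Lambda> j) * (real (Suc k) * x))) \<le> real (\<Lambda> j) ^ 1 * exp (- (real (\<Lambda> j) * (real (Suc k) * (\<alpha> / 2))))" for j
        using mult_left_mono[OF le, of "real (\<Lambda> j)"] by (intro mult_left_mono) auto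
      show "summable (\<lambda>j. real (\<Lambda> j) ^ 1 * exp (- (real (\<Lambda> j) * (real (Suc k) * x))))"
        using p le by (intro summable_moment) linarith
      show "summable (\<lambda>j. real (\<Lambda> j) ^ 1 * exp (- (real (\<Lambda> j) * (real (Suc k) * (\<alpha> / 2)))))"
        using p by (rule summable_moment)
    qed
    moreover have "0 < moment 1 (real (Suc k) * x)" using p le by (intro moment_pos) linarith
    ultimately show "norm (moment 1 (real (Suc k) * x)) \<le> moment 1 (real (Suc k) * (\<alpha> / 2))" by simp
  qed
  then have "continuous_on ?S (\<lambda>x. \<Sum>k. moment 1 (real (Suc k) * x))"
  proof (rule uniform_limit_theorem[rotated])
    show "\<forall>\<^sub>F n in sequentially. continuous_on ?S (\<lambda>x. \<Sum>k<n. moment 1 (real (Suc k) * x))"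
      using \<alpha> by (intro always_eventually allI continuous_intros continuous_on_compose2[OF continuous_on_moment]) (auto intro!: mult_pos_pos)
  qed simp
  then have "continuous_on ?S (log_moment 1)" unfolding log_moment_1_eq[abs_def] .
  then show ?thesis using \<alpha> by (simp add: continuous_on_eq_continuous_at)
qed

lemma saddle_properties:
  assumes n: "0 < n"
  shows "0 < saddle \<Lambda> n" "log_moment 1 (saddle \<Lambda> n) = real n"
proof -
  \<comment> \<open>At this point the member 1 alone contributes 1 / (exp a - 1) = n.\<close>
  define a where "a = ln (1 + 1 / real n)"
  have a: "0 < a" unfolding a_def by (rule ln_gt_zero) (use n in simp)
  obtain j1 where j1: "\<Lambda> j1 = 1" using one_in_range by blast
  have "real (\<Lambda> j1) / (exp (a * real (\<Lambda> j1)) - 1) = real n"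
    using n by (simp add: j1 a_def add_pos_pos)
  moreover have "(\<Sum>j\<in>{j1}. real (\<Lambda> j) / (exp (a * real (\<Lambda> j)) - 1)) \<le> (\<Sum>j. real (\<Lambda> j) / (exp (a * real (\<Lambda> j)) - 1))"
    using saddle_series[OF a] a by (intro sum_le_suminf) (auto simp: sums_iff)
  ultimately have upper: "real n \<le> log_moment 1 a"
    using saddle_series[OF a] by (simp add: sums_iff)
  obtain C where C: "0 < C" "\<And>x. 0 < x \<Longrightarrow> log_moment 1 x \<le> C * x powr (- (\<mu>0 + real 1))"
    using ex_log_moment_le[of 1] by blast
  \<comment> \<open>From b \<ge> 1 and b \<ge> C the power bound gives log_moment 1 b \<le> C / b
    \<le> 1 \<le> n.\<close>
  define b where "b = max a (max 1 C)"
  have b: "a \<le> b" "1 \<le> b" "C \<le> b" by (auto simp: b_def)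
  have "log_moment 1 b \<le> C * b powr (- (\<mu>0 + real 1))" using b by (intro C(2)) auto
  also have "\<dots> \<le> C * b powr (- 1)" using b \<mu>0_pos C by (intro mult_left_mono powr_mono) auto
  also have "\<dots> \<le> 1" using b by (simp add: powr_minus divide_inverse[symmetric])
  finally have lower: "log_moment 1 b \<le> real n" using n by simp
  obtain x where x: "a \<le> x" "log_moment 1 x = real n"
    using IVT2[OF lower upper b(1)] isCont_log_moment_1 a by fastforce
  have sums: "(\<lambda>j. real (\<Lambda> j) / (exp (x * real (\<Lambda> j)) - 1)) sums real n"
    using saddle_series[of x] x a by simp
  have "saddle \<Lambda> n = x"
    unfolding saddle_def
  proof (rule the_equality)
    show "0 < x \<and> (\<lambda>j. real (\<Lambda> j) / (exp (x * real (\<Lambda> j)) - 1)) sums real n" using sums x a by simp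
    fix y assume y: "0 < y \<and> (\<lambda>j. real (\<Lambda> j) / (exp (y * real (\<Lambda> j)) - 1)) sums real n"
    then have "log_moment 1 y = log_moment 1 x" using saddle_series[of y] x sums_unique2 by metis
    then show "y = x"
      using log_moment_1_strict_antimono[of x y] log_moment_1_strict_antimono[of y x] x a y by (cases x y rule: linorder_cases) auto
  qed
  then show "0 < saddle \<Lambda> n" "log_moment 1 (saddle \<Lambda> n) = real n" using x a by auto
qed

lemma saddle_tendsto: "filterlim (saddle \<Lambda>) (at_right 0) sequentially"
proof -
  have pos: "\<forall>\<^sub>F n in sequentially. 0 < saddle \<Lambda> n"
    using eventually_gt_at_top[of 0] by eventually_elim (rule saddle_properties)
  have "saddle \<Lambda> \<longlonglongrightarrow> 0"
  proof (rule order_tendstoI)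
    fix e :: real assume e: "0 < e"
    obtain N where N: "log_moment 1 e < real N" using reals_Archimedean2 by blast
    show "\<forall>\<^sub>F n in sequentially. saddle \<Lambda> n < e"
      using eventually_gt_at_top[of 0] eventually_ge_at_top[of N]
    proof eventually_elim
      case (elim n)
      show ?case
      proof (rule ccontr)
        assume "\<not> saddle \<Lambda> n < e"
        then have "log_moment 1 (saddle \<Lambda> n) \<le> log_moment 1 e"
          using log_moment_1_strict_antimono[OF e, of "saddle \<Lambda> n"] by (cases "saddle \<Lambda> n = e") auto
        then show False using saddle_properties(2)[OF elim(1)] N elim by simp
      qed
    qed
  next
    fix e :: real assume "e < 0"
    then show "\<forall>\<^sub>F n in sequentially. e < saddle \<Lambda> n" using pos by (auto elim!: eventually_mono)
  qed
  then show ?thesis using pos by (auto simp: filterlim_at elim!: eventually_mono)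
qed

subsection \<open>Lower bounds for the decay away from the real axis\<close>

definition gap :: "real \<Rightarrow> real \<Rightarrow> real" where
  "gap \<alpha> \<theta> = (\<Sum>j. exp (- (real (\<Lambda> j) * \<alpha>)) * (1 - cos (real (\<Lambda> j) * \<theta>)))"

lemma summable_gap:
  assumes "0 < \<alpha>"
  shows "summable (\<lambda>j. exp (- (real (\<Lambda> j) * \<alpha>)) * (1 - cos (real (\<Lambda> j) * \<theta>)))"
proof (rule summable_comparison_test')
  show "summable (\<lambda>j. exp (- (real (\<Lambda> j) * \<alpha>)) * 2)"
    using summable_theta[OF assms] by (rule summable_mult2)
  show "norm (exp (- (real (\<Lambda> j) * \<alpha>)) * (1 - cos (real (\<Lambda> j) * \<theta>))) \<le> exp (- (real (\<Lambda> j) * \<alpha>)) * 2" if "0 \<le> j" for j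
    using cos_ge_minus_one[of "real (\<Lambda> j) * \<theta>"] by (simp add: abs_mult)
qed

lemma continuous_on_gap:
  assumes "0 < \<alpha>"
  shows "continuous_on S (gap \<alpha>)"
proof -
  have "uniform_limit S (\<lambda>n x. \<Sum>j<n. exp (- (real (\<Lambda> j) * \<alpha>)) * (1 - cos (real (\<Lambda> j) * x)))
     (\<lambda>x. \<Sum>j. exp (- (real (\<Lambda> j) * \<alpha>)) * (1 - cos (real (\<Lambda> j) * x))) sequentially"
  proof (rule Weierstrass_m_test)
    show "summable (\<lambda>j. exp (- (real (\<Lambda> j) * \<alpha>)) * 2)"
      using summable_theta[OF assms] by (rule summable_mult2)
    show "norm (exp (- (real (\<Lambda> j) * \<alpha>)) * (1 - cos (real (\<Lambda> j) * \<theta>))) \<le> exp (- (real (\<Lambda> j) * \<alpha>)) * 2" for j \<theta>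
      using cos_ge_minus_one[of "real (\<Lambda> j) * \<theta>"] by (simp add: abs_mult)
  qed
  then show ?thesis unfolding gap_def[abs_def]
    by (rule uniform_limit_theorem[rotated]) (auto intro!: always_eventually continuous_intros)
qed

text \<open>It allows raising \<alpha> to a multiple of the angle, where the bound near the real
  axis applies.\<close>

lemma gap_antimono:
  assumes "0 < \<alpha>" "\<alpha> \<le> \<beta>"
  shows "gap \<beta> \<theta> \<le> gap \<alpha> \<theta>"
  unfolding gap_def
proof (rule suminf_le)
  fix j
  have "real (\<Lambda> j) * \<alpha> \<le> real (\<Lambda> j) * \<beta>" using assms by (intro mult_left_mono) auto
  then show "exp (- (real (\<Lambda> j) * \<beta>)) * (1 - cos (real (\<Lambda> j) * \<theta>)) \<le> exp (- (real (\<Lambda> j) * \<alpha>)) * (1 - cos (real (\<Lambda> j) * \<theta>))"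
    by (intro mult_right_mono) auto
qed (use assms in \<open>simp_all add: summable_gap\<close>)

lemma gap_diff_le:
  assumes \<alpha>: "0 < \<alpha>"
  shows "gap \<alpha> (x - y) \<le> 2 * gap \<alpha> x + 2 * gap \<alpha> y"
proof -
  let ?t = "\<lambda>z j. exp (- (real (\<Lambda> j) * \<alpha>)) * (1 - cos (real (\<Lambda> j) * z))"
  have "gap \<alpha> (x - y) \<le> (\<Sum>j. 2 * ?t x j + 2 * ?t y j)"
    unfolding gap_def
  proof (intro suminf_le summable_gap summable_add summable_mult \<alpha>)
    fix j
    have "?t (x - y) j \<le> exp (- (real (\<Lambda> j) * \<alpha>)) * (2 * (1 - cos (real (\<Lambda> j) * x)) + 2 * (1 - cos (real (\<Lambda> j) * y)))"
      using one_minus_cos_diff_le[of "real (\<Lambda> j) * x" "real (\<Lambda> j) * y"]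
      by (intro mult_left_mono) (auto simp: right_diff_distrib)
    then show "?t (x - y) j \<le> 2 * ?t x j + 2 * ?t y j" by (simp add: algebra_simps)
  qed
  also have "\<dots> = 2 * gap \<alpha> x + 2 * gap \<alpha> y"
    unfolding gap_def by (intro sums_unique[symmetric] sums_add sums_mult summable_sums summable_gap \<alpha>)
  finally show ?thesis .
qed

lemma gap_ge_moments:
  assumes t: "0 < t"
  shows "\<theta>\<^sup>2 / 2 * moment 2 t - \<theta> ^ 4 / 24 * moment 4 t \<le> gap t \<theta>"
proof -
  let ?m = "\<lambda>q j. real (\<Lambda> j) ^ q * exp (- (real (\<Lambda> j) * t))"
  have "\<theta>\<^sup>2 / 2 * moment 2 t - \<theta> ^ 4 / 24 * moment 4 t = (\<Sum>j. \<theta>\<^sup>2 / 2 * ?m 2 j - \<theta> ^ 4 / 24 * ?m 4 j)"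
    unfolding moment_def by (intro sums_unique sums_diff sums_mult summable_sums summable_moment t)
  also have "\<dots> \<le> gap t \<theta>"
    unfolding gap_def
  proof (intro suminf_le summable_diff summable_mult summable_moment summable_gap t)
    fix j
    have "exp (- (real (\<Lambda> j) * t)) * ((real (\<Lambda> j) * \<theta>)\<^sup>2 / 2 - (real (\<Lambda> j) * \<theta>) ^ 4 / 24) \<le> exp (- (real (\<Lambda> j) * t)) * (1 - cos (real (\<Lambda> j) * \<theta>))"
      using cos_taylor_4 by (intro mult_left_mono) auto
    then show "\<theta>\<^sup>2 / 2 * ?m 2 j - \<theta> ^ 4 / 24 * ?m 4 j \<le> exp (- (real (\<Lambda> j) * t)) * (1 - cos (real (\<Lambda> j) * \<theta>))"
      by (simp add: power_mult_distrib algebra_simps)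
  qed
  finally show ?thesis .
qed

lemma ex_gap_ge_near:
  "\<exists>c>0. \<exists>B\<ge>1. \<exists>t0>0. \<forall>t \<theta>. 0 < t \<and> t < t0 \<and> B * \<bar>\<theta>\<bar> \<le> t \<longrightarrow> c * \<theta>\<^sup>2 * t powr (- (\<mu>0 + 2)) \<le> gap t \<theta>"
proof -
  define L where "L = \<mu>0 * (\<mu>0 + 1) * A (i 0)"
  have l: "0 < L" unfolding L_def using \<mu>0_pos A_i_0_pos by (intro mult_pos_pos) auto
  have "(\<Prod>l<2. i 0 - real l) = \<mu>0 * (\<mu>0 + 1)" by (simp add: numeral_2_eq_2 algebra_simps)
  then have "((\<lambda>t. t powr (\<mu>0 + 2) * moment 2 t) \<longlongrightarrow> L) (at_right 0)"
    using moment_leading[of 2] by (simp add: L_def mult_ac)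
  then have "\<forall>\<^sub>F t in at_right 0. L / 2 < t powr (\<mu>0 + 2) * moment 2 t"
    by (rule order_tendstoD(1)) (use l in linarith)
  then obtain t0 where t0: "0 < t0" "\<And>t. 0 < t \<Longrightarrow> t < t0 \<Longrightarrow> L / 2 < t powr (\<mu>0 + 2) * moment 2 t"
    by (auto simp: eventually_at_right_field)
  obtain C where C: "0 < C" "\<And>t. 0 < t \<Longrightarrow> moment 4 t \<le> C * t powr (- (\<mu>0 + real 4))"
    using ex_moment_le[of 4] by blast
  \<comment> \<open>This B gives C * \<theta> ^ 2 / t ^ 2 \<le> L, so the quartic part takes at most
    L / 24 from the quadratic L / 4 and leaves more than L / 8.\<close>
  define B where "B = max 1 (C / L)"
  have B: "1 \<le> B" "C \<le> L * B" using l by (auto simp: B_def max_def field_simps)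
  have "L / 8 * \<theta>\<^sup>2 * t powr (- (\<mu>0 + 2)) \<le> gap t \<theta>" if t: "0 < t" "t < t0" "B * \<bar>\<theta>\<bar> \<le> t" for t \<theta>
  proof -
    let ?p = "t powr (- (\<mu>0 + 2))"
    have p: "t powr (\<mu>0 + 2) * ?p = 1" using t by (simp flip: powr_add)
    have "L / 2 * ?p \<le> (t powr (\<mu>0 + 2) * moment 2 t) * ?p"
      using t0(2)[OF t(1,2)] by (intro mult_right_mono) auto
    also have "\<dots> = moment 2 t" using p by (simp add: mult_ac)
    finally have m2: "L / 2 * ?p \<le> moment 2 t" .
    have m4: "moment 4 t \<le> C * ?p / t\<^sup>2"
    proof -
      have "t powr (- (\<mu>0 + real 4)) = ?p * t powr (- 2)" by (simp flip: powr_add)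
      also have "t powr (- 2) = 1 / t\<^sup>2" using t by (simp add: powr_minus powr_realpow[of t 2, simplified] divide_inverse)
      finally show ?thesis using C(2)[OF t(1)] by simp
    qed
    have "B\<^sup>2 * \<theta>\<^sup>2 \<le> t\<^sup>2"
      using power_mono[OF t(3), of 2] B by (simp add: power_mult_distrib)
    moreover have "B * \<theta>\<^sup>2 \<le> B\<^sup>2 * \<theta>\<^sup>2" using B by (intro mult_right_mono) (auto simp: power2_eq_square)
    ultimately have Bt: "B * \<theta>\<^sup>2 \<le> t\<^sup>2" by linarith
    have "C * \<theta>\<^sup>2 \<le> L * B * \<theta>\<^sup>2" using B by (intro mult_right_mono) auto
    also have "\<dots> \<le> L * t\<^sup>2" using mult_left_mono[OF Bt less_imp_le[OF l]] by (simp add: mult.assoc)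
    finally have Ct: "C * \<theta>\<^sup>2 / t\<^sup>2 \<le> L" using t by (simp add: divide_le_eq)
    have "\<theta> ^ 4 / 24 * moment 4 t \<le> \<theta> ^ 4 / 24 * (C * ?p / t\<^sup>2)"
      using m4 by (intro mult_left_mono) auto
    also have "\<dots> = \<theta>\<^sup>2 * ?p / 24 * (C * \<theta>\<^sup>2 / t\<^sup>2)"
      by (simp add: power4_eq_xxxx power2_eq_square)
    also have "\<dots> \<le> \<theta>\<^sup>2 * ?p / 24 * L" using Ct by (intro mult_left_mono) auto
    finally have 4: "\<theta> ^ 4 / 24 * moment 4 t \<le> L / 24 * \<theta>\<^sup>2 * ?p" by (simp add: mult_ac)
    have "\<theta>\<^sup>2 / 2 * (L / 2 * ?p) \<le> \<theta>\<^sup>2 / 2 * moment 2 t" using m2 by (intro mult_left_mono) auto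
    then have "L / 4 * \<theta>\<^sup>2 * ?p - L / 24 * \<theta>\<^sup>2 * ?p \<le> gap t \<theta>"
      using 4 gap_ge_moments[OF t(1), of \<theta>] by (simp add: mult_ac)
    moreover have "L / 8 * \<theta>\<^sup>2 * ?p \<le> L / 4 * \<theta>\<^sup>2 * ?p - L / 24 * \<theta>\<^sup>2 * ?p"
    proof -
      have "0 \<le> L * \<theta>\<^sup>2 * ?p" using l by simp
      then show ?thesis by simp
    qed
    ultimately show ?thesis by linarith
  qed
  then show ?thesis using l B t0 by (intro exI[of _ "L / 8"] conjI exI[of _ B] exI[of _ t0]) auto
qed

end

lemma integral_cauchy_density_le:
  fixes v :: real
  assumes v: "0 < v" and h: "0 \<le> h"
  shows "integral {-h..h} (\<lambda>x. 1 / (1 + (x / v)\<^sup>2)) \<le> pi * v"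
proof -
  have "((\<lambda>x. 1 / (1 + (x / v)\<^sup>2)) has_integral (v * arctan (h / v) - v * arctan (- h / v))) {-h..h}"
  proof (rule fundamental_theorem_of_calculus)
    fix x
    show "((\<lambda>x. v * arctan (x / v)) has_vector_derivative 1 / (1 + (x / v)\<^sup>2)) (at x within {-h..h})"
      using v by (auto intro!: derivative_eq_intros simp: has_real_derivative_iff_has_vector_derivative[symmetric] divide_inverse)
  qed (use h in simp)
  then have "integral {-h..h} (\<lambda>x. 1 / (1 + (x / v)\<^sup>2)) = v * (2 * arctan (h / v))"
    by (simp add: integral_unique arctan_minus)
  also have "\<dots> \<le> v * pi" using v arctan_ubound[of "h / v"] by (intro mult_left_mono) auto
  finally show ?thesis by (simp add: mult.commute)
qed

text \<open>By exp (- y) \<le> 1 / (1 + y) the Gaussian is below a function with an elementary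
  primitive; only the order of magnitude in v matters.\<close>

lemma integral_exp_square_le:
  fixes c v :: real
  assumes c: "0 < c" and v: "0 < v" and h: "0 \<le> h"
  shows "integral {-h..h} (\<lambda>x. exp (- (c * (x / v)\<^sup>2))) \<le> pi / sqrt c * v"
proof -
  have "exp (- y) \<le> 1 / (1 + y)" if "0 \<le> y" for y :: real
    using exp_ge_add_one_self[of y] that by (simp add: exp_minus field_simps)
  moreover have "c * (x / v)\<^sup>2 = (x / (v / sqrt c))\<^sup>2" for x
    using c by (simp add: power_divide power_mult_distrib)
  ultimately have "exp (- (c * (x / v)\<^sup>2)) \<le> 1 / (1 + (x / (v / sqrt c))\<^sup>2)" for x by simp
  then have "integral {-h..h} (\<lambda>x. exp (- (c * (x / v)\<^sup>2))) \<le> integral {-h..h} (\<lambda>x. 1 / (1 + (x / (v / sqrt c))\<^sup>2))"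
    using c v by (intro integral_le integrable_continuous_interval continuous_intros) (auto simp: add_nonneg_eq_0_iff)
  also have "\<dots> \<le> pi * (v / sqrt c)" using c v h by (intro integral_cauchy_density_le) auto
  finally show ?thesis by simp
qed

context admissible_seq
begin

lemma norm_gf_ratio: "norm (gf_ratio \<alpha> \<theta>) = exp (Re (log_gf (Complex \<alpha> \<theta>)) - log_moment 0 \<alpha>)"
  by (simp add: gf_ratio_def)

definition factor_gap :: "nat \<Rightarrow> real \<Rightarrow> real \<Rightarrow> real" where
  "factor_gap j \<alpha> \<theta> = Re (factor_log j (of_real \<alpha>)) - Re (factor_log j (Complex \<alpha> \<theta>))"

lemma factor_gap_sums:
  assumes \<alpha>: "0 < \<alpha>"
  shows "(\<lambda>j. factor_gap j \<alpha> \<theta>) sums (log_moment 0 \<alpha> - Re (log_gf (Complex \<alpha> \<theta>)))"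
  unfolding factor_gap_def
  using sums_diff[OF sums_Re[OF factor_log_sums[of "of_real \<alpha>"]] sums_Re[OF factor_log_sums[of "Complex \<alpha> \<theta>"]]] \<alpha>
  by (simp add: log_gf_of_real)

text \<open>The series of the logarithm gives nonnegative terms, of which only k = 0 is
  kept.\<close>

lemma factor_gap_ge:
  assumes \<alpha>: "0 < \<alpha>"
  shows "exp (- (real (\<Lambda> j) * \<alpha>)) * (1 - cos (real (\<Lambda> j) * \<theta>)) \<le> factor_gap j \<alpha> \<theta>"
proof -
  let ?t = "\<lambda>k. Re (gf_term (of_real \<alpha>) (j, k)) - Re (gf_term (Complex \<alpha> \<theta>) (j, k))"
  have s: "?t sums factor_gap j \<alpha> \<theta>"
    unfolding factor_gap_def using \<alpha>
    by (intro sums_diff sums_Re has_sum_imp_sums[OF factor_log_has_sum]) auto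
  have t: "?t k = exp (- (real (Suc k * \<Lambda> j) * \<alpha>)) * (1 - cos (real (Suc k * \<Lambda> j) * \<theta>)) / real (Suc k)" for k
  proof -
    define l where "l = real (Suc k * \<Lambda> j)"
    have e: "gf_term s (j, k) = exp (- of_real l * s) / of_real (real (Suc k))" for s
      unfolding gf_term_def prod.case l_def of_real_of_nat_eq ..
    have "?t k = (exp (- (l * \<alpha>)) - exp (- (l * \<alpha>)) * cos (l * \<theta>)) / real (Suc k)"
      unfolding e Re_divide_of_real by (simp add: Re_exp diff_divide_distrib del: of_nat_Suc)
    then show ?thesis unfolding l_def by (simp add: right_diff_distrib del: of_nat_Suc)
  qed
  have "(\<Sum>k\<in>{0}. ?t k) \<le> (\<Sum>k. ?t k)"
    unfolding t using s[unfolded t] by (intro sum_le_suminf) (auto simp: sums_iff)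
  then show ?thesis using s t[of 0] by (simp add: sums_iff)
qed

lemma norm_gf_ratio_le_gap:
  assumes \<alpha>: "0 < \<alpha>"
  shows "norm (gf_ratio \<alpha> \<theta>) \<le> exp (- gap \<alpha> \<theta>)"
proof -
  have "gap \<alpha> \<theta> \<le> log_moment 0 \<alpha> - Re (log_gf (Complex \<alpha> \<theta>))"
    unfolding gap_def sums_unique[OF factor_gap_sums[OF \<alpha>]]
    using factor_gap_sums[OF \<alpha>] by (intro suminf_le factor_gap_ge summable_gap \<alpha>) (auto simp: sums_iff)
  then show ?thesis unfolding norm_gf_ratio by simp
qed

text \<open>The factor belonging to the member \<open>1\<close> of the sequence supplies the extra \<open>\<alpha> / \<bar>\<theta>\<bar>\<close>.\<close>
lemma norm_gf_ratio_le_gap_far: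
  assumes \<alpha>: "0 < \<alpha>" "\<alpha> \<le> 1" and \<theta>: "\<bar>\<theta>\<bar> \<le> pi" "\<theta> \<noteq> 0"
  shows "norm (gf_ratio \<alpha> \<theta>) \<le> 5 * exp 2 * \<alpha> / \<bar>\<theta>\<bar> * exp (- gap \<alpha> \<theta>)"
proof -
  obtain j1 where j1: "\<Lambda> j1 = 1" using one_in_range by blast
  let ?g = "\<lambda>j. exp (- (real (\<Lambda> j) * \<alpha>)) * (1 - cos (real (\<Lambda> j) * \<theta>))"
  \<comment> \<open>Every factor loses at least its share of the gap, so the full loss at
    \<open>j1\<close> may be used on top of the gap. The share of \<open>j1\<close>, then counted
    twice, is at most 2, whence exp 2.\<close>
  have "(\<lambda>j. factor_gap j \<alpha> \<theta> - ?g j) sums (log_moment 0 \<alpha> - Re (log_gf (Complex \<alpha> \<theta>)) - gap \<alpha> \<theta>)"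
    unfolding gap_def by (intro sums_diff factor_gap_sums summable_sums summable_gap \<alpha>)
  moreover have "0 \<le> factor_gap j \<alpha> \<theta> - ?g j" for j using factor_gap_ge[OF \<alpha>(1)] by simp
  ultimately have "(\<Sum>j\<in>{j1}. factor_gap j \<alpha> \<theta> - ?g j) \<le> log_moment 0 \<alpha> - Re (log_gf (Complex \<alpha> \<theta>)) - gap \<alpha> \<theta>"
    using sum_le_suminf[of "\<lambda>j. factor_gap j \<alpha> \<theta> - ?g j" "{j1}"] by (simp add: sums_iff)
  moreover have "?g j1 \<le> 2"
  proof -
    have "?g j1 \<le> 1 * 2" using \<alpha> cos_ge_minus_one[of \<theta>] by (intro mult_mono) (auto simp: j1)
    then show ?thesis by simp
  qed
  ultimately have 1: "Re (log_gf (Complex \<alpha> \<theta>)) - log_moment 0 \<alpha> \<le> 2 - gap \<alpha> \<theta> - factor_gap j1 \<alpha> \<theta>" by simp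
  define N where "N = norm (1 - exp (- Complex \<alpha> \<theta>))"
  have N: "\<bar>\<theta>\<bar> / 5 \<le> N" unfolding N_def by (rule norm_one_minus_exp_ge[OF \<alpha> \<theta>(1)])
  then have Npos: "0 < N" using \<theta> by linarith
  have e: "0 < 1 - exp (- \<alpha>)" "1 - exp (- \<alpha>) \<le> \<alpha>" using \<alpha> exp_ge_add_one_self[of "- \<alpha>"] by auto
  have "factor_gap j1 \<alpha> \<theta> = ln N - ln (1 - exp (- \<alpha>))"
  proof -
    have nz: "1 - exp (- Complex \<alpha> \<theta>) \<noteq> 0" using Npos by (auto simp: N_def)
    have "Re (factor_log j1 (Complex \<alpha> \<theta>)) = - ln N"
      using nz by (simp add: factor_log_def j1 N_def Re_Ln)
    moreover have "factor_log j1 (of_real \<alpha>) = of_real (- ln (1 - exp (- \<alpha>)))"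
    proof -
      have "factor_log j1 (of_real \<alpha>) = - ln (of_real (1 - exp (- \<alpha>)))"
        by (simp add: factor_log_def j1 flip: exp_of_real)
      then show ?thesis using e by (simp only: Ln_of_real of_real_minus)
    qed
    ultimately show ?thesis by (simp add: factor_gap_def)
  qed
  then have "norm (gf_ratio \<alpha> \<theta>) \<le> exp (2 - gap \<alpha> \<theta> - (ln N - ln (1 - exp (- \<alpha>))))"
    using 1 unfolding norm_gf_ratio by simp
  also have "\<dots> = exp 2 * exp (- gap \<alpha> \<theta>) * (1 - exp (- \<alpha>)) / N"
    using e Npos by (simp add: exp_diff exp_add exp_minus field_simps)
  also have "\<dots> \<le> exp 2 * exp (- gap \<alpha> \<theta>) * \<alpha> / (\<bar>\<theta>\<bar> / 5)"
    using e N \<theta> \<alpha> by (intro frac_le mult_left_mono mult_nonneg_nonneg) auto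
  finally show ?thesis by (simp add: field_simps)
qed

text \<open>
  If the gap is least at \<open>y\<close>, then \<open>gap_diff_le\<close>, a triangle inequality up to a factor \<open>2\<close>, bounds
  \<open>gap \<alpha> x\<close> below by \<open>gap \<alpha> (x - y) / 4\<close>; this moves every interval of length \<open>h\<close> to the origin.
\<close>
lemma integral_exp_gap_interval_le:
  assumes \<alpha>: "0 < \<alpha>" and h: "0 \<le> h"
  shows "integral {a..a + h} (\<lambda>\<theta>. exp (- gap \<alpha> \<theta>)) \<le> integral {-h..h} (\<lambda>\<theta>. exp (- (gap \<alpha> \<theta> / 4)))"
proof -
  have cont: "continuous_on S (\<lambda>\<theta>. exp (- (gap \<alpha> \<theta> / 4)))" "continuous_on S (\<lambda>\<theta>. exp (- gap \<alpha> \<theta>))" for S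
    by (auto intro!: continuous_intros continuous_on_gap \<alpha>)
  obtain y where y: "y \<in> {a..a + h}" "\<And>x. x \<in> {a..a + h} \<Longrightarrow> gap \<alpha> y \<le> gap \<alpha> x"
    using continuous_attains_inf[OF compact_Icc _ continuous_on_gap[OF \<alpha>], of a "a + h"] h by auto
  have "integral {a..a + h} (\<lambda>\<theta>. exp (- gap \<alpha> \<theta>)) \<le> integral {a..a + h} (\<lambda>\<theta>. exp (- (gap \<alpha> (\<theta> - y) / 4)))"
  proof (rule integral_le)
    show "(\<lambda>\<theta>. exp (- gap \<alpha> \<theta>)) integrable_on {a..a + h}" by (intro integrable_continuous_interval cont)
    show "(\<lambda>\<theta>. exp (- (gap \<alpha> (\<theta> - y) / 4))) integrable_on {a..a + h}"
      by (intro integrable_continuous_interval continuous_intros continuous_on_compose2[OF continuous_on_gap[OF \<alpha>, of UNIV]]) auto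
    fix x assume "x \<in> {a..a + h}"
    then show "exp (- gap \<alpha> x) \<le> exp (- (gap \<alpha> (x - y) / 4))"
      using gap_diff_le[OF \<alpha>, of x y] y(2)[of x] by simp
  qed
  also have "\<dots> = integral {a - y..a + h - y} (\<lambda>\<theta>. exp (- (gap \<alpha> \<theta> / 4)))"
    using integral_shift[of "a" "- y" "a + h" "\<lambda>\<theta>. exp (- (gap \<alpha> \<theta> / 4))"] cont(1) by (simp add: o_def)
  also have "\<dots> \<le> integral {-h..h} (\<lambda>\<theta>. exp (- (gap \<alpha> \<theta> / 4)))"
    using y by (intro integral_subset_le integrable_continuous_interval cont) auto
  finally show ?thesis .
qed

lemma integral_exp_gap_multiple_le:
  assumes \<alpha>: "0 < \<alpha>" and h: "0 \<le> h"
  shows "integral {a..a + real K * h} (\<lambda>\<theta>. exp (- gap \<alpha> \<theta>)) \<le> real K * integral {-h..h} (\<lambda>\<theta>. exp (- (gap \<alpha> \<theta> / 4)))"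
proof (induction K)
  case (Suc K)
  have ii: "(\<lambda>\<theta>. exp (- gap \<alpha> \<theta>)) integrable_on {a..a + real (Suc K) * h}"
    by (intro integrable_continuous_interval continuous_intros continuous_on_gap \<alpha>)
  have "integral {a..a + real (Suc K) * h} (\<lambda>\<theta>. exp (- gap \<alpha> \<theta>)) =
    integral {a..a + real K * h} (\<lambda>\<theta>. exp (- gap \<alpha> \<theta>)) + integral {a + real K * h..a + real (Suc K) * h} (\<lambda>\<theta>. exp (- gap \<alpha> \<theta>))"
    by (rule Henstock_Kurzweil_Integration.integral_combine[symmetric, OF _ _ ii]) (use h in \<open>auto simp: algebra_simps\<close>)
  also have "integral {a + real K * h..a + real (Suc K) * h} (\<lambda>\<theta>. exp (- gap \<alpha> \<theta>)) \<le> integral {-h..h} (\<lambda>\<theta>. exp (- (gap \<alpha> \<theta> / 4)))"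
    using integral_exp_gap_interval_le[OF \<alpha> h, of "a + real K * h"] by (simp add: algebra_simps)
  finally show ?case using Suc by (simp add: algebra_simps)
qed simp

lemma integral_exp_gap_le:
  assumes \<alpha>: "0 < \<alpha>" and h: "0 < h" "h \<le> 1"
  shows "integral {-pi..pi} (\<lambda>\<theta>. exp (- gap \<alpha> \<theta>)) \<le> 8 / h * integral {-h..h} (\<lambda>\<theta>. exp (- (gap \<alpha> \<theta> / 4)))"
proof -
  \<comment> \<open>The number of intervals covering the circle; as h \<le> 1, it is at most (2 * pi
    + 1) / h \<le> 8 / h.\<close>
  define K where "K = nat \<lceil>2 * pi / h\<rceil>"
  have ge: "2 * pi / h \<le> real K" unfolding K_def by (simp add: real_nat_ceiling_ge)
  have "0 \<le> 2 * pi / h" using h by simp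
  then have "real K \<le> 2 * pi / h + 1" unfolding K_def using of_int_ceiling_le_add_one[of "2 * pi / h"] by simp
  also have "\<dots> \<le> 2 * pi / h + 1 / h" using h by (simp add: field_simps)
  also have "\<dots> \<le> 8 / h" using h pi_approx by (simp add: add_divide_distrib[symmetric] divide_right_mono)
  finally have K: "real K \<le> 8 / h" .
  have "integral {-pi..pi} (\<lambda>\<theta>. exp (- gap \<alpha> \<theta>)) \<le> integral {-pi..-pi + real K * h} (\<lambda>\<theta>. exp (- gap \<alpha> \<theta>))"
    using ge h by (intro integral_subset_le integrable_continuous_interval continuous_intros continuous_on_gap \<alpha>)
      (auto simp: field_simps)
  also have "\<dots> \<le> real K * integral {-h..h} (\<lambda>\<theta>. exp (- (gap \<alpha> \<theta> / 4)))"
    using h by (intro integral_exp_gap_multiple_le \<alpha>) auto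
  also have "\<dots> \<le> 8 / h * integral {-h..h} (\<lambda>\<theta>. exp (- (gap \<alpha> \<theta> / 4)))"
    using K by (intro mult_right_mono integral_nonneg integrable_continuous_interval continuous_intros continuous_on_gap \<alpha>) auto
  finally show ?thesis .
qed

end

subsection \<open>Major and minor arcs\<close>

text \<open>The constants of \<open>ex_gap_ge_near\<close> are fixed here so that the arcs can be
  defined from them.\<close>

locale gap_bounds = admissible_seq +
  fixes c B t0 :: real
  assumes c_pos: "0 < c" and B_ge: "1 \<le> B" and t0_pos: "0 < t0"
    and gap_ge: "0 < t \<Longrightarrow> t < t0 \<Longrightarrow> B * \<bar>\<theta>\<bar> \<le> t \<Longrightarrow> c * \<theta>\<^sup>2 * t powr (- (\<mu>0 + 2)) \<le> gap t \<theta>"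
begin

definition c' :: real where "c' = c * B powr (- (\<mu>0 + 2))"

lemma c'_pos: "0 < c'"
  using c_pos B_ge by (simp add: c'_def)

text \<open>The exponent - (\<mu>0 + 2) is that of the inverse square of the peak width.\<close>

lemma gap_ge_core:
  assumes "0 < \<alpha>" "\<alpha> < t0" "B * \<bar>\<theta>\<bar> \<le> \<alpha>"
  shows "c * (\<theta> / \<alpha> powr (1 + \<mu>0 / 2))\<^sup>2 \<le> gap \<alpha> \<theta>"
proof -
  have e: "1 + \<mu>0 / 2 + (1 + \<mu>0 / 2) = \<mu>0 + 2" by (simp add: field_simps)
  have sq: "(\<alpha> powr (1 + \<mu>0 / 2))\<^sup>2 = \<alpha> powr (\<mu>0 + 2)"
    unfolding power2_eq_square powr_add[symmetric] e ..
  have "c * (\<theta> / \<alpha> powr (1 + \<mu>0 / 2))\<^sup>2 = c * \<theta>\<^sup>2 * \<alpha> powr (- (\<mu>0 + 2))"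
    unfolding power_divide sq powr_minus_divide by simp
  then show ?thesis using gap_ge[OF assms] by linarith
qed

text \<open>Here \<alpha> is too small for the bound near the axis, but the gap can only decrease
  when \<alpha> is raised to B * |\<theta>|, where that bound just applies. There it is a constant
  times |\<theta>| powr (- \<mu>0), without \<alpha>.\<close>

lemma gap_ge_outside:
  assumes \<alpha>: "0 < \<alpha>" "\<alpha> \<le> B * \<bar>\<theta>\<bar>" and \<theta>: "\<bar>\<theta>\<bar> \<le> h" "B * h < t0"
  shows "c' * h powr (- \<mu>0) \<le> gap \<alpha> \<theta>"
proof -
  have B: "0 < B" using B_ge by simp
  have \<theta>0: "0 < \<bar>\<theta>\<bar>" using \<alpha> B by (auto simp: zero_less_mult_iff dest: less_le_trans)
  have lt: "B * \<bar>\<theta>\<bar> < t0"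
    using mult_left_mono[OF \<theta>(1), of B] \<theta>(2) B by linarith
  have "c * \<theta>\<^sup>2 * (B * \<bar>\<theta>\<bar>) powr (- (\<mu>0 + 2)) \<le> gap (B * \<bar>\<theta>\<bar>) \<theta>"
    using gap_ge[of "B * \<bar>\<theta>\<bar>" \<theta>] B \<theta>0 lt by simp
  also have "\<dots> \<le> gap \<alpha> \<theta>" using \<alpha> by (intro gap_antimono)
  also have "(B * \<bar>\<theta>\<bar>) powr (- (\<mu>0 + 2)) = B powr (- (\<mu>0 + 2)) * \<bar>\<theta>\<bar> powr (- (\<mu>0 + 2))" by (rule powr_mult)
  also have "\<theta>\<^sup>2 = \<bar>\<theta>\<bar> powr 2" using \<theta>0 by (simp add: powr_realpow[of "\<bar>\<theta>\<bar>" 2, simplified])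
  also have "c * \<bar>\<theta>\<bar> powr 2 * (B powr (- (\<mu>0 + 2)) * \<bar>\<theta>\<bar> powr (- (\<mu>0 + 2))) = c' * (\<bar>\<theta>\<bar> powr 2 * \<bar>\<theta>\<bar> powr (- (\<mu>0 + 2)))"
    by (simp only: c'_def mult_ac)
  also have "\<bar>\<theta>\<bar> powr 2 * \<bar>\<theta>\<bar> powr (- (\<mu>0 + 2)) = \<bar>\<theta>\<bar> powr (- \<mu>0)" unfolding powr_add[symmetric] by simp
  finally have "c' * \<bar>\<theta>\<bar> powr (- \<mu>0) \<le> gap \<alpha> \<theta>" .
  moreover have "h powr (- \<mu>0) \<le> \<bar>\<theta>\<bar> powr (- \<mu>0)" using \<theta>0 \<theta> \<mu>0_pos by (intro powr_mono2') auto
  then have "c' * h powr (- \<mu>0) \<le> c' * \<bar>\<theta>\<bar> powr (- \<mu>0)" using c'_pos by (intro mult_left_mono) auto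
  ultimately show ?thesis by linarith
qed

text \<open>The two regimes meet at B * |\<theta>| = \<alpha>; the sum of both bounds serves for
  either.\<close>

lemma integral_quarter_gap_le:
  assumes \<alpha>: "0 < \<alpha>" "\<alpha> < t0" and h: "0 < h" "B * h < t0"
  shows "integral {-h..h} (\<lambda>\<theta>. exp (- (gap \<alpha> \<theta> / 4)))
     \<le> 2 * pi / sqrt c * \<alpha> powr (1 + \<mu>0 / 2) + 2 * h * exp (- (c' * h powr (- \<mu>0) / 4))"
proof -
  let ?u = "\<alpha> powr (1 + \<mu>0 / 2)"
  let ?e = "exp (- (c' * h powr (- \<mu>0) / 4))"
  have u: "0 < ?u" using \<alpha> by simp
  have le: "exp (- (gap \<alpha> \<theta> / 4)) \<le> exp (- (c / 4 * (\<theta> / ?u)\<^sup>2)) + ?e" if "\<theta> \<in> {-h..h}" for \<theta>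
  proof (cases "B * \<bar>\<theta>\<bar> \<le> \<alpha>")
    case True
    have "exp (- (gap \<alpha> \<theta> / 4)) \<le> exp (- (c / 4 * (\<theta> / ?u)\<^sup>2))" using gap_ge_core[OF \<alpha> True] by simp
    then show ?thesis by (rule order_trans) simp
  next
    case False
    have "exp (- (gap \<alpha> \<theta> / 4)) \<le> ?e" using gap_ge_outside[of \<alpha> \<theta> h] \<alpha> False h that by auto
    then show ?thesis by (rule order_trans) simp
  qed
  have "integral {-h..h} (\<lambda>\<theta>. exp (- (gap \<alpha> \<theta> / 4))) \<le> integral {-h..h} (\<lambda>\<theta>. exp (- (c / 4 * (\<theta> / ?u)\<^sup>2)) + ?e)"
    using u by (intro integral_le le integrable_continuous_interval continuous_intros continuous_on_gap \<alpha>) auto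
  also have "\<dots> = integral {-h..h} (\<lambda>\<theta>. exp (- (c / 4 * (\<theta> / ?u)\<^sup>2))) + integral {-h..h} (\<lambda>\<theta>. ?e)"
    using u by (intro Henstock_Kurzweil_Integration.integral_add integrable_continuous_interval continuous_intros) auto
  also have "integral {-h..h} (\<lambda>\<theta>. ?e) = 2 * h * ?e" using h by simp
  also have "integral {-h..h} (\<lambda>\<theta>. exp (- (c / 4 * (\<theta> / ?u)\<^sup>2))) \<le> pi / sqrt (c / 4) * ?u"
    using c_pos u h by (intro integral_exp_square_le) auto
  also have "pi / sqrt (c / 4) = 2 * pi / sqrt c" by (simp add: real_sqrt_divide)
  finally show ?thesis by simp
qed

text \<open>The width \<open>\<eta> \<alpha>\<close> is chosen so that the gap at that distance from the real axis beats a power of \<open>\<alpha>\<close>.\<close>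
definition \<kappa> :: real where
  "\<kappa> = 4 * (\<mu>0 + 2) / c'"

definition \<eta> :: "real \<Rightarrow> real" where
  "\<eta> \<alpha> = (\<kappa> * (- ln \<alpha>)) powr (- 1 / \<mu>0)"

lemma \<kappa>_pos: "0 < \<kappa>"
  unfolding \<kappa>_def by (rule divide_pos_pos[OF _ c'_pos]) (use \<mu>0_pos in simp)

lemma \<eta>_base_pos:
  assumes "0 < \<alpha>" "\<alpha> < 1"
  shows "0 < \<kappa> * (- ln \<alpha>)"
  by (rule mult_pos_pos[OF \<kappa>_pos]) (use ln_less_zero[OF assms] in linarith)

lemma \<eta>_pos: "0 < \<alpha> \<Longrightarrow> \<alpha> < 1 \<Longrightarrow> 0 < \<eta> \<alpha>"
  unfolding \<eta>_def using \<eta>_base_pos[of \<alpha>] by (intro iffD2[OF powr_gt_zero]) linarith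

text \<open>The 4 in \<kappa> offsets the quarter of the gap; \<alpha> powr (\<mu>0 + 2) is the
  square of the peak width, negligible against the peak.\<close>

lemma exp_\<eta>:
  assumes "0 < \<alpha>" "\<alpha> < 1"
  shows "exp (- (c' * \<eta> \<alpha> powr (- \<mu>0) / 4)) = \<alpha> powr (\<mu>0 + 2)"
proof -
  have m: "- 1 / \<mu>0 * - \<mu>0 = 1" using \<mu>0_pos by (simp add: field_simps)
  have "\<eta> \<alpha> powr (- \<mu>0) = \<kappa> * (- ln \<alpha>)"
    unfolding \<eta>_def powr_powr m using \<eta>_base_pos[OF assms] by (intro powr_one) linarith
  moreover have "c' * (\<kappa> * (- ln \<alpha>)) / 4 = - ((\<mu>0 + 2) * ln \<alpha>)"
    unfolding \<kappa>_def using c'_pos by (simp add: field_simps)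
  ultimately have "c' * \<eta> \<alpha> powr (- \<mu>0) / 4 = - ((\<mu>0 + 2) * ln \<alpha>)" by (simp only:)
  then have "- (c' * \<eta> \<alpha> powr (- \<mu>0) / 4) = (\<mu>0 + 2) * ln \<alpha>" by (simp only: minus_minus)
  then have "exp (- (c' * \<eta> \<alpha> powr (- \<mu>0) / 4)) = exp ((\<mu>0 + 2) * ln \<alpha>)" by (rule arg_cong)
  also have "\<dots> = \<alpha> powr (\<mu>0 + 2)" using assms(1) by (simp add: powr_def)
  finally show ?thesis .
qed

lemma \<eta>_tendsto_0: "(\<eta> \<longlongrightarrow> 0) (at_right 0)"
proof -
  have "filterlim (\<lambda>\<alpha>::real. - ln \<alpha>) at_top (at_right 0)" by real_asymp
  then have lim: "filterlim (\<lambda>\<alpha>. \<kappa> * (- ln \<alpha>)) at_top (at_right 0)"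
    by (rule filterlim_tendsto_pos_mult_at_top[OF tendsto_const \<kappa>_pos])
  have "- 1 / \<mu>0 < 0" using \<mu>0_pos by (simp add: divide_neg_pos)
  then show ?thesis unfolding \<eta>_def[abs_def] using lim by (rule tendsto_neg_powr)
qed

text \<open>\<eta> is only a negative power of ln (1 / \<alpha>) up to a constant.\<close>

lemma \<alpha>_over_\<eta>_tendsto_0: "((\<lambda>\<alpha>. \<alpha> / (\<eta> \<alpha>)\<^sup>2) \<longlongrightarrow> 0) (at_right 0)"
proof -
  define p where "p = 2 / \<mu>0"
  have p: "0 < p" unfolding p_def using \<mu>0_pos by (intro divide_pos_pos) linarith+
  have "((\<lambda>\<alpha>. \<alpha> * (- ln \<alpha>) powr p) \<longlongrightarrow> 0) (at_right 0)" using p by real_asymp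
  from tendsto_mult[OF tendsto_const[of "\<kappa> powr p"] this]
  have lim: "((\<lambda>\<alpha>. \<kappa> powr p * (\<alpha> * (- ln \<alpha>) powr p)) \<longlongrightarrow> 0) (at_right 0)" by simp
  have "\<kappa> powr p * (\<alpha> * (- ln \<alpha>) powr p) = \<alpha> / (\<eta> \<alpha>)\<^sup>2" if "0 < \<alpha>" "\<alpha> < 1" for \<alpha>
  proof -
    have e: "- 1 / \<mu>0 + - 1 / \<mu>0 = - p" unfolding p_def by (simp add: field_simps)
    have "(\<eta> \<alpha>)\<^sup>2 = (\<kappa> * (- ln \<alpha>)) powr (- p)"
      unfolding \<eta>_def power2_eq_square powr_add[symmetric] e ..
    then have "\<alpha> / (\<eta> \<alpha>)\<^sup>2 = \<alpha> * (\<kappa> * (- ln \<alpha>)) powr p" by (simp only: powr_minus divide_inverse inverse_inverse_eq)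
    also have "(\<kappa> * (- ln \<alpha>)) powr p = \<kappa> powr p * (- ln \<alpha>) powr p" by (rule powr_mult)
    finally show ?thesis by (simp only: mult_ac)
  qed
  then have "\<forall>\<^sub>F \<alpha> in at_right 0. \<kappa> powr p * (\<alpha> * (- ln \<alpha>) powr p) = \<alpha> / (\<eta> \<alpha>)\<^sup>2"
    unfolding eventually_at_right_field by (intro exI[of _ 1]) auto
  with lim show ?thesis by (rule Lim_transform_eventually)
qed

end

section \<open>The Gaussian limit on the major arc\<close>

lemma gaussian_integral:
  fixes k :: real
  assumes k: "0 < k"
  shows "integrable lborel (\<lambda>x. exp (- (k * x\<^sup>2 / 2)))"
    and "(\<integral>x. exp (- (k * x\<^sup>2 / 2)) \<partial>lborel) = sqrt (2 * pi / k)"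
proof -
  define \<sigma> where "\<sigma> = 1 / sqrt k"
  have \<sigma>: "0 < \<sigma>" "\<sigma>\<^sup>2 = 1 / k" using k by (auto simp: \<sigma>_def power_divide)
  have e: "exp (- (k * x\<^sup>2 / 2)) = sqrt (2 * pi / k) * normal_density 0 \<sigma> x" for x
    using k by (simp add: normal_density_def \<sigma>(2) real_sqrt_divide real_sqrt_mult field_simps)
  show "integrable lborel (\<lambda>x. exp (- (k * x\<^sup>2 / 2)))"
    unfolding e using \<sigma>(1) by (intro integrable_mult_right integrable_normal_density)
  show "(\<integral>x. exp (- (k * x\<^sup>2 / 2)) \<partial>lborel) = sqrt (2 * pi / k)"
    unfolding e using \<sigma>(1) by simp
qed

context admissible_seq
begin

text \<open>The scale of angles \<theta> at which \<theta> ^ 2 * log_moment 2 \<alpha> stays of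
  order 1.\<close>

definition width :: "real \<Rightarrow> real" where "width \<alpha> = \<alpha> powr (1 + \<mu>0 / 2)"

lemma width_pos: "0 < \<alpha> \<Longrightarrow> 0 < width \<alpha>"
  by (simp add: width_def)

text \<open>The limit in \<open>log_moment_2_leading\<close>, that is, the second derivative of the
  logarithm in units of \<open>width\<close>.\<close>

definition curvature :: real where "curvature = \<mu>0 * (\<mu>0 + 1) * riemann_zeta (\<mu>0 + 1) * A (i 0)"

lemma curvature_pos: "0 < curvature"
  unfolding curvature_def using \<mu>0_pos A_i_0_pos riemann_zeta_pos[of "\<mu>0 + 1"] by (intro mult_pos_pos) auto

text \<open>In the scaled variable the cubic Taylor error is of order \<alpha> powr (\<mu>0 / 2),
  the product of width ^ 3 and \<alpha> powr (- (\<mu>0 + 3)).\<close>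

lemma gf_ratio_tendsto: "((\<lambda>\<alpha>. gf_ratio \<alpha> (width \<alpha> * x)) \<longlongrightarrow> of_real (exp (- (curvature * x\<^sup>2 / 2)))) (at_right 0)"
proof -
  obtain C where C: "0 < C" "\<And>\<alpha>. 0 < \<alpha> \<Longrightarrow> log_moment 3 \<alpha> \<le> C * \<alpha> powr (- (\<mu>0 + real 3))"
    using ex_log_moment_le[of 3] by blast
  define E where "E \<alpha> = log_gf (Complex \<alpha> (width \<alpha> * x)) - of_real (log_moment 0 \<alpha>) + \<i> * of_real (width \<alpha> * x * log_moment 1 \<alpha>)" for \<alpha>
  define q where "q \<alpha> = (width \<alpha> * x)\<^sup>2 / 2 * log_moment 2 \<alpha>" for \<alpha>
  have "((\<lambda>\<alpha>. E \<alpha> + of_real (q \<alpha>)) \<longlongrightarrow> 0) (at_right 0)"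
  proof (rule Lim_null_comparison)
    have "norm (E \<alpha> + of_real (q \<alpha>)) \<le> C * \<bar>x\<bar> ^ 3 * \<alpha> powr (\<mu>0 / 2)" if \<alpha>: "0 < \<alpha>" for \<alpha>
    proof -
      have "norm (E \<alpha> + of_real (q \<alpha>)) \<le> \<bar>width \<alpha> * x\<bar> ^ 3 * log_moment 3 \<alpha>"
        unfolding E_def q_def by (rule log_gf_taylor[OF \<alpha>])
      also have "\<dots> \<le> \<bar>width \<alpha> * x\<bar> ^ 3 * (C * \<alpha> powr (- (\<mu>0 + real 3)))"
        using C(2)[OF \<alpha>] by (intro mult_left_mono) auto
      also have "\<bar>width \<alpha> * x\<bar> ^ 3 = width \<alpha> ^ 3 * \<bar>x\<bar> ^ 3" using width_pos[OF \<alpha>] by (simp add: abs_mult power_mult_distrib)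
      also have "width \<alpha> ^ 3 = \<alpha> powr (3 + 3 * \<mu>0 / 2)"
        using \<alpha> by (simp add: width_def powr_power algebra_simps)
      also have "\<alpha> powr (3 + 3 * \<mu>0 / 2) * \<bar>x\<bar> ^ 3 * (C * \<alpha> powr (- (\<mu>0 + real 3))) =
        C * \<bar>x\<bar> ^ 3 * (\<alpha> powr (3 + 3 * \<mu>0 / 2) * \<alpha> powr (- (\<mu>0 + real 3)))" by (simp only: mult_ac)
      also have "\<alpha> powr (3 + 3 * \<mu>0 / 2) * \<alpha> powr (- (\<mu>0 + real 3)) = \<alpha> powr (\<mu>0 / 2)"
        unfolding powr_add[symmetric] by (intro arg_cong[where f = "(powr) \<alpha>"]) (simp add: field_simps)
      finally show ?thesis .
    qed
    then show "\<forall>\<^sub>F \<alpha> in at_right 0. norm (E \<alpha> + of_real (q \<alpha>)) \<le> C * \<bar>x\<bar> ^ 3 * \<alpha> powr (\<mu>0 / 2)"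
      by (intro eventually_mono[OF eventually_at_right_less])
    show "((\<lambda>\<alpha>. C * \<bar>x\<bar> ^ 3 * \<alpha> powr (\<mu>0 / 2)) \<longlongrightarrow> 0) (at_right 0)"
      using tendsto_mult[OF tendsto_const tendsto_powr_at_right_0[of "\<mu>0 / 2"], of "C * \<bar>x\<bar> ^ 3"] \<mu>0_pos by simp
  qed
  moreover have "(q \<longlongrightarrow> curvature * x\<^sup>2 / 2) (at_right 0)"
  proof -
    have "((\<lambda>\<alpha>. \<alpha> powr (\<mu>0 + 2) * log_moment 2 \<alpha>) \<longlongrightarrow> curvature) (at_right 0)"
      unfolding curvature_def by (rule log_moment_2_leading)
    from tendsto_mult[OF this tendsto_const[of "x\<^sup>2 / 2"]]
    have "((\<lambda>\<alpha>. \<alpha> powr (\<mu>0 + 2) * log_moment 2 \<alpha> * (x\<^sup>2 / 2)) \<longlongrightarrow> curvature * x\<^sup>2 / 2) (at_right 0)" by simp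
    moreover have "\<alpha> powr (\<mu>0 + 2) * log_moment 2 \<alpha> * (x\<^sup>2 / 2) = q \<alpha>" if "0 < \<alpha>" for \<alpha>
    proof -
      have "(width \<alpha>)\<^sup>2 = \<alpha> powr (\<mu>0 + 2)" using that by (simp add: width_def powr_power algebra_simps)
      then show ?thesis by (simp add: q_def power_mult_distrib)
    qed
    ultimately show ?thesis
      by (auto elim!: Lim_transform_eventually intro!: eventually_mono[OF eventually_at_right_less])
  qed
  ultimately have "((\<lambda>\<alpha>. exp ((E \<alpha> + of_real (q \<alpha>)) - of_real (q \<alpha>))) \<longlongrightarrow> exp (0 - of_real (curvature * x\<^sup>2 / 2))) (at_right 0)"
    by (intro tendsto_intros)
  moreover have "exp ((E \<alpha> + of_real (q \<alpha>)) - of_real (q \<alpha>)) = gf_ratio \<alpha> (width \<alpha> * x)" for \<alpha>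
    by (simp add: E_def gf_ratio_def)
  moreover have "exp (0 - complex_of_real (curvature * x\<^sup>2 / 2)) = of_real (exp (- (curvature * x\<^sup>2 / 2)))"
    by (simp flip: exp_of_real)
  ultimately show ?thesis by simp
qed

end

context gap_bounds
begin

text \<open>In units of \<open>width\<close> the arc has length of order \<alpha> powr (- \<mu>0 /
  2) and so fills the whole line; on it \<open>gap_ge_core\<close> provides a Gaussian
  majorant.\<close>

lemma core_integral_tendsto:
  "((\<lambda>\<alpha>. integral {-(\<alpha> / B)..\<alpha> / B} (gf_ratio \<alpha>) / of_real (width \<alpha>)) \<longlongrightarrow> of_real (sqrt (2 * pi / curvature))) (at_right 0)"
proof -
  have B: "0 < B" using B_ge by simp
  define G where "G \<alpha> x = indicat_real {-(\<alpha> / B)..\<alpha> / B} (width \<alpha> * x) *\<^sub>R gf_ratio \<alpha> (width \<alpha> * x)" for \<alpha> x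
  have eq: "integral {-(\<alpha> / B)..\<alpha> / B} (gf_ratio \<alpha>) / of_real (width \<alpha>) = integral\<^sup>L lborel (G \<alpha>)"
    and meas: "G \<alpha> \<in> borel_measurable borel" if \<alpha>: "0 < \<alpha>" for \<alpha>
  proof -
    have gf_ratio_meas: "gf_ratio \<alpha> \<in> borel_measurable borel"
      using continuous_on_gf_ratio[OF \<alpha>] by (rule borel_measurable_continuous_onI)
    show "G \<alpha> \<in> borel_measurable borel" unfolding G_def[abs_def] using gf_ratio_meas by measurable
    have "set_integrable lborel {-(\<alpha> / B)..\<alpha> / B} (gf_ratio \<alpha>)"
      unfolding set_integrable_def by (intro borel_integrable_compact continuous_on_gf_ratio \<alpha>) auto
    then have "integral {-(\<alpha> / B)..\<alpha> / B} (gf_ratio \<alpha>) = (\<integral>x. indicat_real {-(\<alpha> / B)..\<alpha> / B} x *\<^sub>R gf_ratio \<alpha> x \<partial>lborel)"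
      using set_borel_integral_eq_integral(2)[of "{-(\<alpha> / B)..\<alpha> / B}" "gf_ratio \<alpha>"] by (simp add: set_lebesgue_integral_def)
    also have "\<dots> = \<bar>width \<alpha>\<bar> *\<^sub>R (\<integral>x. G \<alpha> x \<partial>lborel)"
      unfolding G_def using lborel_integral_real_affine[of "width \<alpha>" "\<lambda>x. indicat_real {-(\<alpha> / B)..\<alpha> / B} x *\<^sub>R gf_ratio \<alpha> x" 0] width_pos[OF \<alpha>]
      by simp
    finally show "integral {-(\<alpha> / B)..\<alpha> / B} (gf_ratio \<alpha>) / of_real (width \<alpha>) = integral\<^sup>L lborel (G \<alpha>)"
      using width_pos[OF \<alpha>] by (simp add: scaleR_conv_of_real)
  qed
  have bound: "norm (G \<alpha> x) \<le> exp (- (2 * c * x\<^sup>2 / 2))" if \<alpha>: "0 < \<alpha>" "\<alpha> < t0" for \<alpha> x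
  proof (cases "width \<alpha> * x \<in> {-(\<alpha> / B)..\<alpha> / B}")
    case True
    then have "\<bar>width \<alpha> * x\<bar> \<le> \<alpha> / B" by auto
    then have "B * \<bar>width \<alpha> * x\<bar> \<le> \<alpha>" using B by (simp add: field_simps)
    from gap_ge_core[OF \<alpha> this] have "c * x\<^sup>2 \<le> gap \<alpha> (width \<alpha> * x)"
      using width_pos[OF \<alpha>(1)] by (simp add: width_def)
    then have "norm (gf_ratio \<alpha> (width \<alpha> * x)) \<le> exp (- (c * x\<^sup>2))"
      using norm_gf_ratio_le_gap[OF \<alpha>(1), of "width \<alpha> * x"] by (elim order_trans) simp
    then show ?thesis using True by (simp add: G_def)
  qed (simp add: G_def)
  have lim: "((\<lambda>\<alpha>. G \<alpha> x) \<longlongrightarrow> of_real (exp (- (curvature * x\<^sup>2 / 2)))) (at_right 0)" for x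
  proof (rule Lim_transform_eventually[OF gf_ratio_tendsto])
    have "((\<lambda>\<alpha>. B * \<bar>x\<bar> * \<alpha> powr (\<mu>0 / 2)) \<longlongrightarrow> 0) (at_right 0)"
      using tendsto_mult[OF tendsto_const tendsto_powr_at_right_0[of "\<mu>0 / 2"], of "B * \<bar>x\<bar>"] \<mu>0_pos by simp
    then have "\<forall>\<^sub>F \<alpha> in at_right 0. B * \<bar>x\<bar> * \<alpha> powr (\<mu>0 / 2) < 1" by (rule order_tendstoD) simp
    then show "\<forall>\<^sub>F \<alpha> in at_right 0. gf_ratio \<alpha> (width \<alpha> * x) = G \<alpha> x"
      using eventually_at_right_less
    proof eventually_elim
      case (elim \<alpha>)
      have "B * \<bar>width \<alpha> * x\<bar> = \<alpha> * (B * \<bar>x\<bar> * \<alpha> powr (\<mu>0 / 2))"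
      proof -
        have "width \<alpha> = \<alpha> powr 1 * \<alpha> powr (\<mu>0 / 2)" unfolding width_def by (rule powr_add)
        then show ?thesis using elim by (simp add: abs_mult)
      qed
      also have "\<dots> \<le> \<alpha> * 1" using elim by (intro mult_left_mono) auto
      finally have "\<bar>width \<alpha> * x\<bar> \<le> \<alpha> / B" using B by (simp add: field_simps)
      then show ?case by (auto simp: G_def indicator_def abs_le_iff)
    qed
  qed
  have "((\<lambda>\<alpha>. integral\<^sup>L lborel (G \<alpha>)) \<longlongrightarrow> of_real (sqrt (2 * pi / curvature))) (at_right 0)"
    unfolding tendsto_at_iff_sequentially
  proof (intro allI impI)
    fix X :: "nat \<Rightarrow> real"
    assume X: "\<forall>n. X n \<in> {0<..} - {0}" "X \<longlonglongrightarrow> 0"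
    have "\<forall>\<^sub>F n in sequentially. X n < t0" using X(2) t0_pos by (rule order_tendstoD)
    then obtain N where N: "\<And>n. n \<ge> N \<Longrightarrow> X n < t0" by (auto simp: eventually_sequentially)
    have Xpos: "0 < X n" for n using X by auto
    have "(\<lambda>n. integral\<^sup>L lborel (G (X (n + N)))) \<longlonglongrightarrow> (\<integral>x. complex_of_real (exp (- (curvature * x\<^sup>2 / 2))) \<partial>lborel)"
    proof (rule integral_dominated_convergence)
      show "integrable lborel (\<lambda>x. exp (- (2 * c * x\<^sup>2 / 2)))"
        using c_pos by (intro gaussian_integral) simp
      show "AE x in lborel. norm (G (X (n + N)) x) \<le> exp (- (2 * c * x\<^sup>2 / 2))" for n
        using Xpos N by (intro AE_I2 bound) auto
      show "G (X (n + N)) \<in> borel_measurable lborel" for n using meas[OF Xpos] by simp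
      show "AE x in lborel. (\<lambda>n. G (X (n + N)) x) \<longlonglongrightarrow> of_real (exp (- (curvature * x\<^sup>2 / 2)))"
      proof (rule AE_I2)
        fix x :: real
        have "(\<lambda>n. G (X n) x) \<longlonglongrightarrow> of_real (exp (- (curvature * x\<^sup>2 / 2)))"
          using lim[of x] X unfolding tendsto_at_iff_sequentially by (auto simp: o_def)
        then show "(\<lambda>n. G (X (n + N)) x) \<longlonglongrightarrow> of_real (exp (- (curvature * x\<^sup>2 / 2)))"
          by (rule LIMSEQ_ignore_initial_segment)
      qed
    qed measurable
    also have "(\<integral>x. complex_of_real (exp (- (curvature * x\<^sup>2 / 2))) \<partial>lborel) = of_real (sqrt (2 * pi / curvature))"
      unfolding gaussian_integral(2)[OF curvature_pos, symmetric] by (rule integral_complex_of_real)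
    finally show "((\<lambda>\<alpha>. integral\<^sup>L lborel (G \<alpha>)) \<circ> X) \<longlonglongrightarrow> of_real (sqrt (2 * pi / curvature))"
      unfolding o_def by (rule LIMSEQ_offset)
  qed
  then show ?thesis
    by (rule Lim_transform_eventually) (auto simp: eq intro!: eventually_mono[OF eventually_at_right_less])
qed

text \<open>Up to \<eta> the gap makes the integrand at most width squared. Beyond \<eta> the extra
  factor is at most 5 * exp 2 * \<alpha> / \<eta>, and covering by intervals of length \<eta> costs
  8 / \<eta>; this explains 40 and \<alpha> / \<eta> ^ 2.\<close>

lemma outer_integral_le:
  assumes \<alpha>: "0 < \<alpha>" "\<alpha> < 1" "\<alpha> < t0" and h: "\<eta> \<alpha> \<le> 1" "B * \<eta> \<alpha> < t0"
  shows "norm (integral {-pi..pi} (gf_ratio \<alpha>) - integral {-(\<alpha> / B)..\<alpha> / B} (gf_ratio \<alpha>)) \<le>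
    width \<alpha> * (2 * pi * width \<alpha> + 40 * exp 2 * (\<alpha> / (\<eta> \<alpha>)\<^sup>2) * (2 * pi / sqrt c + 2 * width \<alpha>))"
proof -
  have B: "0 < B" using B_ge by simp
  have \<eta>0: "0 < \<eta> \<alpha>" using \<alpha> by (intro \<eta>_pos)
  have w: "0 < width \<alpha>" using \<alpha> by (intro width_pos)
  have w2: "\<alpha> powr (\<mu>0 + 2) = (width \<alpha>)\<^sup>2" using \<alpha> by (simp add: width_def powr_power algebra_simps)
  let ?K = "5 * exp 2 * \<alpha> / \<eta> \<alpha>"
  let ?f = "\<lambda>\<theta>. if \<theta> \<in> {-(\<alpha> / B)..\<alpha> / B} then gf_ratio \<alpha> \<theta> else 0"
  let ?b = "\<lambda>\<theta>. (width \<alpha>)\<^sup>2 + ?K * exp (- gap \<alpha> \<theta>)"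
  have "\<alpha> / B \<le> 1" using \<alpha> B_ge by (simp add: divide_le_eq)
  then have sub: "{-(\<alpha> / B)..\<alpha> / B} \<subseteq> {-pi..pi}" using pi_gt3 by auto
  have int_gf_ratio: "gf_ratio \<alpha> integrable_on {a..b}" for a b
    using \<alpha> by (intro integrable_continuous_interval continuous_on_gf_ratio)
  have int_f: "(?f has_integral integral {-(\<alpha> / B)..\<alpha> / B} (gf_ratio \<alpha>)) {-pi..pi}"
    using integrable_integral[OF int_gf_ratio] by (subst has_integral_restrict[OF sub])
  have hd: "((\<lambda>\<theta>. gf_ratio \<alpha> \<theta> - ?f \<theta>) has_integral (integral {-pi..pi} (gf_ratio \<alpha>) - integral {-(\<alpha> / B)..\<alpha> / B} (gf_ratio \<alpha>))) {-pi..pi}"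
    by (intro has_integral_diff integrable_integral[OF int_gf_ratio] int_f)
  have cont_gap: "continuous_on S (\<lambda>\<theta>. exp (- gap \<alpha> \<theta>))" for S
    using \<alpha> by (intro continuous_intros continuous_on_gap)
  have le: "norm (gf_ratio \<alpha> \<theta> - ?f \<theta>) \<le> ?b \<theta>" if \<theta>: "\<theta> \<in> {-pi..pi}" for \<theta>
  proof (cases "\<theta> \<in> {-(\<alpha> / B)..\<alpha> / B}")
    case True
    then show ?thesis using \<alpha> \<eta>0 by simp
  next
    case False
    then have "\<alpha> / B < \<bar>\<theta>\<bar>" by auto
    then have out: "\<alpha> \<le> B * \<bar>\<theta>\<bar>" "\<theta> \<noteq> 0" using B \<alpha> by (auto simp: field_simps)
    show ?thesis
    proof (cases "\<bar>\<theta>\<bar> \<le> \<eta> \<alpha>")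
      case True
      have "norm (gf_ratio \<alpha> \<theta>) \<le> exp (- gap \<alpha> \<theta>)" by (rule norm_gf_ratio_le_gap[OF \<alpha>(1)])
      also have "\<dots> \<le> exp (- (c' * \<eta> \<alpha> powr (- \<mu>0) / 4))"
      proof -
        have "0 \<le> c' * \<eta> \<alpha> powr (- \<mu>0)" using c'_pos by simp
        then show ?thesis using gap_ge_outside[OF \<alpha>(1) out(1) True h(2)] by simp
      qed
      also have "\<dots> = (width \<alpha>)\<^sup>2" using exp_\<eta> \<alpha> w2 by simp
      finally show ?thesis using False \<alpha> \<eta>0 by (simp add: add_increasing2)
    next
      case far: False
      have "norm (gf_ratio \<alpha> \<theta>) \<le> 5 * exp 2 * \<alpha> / \<bar>\<theta>\<bar> * exp (- gap \<alpha> \<theta>)"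
        using \<alpha> \<theta> out by (intro norm_gf_ratio_le_gap_far) auto
      also have "\<dots> \<le> ?K * exp (- gap \<alpha> \<theta>)"
        using far \<alpha> \<eta>0 by (intro mult_right_mono divide_left_mono mult_pos_pos) auto
      also have "\<dots> \<le> ?b \<theta>" by simp
      finally show ?thesis by (simp only: if_not_P[OF False] diff_zero)
    qed
  qed
  have "norm (integral {-pi..pi} (gf_ratio \<alpha>) - integral {-(\<alpha> / B)..\<alpha> / B} (gf_ratio \<alpha>)) =
      norm (integral {-pi..pi} (\<lambda>\<theta>. gf_ratio \<alpha> \<theta> - ?f \<theta>))"
    using hd by (simp add: integral_unique)
  also have "\<dots> \<le> integral {-pi..pi} ?b"
  proof (rule integral_norm_bound_integral[OF has_integral_integrable[OF hd] _ le])
    show "?b integrable_on {-pi..pi}" by (intro integrable_continuous_interval continuous_intros cont_gap)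
  qed
  also have "\<dots> = 2 * pi * (width \<alpha>)\<^sup>2 + ?K * integral {-pi..pi} (\<lambda>\<theta>. exp (- gap \<alpha> \<theta>))"
  proof -
    have "(\<lambda>\<theta>. ?K * exp (- gap \<alpha> \<theta>)) integrable_on {-pi..pi}"
      by (intro integrable_continuous_interval continuous_on_mult continuous_on_const cont_gap)
    from Henstock_Kurzweil_Integration.integral_add[OF integrable_const_ivl this]
    show ?thesis by (simp only: integral_mult_right integral_const_real) (simp add: mult.commute)
  qed
  also have "integral {-pi..pi} (\<lambda>\<theta>. exp (- gap \<alpha> \<theta>)) \<le> 8 / \<eta> \<alpha> * (width \<alpha> * (2 * pi / sqrt c + 2 * width \<alpha>))"
  proof -
    have "integral {-pi..pi} (\<lambda>\<theta>. exp (- gap \<alpha> \<theta>)) \<le> 8 / \<eta> \<alpha> * integral {-\<eta> \<alpha>..\<eta> \<alpha>} (\<lambda>\<theta>. exp (- (gap \<alpha> \<theta> / 4)))"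
      using \<alpha> \<eta>0 h by (intro integral_exp_gap_le)
    also have "\<dots> \<le> 8 / \<eta> \<alpha> * (2 * pi / sqrt c * \<alpha> powr (1 + \<mu>0 / 2) + 2 * \<eta> \<alpha> * exp (- (c' * \<eta> \<alpha> powr (- \<mu>0) / 4)))"
      using \<alpha> \<eta>0 h by (intro mult_left_mono integral_quarter_gap_le) auto
    also have "\<dots> \<le> 8 / \<eta> \<alpha> * (width \<alpha> * (2 * pi / sqrt c + 2 * width \<alpha>))"
    proof (intro mult_left_mono)
      have "2 * \<eta> \<alpha> * (width \<alpha>)\<^sup>2 \<le> 2 * 1 * (width \<alpha>)\<^sup>2" using h by (intro mult_right_mono mult_left_mono) auto
      then show "2 * pi / sqrt c * \<alpha> powr (1 + \<mu>0 / 2) + 2 * \<eta> \<alpha> * exp (- (c' * \<eta> \<alpha> powr (- \<mu>0) / 4)) \<le> width \<alpha> * (2 * pi / sqrt c + 2 * width \<alpha>)"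
        unfolding exp_\<eta>[OF \<alpha>(1,2)] w2 width_def[symmetric] by (simp add: algebra_simps power2_eq_square)
    qed (use \<eta>0 in simp)
    finally show ?thesis .
  qed
  then have "2 * pi * (width \<alpha>)\<^sup>2 + ?K * integral {-pi..pi} (\<lambda>\<theta>. exp (- gap \<alpha> \<theta>)) \<le>
      2 * pi * (width \<alpha>)\<^sup>2 + ?K * (8 / \<eta> \<alpha> * (width \<alpha> * (2 * pi / sqrt c + 2 * width \<alpha>)))"
    using \<alpha> \<eta>0 by (intro add_left_mono mult_left_mono) auto
  also have "\<dots> = width \<alpha> * (2 * pi * width \<alpha> + 40 * exp 2 * (\<alpha> / (\<eta> \<alpha>)\<^sup>2) * (2 * pi / sqrt c + 2 * width \<alpha>))"
    by (simp add: power2_eq_square algebra_simps add_divide_distrib)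
  finally show ?thesis .
qed

lemma outer_integral_tendsto:
  "((\<lambda>\<alpha>. (integral {-pi..pi} (gf_ratio \<alpha>) - integral {-(\<alpha> / B)..\<alpha> / B} (gf_ratio \<alpha>)) / of_real (width \<alpha>)) \<longlongrightarrow> 0) (at_right 0)"
proof (rule Lim_null_comparison)
  have B: "0 < B" using B_ge by simp
  have w0: "(width \<longlongrightarrow> 0) (at_right 0)"
    unfolding width_def[abs_def] using \<mu>0_pos by (intro tendsto_powr_at_right_0) simp
  have "\<forall>\<^sub>F \<alpha> in at_right 0. \<eta> \<alpha> < min 1 (t0 / B)"
    using \<eta>_tendsto_0 by (rule order_tendstoD) (use B t0_pos in simp)
  moreover have "\<forall>\<^sub>F \<alpha> in at_right 0. \<alpha> < min 1 t0"
    using eventually_at_right_real[of 0 "min 1 t0"] t0_pos by (auto elim: eventually_mono)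
  ultimately show "\<forall>\<^sub>F \<alpha> in at_right 0. norm ((integral {-pi..pi} (gf_ratio \<alpha>) - integral {-(\<alpha> / B)..\<alpha> / B} (gf_ratio \<alpha>)) / of_real (width \<alpha>)) \<le>
      2 * pi * width \<alpha> + 40 * exp 2 * (\<alpha> / (\<eta> \<alpha>)\<^sup>2) * (2 * pi / sqrt c + 2 * width \<alpha>)"
    using eventually_at_right_less
  proof eventually_elim
    case (elim \<alpha>)
    then have "B * \<eta> \<alpha> < t0" using B by (simp add: field_simps)
    then show ?case
      using outer_integral_le[of \<alpha>] elim width_pos[of \<alpha>] by (simp add: norm_divide divide_le_eq mult.commute)
  qed
  have "((\<lambda>\<alpha>. 2 * pi * width \<alpha> + 40 * exp 2 * (\<alpha> / (\<eta> \<alpha>)\<^sup>2) * (2 * pi / sqrt c + 2 * width \<alpha>)) \<longlongrightarrow>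
      2 * pi * 0 + 40 * exp 2 * 0 * (2 * pi / sqrt c + 2 * 0)) (at_right 0)"
    by (intro tendsto_intros w0 \<alpha>_over_\<eta>_tendsto_0)
  then show "((\<lambda>\<alpha>. 2 * pi * width \<alpha> + 40 * exp 2 * (\<alpha> / (\<eta> \<alpha>)\<^sup>2) * (2 * pi / sqrt c + 2 * width \<alpha>)) \<longlongrightarrow> 0) (at_right 0)"
    by simp
qed

lemma gf_ratio_integral_tendsto_aux:
  "((\<lambda>\<alpha>. integral {-pi..pi} (gf_ratio \<alpha>) / of_real (width \<alpha>)) \<longlongrightarrow> of_real (sqrt (2 * pi / curvature))) (at_right 0)"
  using tendsto_add[OF outer_integral_tendsto core_integral_tendsto] by (simp add: diff_divide_distrib)

end

section \<open>Assembly of the asymptotic formula\<close>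

lemma (in admissible_seq) gf_ratio_integral_tendsto:
  "((\<lambda>\<alpha>. integral {-pi..pi} (gf_ratio \<alpha>) / of_real (width \<alpha>)) \<longlongrightarrow> of_real (sqrt (2 * pi / curvature))) (at_right 0)"
proof -
  obtain c B t0 where "0 < c" "1 \<le> B" "0 < t0"
    "\<And>t \<theta>. 0 < t \<Longrightarrow> t < t0 \<Longrightarrow> B * \<bar>\<theta>\<bar> \<le> t \<Longrightarrow> c * \<theta>\<^sup>2 * t powr (- (\<mu>0 + 2)) \<le> gap t \<theta>"
    using ex_gap_ge_near by blast
  then interpret gap_bounds \<Lambda> i A c B t0
    by unfold_locales
  show ?thesis by (rule gf_ratio_integral_tendsto_aux)
qed

text \<open>The quotient is shown to tend to 1 as a function of \<alpha>, before the saddle point is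
  substituted. In the power of \<alpha>, 1 + \<mu>0 / 2 comes from \<open>width\<close> and - A 0
  from the logarithmic term; the constant is sqrt (2 * pi / curvature) / (2 * pi).\<close>

lemma (in admissible_split) num_partitions_asymp_equiv:
  "(\<lambda>n. real (num_partitions \<Lambda> n)) \<sim>[sequentially]
    (\<lambda>n. (2 * pi * curvature) powr (- 1 / 2) * saddle \<Lambda> n powr (\<mu>0 / 2 + 1 - A 0)
      * exp ((\<Sum>k\<le>d. (1 - i k) * A (i k) * saddle \<Lambda> n powr i k * riemann_zeta (1 - i k)) + A 0 + Re (deriv (zeta_seq \<Lambda> \<mu>0) 0)))"
    (is "_ \<sim>[_] (\<lambda>n. ?R (saddle \<Lambda> n))")
proof -
  let ?Z = "Re (deriv (zeta_seq \<Lambda> \<mu>0) 0)"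
  let ?S0 = "\<lambda>\<alpha>. \<Sum>n\<le>d. A (i n) * \<alpha> powr i n * riemann_zeta (1 - i n)"
  let ?S1 = "\<lambda>\<alpha>. \<Sum>n\<le>d. - i n * A (i n) * \<alpha> powr i n * riemann_zeta (1 - i n)"
  let ?L = "\<lambda>\<alpha>. exp (\<alpha> * log_moment 1 \<alpha> + log_moment 0 \<alpha>) / (2 * pi) * Re (integral {-pi..pi} (gf_ratio \<alpha>))"
  \<comment> \<open>The true exponent minus the claimed one, with - A 0 * ln \<alpha> counted as
    part of the latter; it tends to 0.\<close>
  let ?X = "\<lambda>\<alpha>. (log_moment 0 \<alpha> - ?S0 \<alpha> + A 0 * ln \<alpha>) + (\<alpha> * log_moment 1 \<alpha> - ?S1 \<alpha>) - A 0 - ?Z"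
  let ?Y = "\<lambda>\<alpha>. Re (integral {-pi..pi} (gf_ratio \<alpha>) / of_real (width \<alpha>))"
  have Z: "?Z = (LINT t:{0<..}|lborel. const_integrand t)" by (simp add: deriv_zeta_seq_0)
  have k: "0 < curvature" by (rule curvature_pos)
  have "((\<lambda>\<alpha>. exp (?X \<alpha>) * ?Y \<alpha> * (sqrt (2 * pi * curvature) / (2 * pi))) \<longlongrightarrow>
      exp (?Z + A 0 - A 0 - ?Z) * Re (of_real (sqrt (2 * pi / curvature))) * (sqrt (2 * pi * curvature) / (2 * pi))) (at_right 0)"
    unfolding Z
    by (rule tendsto_mult[OF tendsto_mult[OF tendsto_exp[OF tendsto_diff[OF tendsto_diff[OF
          tendsto_add[OF log_moment_0_expansion log_moment_1_expansion] tendsto_const] tendsto_const]]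
          tendsto_Re[OF gf_ratio_integral_tendsto]] tendsto_const])
  also have "exp (?Z + A 0 - A 0 - ?Z) * Re (of_real (sqrt (2 * pi / curvature))) * (sqrt (2 * pi * curvature) / (2 * pi)) = 1"
  proof -
    have "sqrt (2 * pi / curvature) * sqrt (2 * pi * curvature) = sqrt ((2 * pi)\<^sup>2)"
      using k by (simp add: power2_eq_square flip: real_sqrt_mult)
    also have "\<dots> = 2 * pi" by (subst real_sqrt_abs) simp
    finally have "sqrt (2 * pi / curvature) * sqrt (2 * pi * curvature) / (2 * pi) = 1" by simp
    moreover have "exp (?Z + A 0 - A 0 - ?Z) = 1" by simp
    ultimately show ?thesis by (simp only: Re_complex_of_real mult_1_left times_divide_eq_right)
  qed
  finally have lim: "((\<lambda>\<alpha>. exp (?X \<alpha>) * ?Y \<alpha> * (sqrt (2 * pi * curvature) / (2 * pi))) \<longlongrightarrow> 1) (at_right 0)" .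
  have quot: "exp (?X \<alpha>) * ?Y \<alpha> * (sqrt (2 * pi * curvature) / (2 * pi)) = ?L \<alpha> / ?R \<alpha>" if \<alpha>: "0 < \<alpha>" for \<alpha>
  proof -
    have S: "(\<Sum>k\<le>d. (1 - i k) * A (i k) * \<alpha> powr i k * riemann_zeta (1 - i k)) = ?S0 \<alpha> + ?S1 \<alpha>"
      unfolding sum.distrib[symmetric] by (intro sum.cong) (auto simp: algebra_simps)
    have 1: "exp (?X \<alpha>) = exp (\<alpha> * log_moment 1 \<alpha> + log_moment 0 \<alpha>) * \<alpha> powr A 0 / exp (?S0 \<alpha> + ?S1 \<alpha> + A 0 + ?Z)"
    proof -
      have "\<alpha> powr A 0 = exp (A 0 * ln \<alpha>)" using \<alpha> by (simp add: powr_def)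
      then show ?thesis by (simp add: algebra_simps flip: exp_add exp_diff)
    qed
    have 2: "?Y \<alpha> = Re (integral {-pi..pi} (gf_ratio \<alpha>)) / \<alpha> powr (1 + \<mu>0 / 2)" by (simp add: width_def)
    have 3: "(2 * pi * curvature) powr (- 1 / 2) = 1 / sqrt (2 * pi * curvature)"
      using powr_half_sqrt[of "2 * pi * curvature"] k
      by (simp only: powr_minus_divide minus_divide_left[symmetric]) simp
    have 4: "\<alpha> powr (\<mu>0 / 2 + 1 - A 0) = \<alpha> powr (1 + \<mu>0 / 2) / \<alpha> powr A 0"
      unfolding powr_diff[symmetric] by (simp only: add.commute)
    have eq: "E * p / D * (I / q) * (r / (2 * pi)) = E / (2 * pi) * I / (1 / r * (q / p) * D)" for E p D I q r :: real
      by (simp add: ac_simps)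
    show ?thesis unfolding S 1 2 3 4 by (rule eq)
  qed
  have "((\<lambda>\<alpha>. ?L \<alpha> / ?R \<alpha>) \<longlongrightarrow> 1) (at_right 0)"
    by (rule Lim_transform_eventually[OF lim]) (intro eventually_mono[OF eventually_at_right_less] quot)
  from filterlim_compose[OF this saddle_tendsto]
  have "(\<lambda>n. ?L (saddle \<Lambda> n) / ?R (saddle \<Lambda> n)) \<longlonglongrightarrow> 1" .
  moreover have "\<forall>\<^sub>F n in sequentially. ?L (saddle \<Lambda> n) / ?R (saddle \<Lambda> n) = real (num_partitions \<Lambda> n) / ?R (saddle \<Lambda> n)"
    using eventually_gt_at_top[of 0]
  proof eventually_elim
    case (elim n)
    note s = saddle_properties[OF elim]
    have "real (num_partitions \<Lambda> n) = Re (of_nat (num_partitions \<Lambda> n))" by simp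
    also have "\<dots> = ?L (saddle \<Lambda> n)"
      unfolding num_partitions_eq_integral[OF s] s(2) Re_complex_of_real by (simp add: mult.commute)
    finally show ?case by simp
  qed
  ultimately have "(\<lambda>n. real (num_partitions \<Lambda> n) / ?R (saddle \<Lambda> n)) \<longlonglongrightarrow> 1"
    by (rule Lim_transform_eventually)
  then show ?thesis by (rule asymp_equivI')
qed

theorem theorem1:
  fixes \<Lambda> :: "nat \<Rightarrow> nat" and i \<mu> :: "nat \<Rightarrow> real" and A :: "real \<Rightarrow> real" and d :: nat
    and \<alpha> :: "nat \<Rightarrow> real"
  assumes "admissible \<Lambda> i A"
    and "\<And>n. \<mu> n = - i n"
    and "\<And>n. \<mu> n > 0 \<longleftrightarrow> n \<le> d"
    and "\<And>n. \<alpha> n = saddle \<Lambda> n"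
  shows "(\<lambda>n. real (num_partitions \<Lambda> n)) \<sim>[sequentially]
    (\<lambda>n. (2 * pi * \<mu> 0 * (\<mu> 0 + 1) * riemann_zeta (\<mu> 0 + 1) * A (- \<mu> 0)) powr (- 1 / 2)
        * \<alpha> n powr (\<mu> 0 / 2 + 1 - A 0)
        * exp ((\<Sum>k\<le>d. (\<mu> k + 1) / (\<alpha> n powr \<mu> k) * riemann_zeta (\<mu> k + 1) * A (- \<mu> k))
               + A 0 + Re (deriv (zeta_seq \<Lambda> (\<mu> 0)) 0)))"
proof -
  interpret admissible_split \<Lambda> i A d
    using assms by unfold_locales auto
  have S: "(- i k + 1) / (saddle \<Lambda> n powr (- i k)) * riemann_zeta (- i k + 1) * A (- (- i k))
      = (1 - i k) * A (i k) * saddle \<Lambda> n powr i k * riemann_zeta (1 - i k)" for k n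
    by (simp add: powr_minus divide_inverse)
  have K: "2 * pi * \<mu>0 * (\<mu>0 + 1) * riemann_zeta (\<mu>0 + 1) * A (- \<mu>0) = 2 * pi * curvature"
    by (simp add: curvature_def)
  show ?thesis
    unfolding assms(2,4) S K by (rule num_partitions_asymp_equiv)
qed

end
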